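(* Let $\Phi:\mathcal{P}\to\mathcal{Q}$ be a cartesian map between indexed frames $\mathcal{P},\mathcal{Q}:\mathbb{C}^{\mathrm{op}}\to\mathbf{Pos}$, and let $\mathbb{C}\langle\Phi\rangle:\mathbb{C}\langle\mathcal{P}\rangle\to\mathbb{C}\langle\mathcal{Q}\rangle$ be the induced functor, sending $(A,\rho)$ to $(A,\Phi_{A\times A}(\rho))$ and each morphism to the morphism with the same underlying map in $\mathbb{C}$. Let $E_{\mathcal{P}}:\mathbb{C}\langle\mathcal{P}\rangle\to\mathbb{C}[\mathcal{P}]$ and $E_{\mathcal{Q}}:\mathbb{C}\langle\mathcal{Q}\rangle\to\mathbb{C}[\mathcal{Q}]$ be the localization functors. (i) The functor $\mathbb{C}\langle\Phi\rangle$ preserves finite limits. (ii) $E_{\mathcal{Q}}(\mathbb{C}\langle\Phi\rangle(f))=E_{\mathcal{Q}}(\mathbb{C}\langle\Phi\rangle(g))$ for all parallel maps $f,g$ in $\mathbb{C}\langle\mathcal{P}\rangle$ with $E_{\mathcal{P}}(f)=E_{\mathcal{P}}(g)$. (iii) If $\mathcal{P}$ is a tripos then $\mathbb{C}\langle\Phi\rangle$ admits a right derived functor. (iv) If $\mathcal{P}$ has enough $\exists$-prime predicates then $\mathbb{C}\langle\Phi\rangle$ admits a left derived functor.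
   Context: **Indexed frames.** An indexed poset on a category $\mathbb{C}$ is a functor $\mathcal{A}:\mathbb{C}^{\mathrm{op}}\to\mathbf{Pos}$ to posets and monotone maps (default size convention: $\mathbb{C}$ and the posets are small); for $f:J\to I$ write $f^*=\mathcal{A}(f)$; elements of $\mathcal{A}(I)$ are called predicates on $I$. It is an indexed meet-semilattice if every $\mathcal{A}(I)$ has finite meets (including a greatest element $\top$) and all $f^*$ preserve them. An indexed frame is an indexed meet-semilattice $\mathcal{P}$ on a category $\mathbb{C}$ with finite limits such that: (Ex) every $f^*$ has a left adjoint $\exists_f$; (Fr) $(\exists_f\varphi)\wedge\psi=\exists_f(\varphi\wedge f^*\psi)$ for $f:J\to I$, $\varphi\in\mathcal{P}(J)$, $\psi\in\mathcal{P}(I)$; (BC) $\exists_h\circ k^*=f^*\circ\exists_g$ for every pullback square in $\mathbb{C}$ with $fh=gk$, $h:D\to A$, $k:D\to B$, $f:A\to C$, $g:B\to C$. An indexed monotone map is a natural transformation; it is cartesian if it preserves fiberwise finite meets. **Triposes.** A tripos is an indexed frame $\mathcal{P}$ such that all fibers are Heyting algebras, all $f^*$ also have right adjoints $\forall_f$, and for every $I\in\mathbb{C}$ there are an object $\mathfrak{P}(I)\in\mathbb{C}$ and $\varepsilon_I\in\mathcal{P}(I\times\mathfrak{P}(I))$ such that for all $J$ and $\varphi\in\mathcal{P}(I\times J)$ there is a (not necessarily unique) $\ulcorner\varphi\urcorner:J\to\mathfrak{P}(I)$ with $(I\times\ulcorner\varphi\urcorner)^*(\varepsilon_I)=\varphi$.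 **$\exists$-prime predicates.** A predicate $\varpi\in\mathcal{P}(I)$ of an indexed frame is $\exists$-prime if for all $u:J\to I$, $v:K\to J$ and $\psi\in\mathcal{P}(K)$ with $u^*\varpi\le\exists_v\psi$ there is a section $s$ of $v$ with $u^*\varpi\le s^*\psi$. $\mathcal{P}$ has enough $\exists$-prime predicates if for every $\varphi\in\mathcal{P}(I)$ there are an $\exists$-prime $\varpi\in\mathcal{P}(J)$ and $f:J\to I$ with $\varphi=\exists_f\varpi$. **Internal language.** Sorts are objects of $\mathbb{C}$; function symbols of arity $A_1,\dots,A_n\to B$ are morphisms $A_1\times\dots\times A_n\to B$; relation symbols of arity $A_1,\dots,A_n$ are elements of $\mathcal{P}(A_1\times\dots\times A_n)$. Formulas are built from $\varphi(\vec t)$ and $s=t$ using $\wedge,\top,\exists$. For a context $\vec x=x_1,\dots,x_n$ let $\mathfrak{s}(\vec x)$ be the product of the sorts. Terms in context are interpreted as morphisms out of $\mathfrak{s}(\vec x)$ (variables as projections, application as composition), formulas as predicates on $\mathfrak{s}(\vec x)$: $[\![\varphi(t_1,\dots,t_n)]\!]_{\vec x}=\langle[\![t_1]\!]_{\vec x},\dots,[\![t_n]\!]_{\vec x}\rangle^*\varphi$; $[\![t=u]\!]_{\vec x}=\langle[\![t]\!]_{\vec x},[\![u]\!]_{\vec x}\rangle^*(\exists_\delta\top)$ with $\delta$ the diagonal; $\wedge,\top$ fiberwise; $[\![\exists y.\,P]\!]_{\vec x}=\exists_\pi[\![P]\!]_{\vec x,y}$ with $\pi$ the projection forgetting $y$.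 A judgment $P_1,\dots,P_n\vdash_{\vec x}Q$ holds if $[\![P_1]\!]_{\vec x}\wedge\dots\wedge[\![P_n]\!]_{\vec x}\le[\![Q]\!]_{\vec x}$. Writing $\varphi(\vec x)\equiv P$ defines $\varphi:=[\![P]\!]_{\vec x}$. **The category $\mathbb{C}\langle\mathcal{P}\rangle$.** Objects are pairs $(A,\rho)$ with $A\in\mathbb{C}$ and $\rho\in\mathcal{P}(A\times A)$ such that $\rho(x,y)\vdash_{x,y}\rho(y,x)$ and $\rho(x,y),\rho(y,z)\vdash_{x,y,z}\rho(x,z)$ hold. Morphisms $(A,\rho)\to(B,\sigma)$ are maps $f:A\to B$ in $\mathbb{C}$ such that $\rho(x,y)\vdash_{x,y}\sigma(fx,fy)$ holds; composition and identities are those of $\mathbb{C}$. We abbreviate $\rho(x,x)$ by $\rho x$. A morphism $f:(A,\rho)\to(B,\sigma)$ is a weak equivalence if $\rho x,\sigma(fx,fy),\rho y\vdash_{x,y}\rho(x,y)$ and $\sigma u\vdash_u\exists x.\,\rho x\wedge\sigma(fx,u)$ hold. **The category $\mathbb{C}[\mathcal{P}]$ and the localization functor.** $\mathbb{C}[\mathcal{P}]$ has the same objects as $\mathbb{C}\langle\mathcal{P}\rangle$; morphisms $(A,\rho)\to(B,\sigma)$ are predicates $\phi\in\mathcal{P}(A\times B)$ satisfying $\phi(x,u)\vdash_{x,u}\rho x\wedge\sigma u$; $\ \rho(y,x),\phi(x,u),\sigma(u,v)\vdash_{x,y,u,v}\phi(y,v)$; $\ \phi(x,u),\phi(x,v)\vdash_{x,u,v}\sigma(u,v)$;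 $\ \rho x\vdash_x\exists u.\,\phi(x,u)$. Composition is $(\gamma\circ\phi)(x,r)\equiv\exists u.\,\phi(x,u)\wedge\gamma(u,r)$; the identity on $(A,\rho)$ is $\rho$. The functor $E_{\mathcal{P}}:\mathbb{C}\langle\mathcal{P}\rangle\to\mathbb{C}[\mathcal{P}]$ is the identity on objects and $E_{\mathcal{P}}(f)(x,u)\equiv\rho x\wedge\sigma(fx,u)$ for $f:(A,\rho)\to(B,\sigma)$; it exhibits $\mathbb{C}[\mathcal{P}]$ as the localization (homotopy category) of $\mathbb{C}\langle\mathcal{P}\rangle$ at the weak equivalences. **Derived functors.** For categories with weak equivalences $\mathcal{C},\mathcal{D}$ with localization functors $E_{\mathcal{C}}:\mathcal{C}\to\mathrm{ho}(\mathcal{C})$, $E_{\mathcal{D}}:\mathcal{D}\to\mathrm{ho}(\mathcal{D})$ and an arbitrary functor $F:\mathcal{C}\to\mathcal{D}$, a left derived functor of $F$ is a right Kan extension of $E_{\mathcal{D}}\circ F$ along $E_{\mathcal{C}}$, and a right derived functor of $F$ is a left Kan extension of $E_{\mathcal{D}}\circ F$ along $E_{\mathcal{C}}$. *)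

theory Defs
  imports Main
begin

section \<open>Categories, functors, natural transformations\<close>

record ('o, 'a) cat =
  Obj :: "'o set"
  Arr :: "'a set"
  Dom :: "'a \<Rightarrow> 'o"
  Cod :: "'a \<Rightarrow> 'o"
  Ident :: "'o \<Rightarrow> 'a"
  Comp :: "'a \<Rightarrow> 'a \<Rightarrow> 'a"  (infixl "\<cdot>\<index>" 70)

definition hom :: "('o, 'a, 'z) cat_scheme \<Rightarrow> 'o \<Rightarrow> 'o \<Rightarrow> 'a set" where
  "hom C A B = {f \<in> Arr C. Dom C f = A \<and> Cod C f = B}"

locale category =
  fixes C :: "('o, 'a, 'z) cat_scheme" (structure)
  assumes dom_obj: "f \<in> Arr C \<Longrightarrow> Dom C f \<in> Obj C"
    and cod_obj: "f \<in> Arr C \<Longrightarrow> Cod C f \<in> Obj C"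
    and ident_hom: "A \<in> Obj C \<Longrightarrow> Ident C A \<in> hom C A A"
    and comp_hom: "f \<in> hom C A B \<Longrightarrow> g \<in> hom C B D \<Longrightarrow> g \<cdot> f \<in> hom C A D"
    and comp_ident: "f \<in> hom C A B \<Longrightarrow> f \<cdot> Ident C A = f"
    and ident_comp: "f \<in> hom C A B \<Longrightarrow> Ident C B \<cdot> f = f"
    and comp_assoc: "f \<in> hom C A B \<Longrightarrow> g \<in> hom C B D \<Longrightarrow> h \<in> hom C D E \<Longrightarrow>
      h \<cdot> (g \<cdot> f) = (h \<cdot> g) \<cdot> f"

record ('o, 'a, 'o2, 'a2) fctr =
  FObj :: "'o \<Rightarrow> 'o2"
  FArr :: "'a \<Rightarrow> 'a2"

locale is_functor = C: category C + D: category D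
  for C :: "('o, 'a, 'z) cat_scheme" and D :: "('o2, 'a2, 'z2) cat_scheme" +
  fixes F :: "('o, 'a, 'o2, 'a2) fctr"
  assumes map_obj: "A \<in> Obj C \<Longrightarrow> FObj F A \<in> Obj D"
    and map_hom: "f \<in> hom C A B \<Longrightarrow> FArr F f \<in> hom D (FObj F A) (FObj F B)"
    and map_ident: "A \<in> Obj C \<Longrightarrow> FArr F (Ident C A) = Ident D (FObj F A)"
    and map_comp: "f \<in> hom C A B \<Longrightarrow> g \<in> hom C B E \<Longrightarrow>
      FArr F (g \<cdot>\<^bsub>C\<^esub> f) = FArr F g \<cdot>\<^bsub>D\<^esub> FArr F f"

definition fcomp ::
  "('o2, 'a2, 'o3, 'a3) fctr \<Rightarrow> ('o, 'a, 'o2, 'a2) fctr \<Rightarrow> ('o, 'a, 'o3, 'a3) fctr"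
  (infixl "\<circ>\<^sub>F" 55) where
  "G \<circ>\<^sub>F F = \<lparr>FObj = FObj G \<circ> FObj F, FArr = FArr G \<circ> FArr F\<rparr>"

locale nat_trans = F: is_functor C D F + G: is_functor C D G
  for C :: "('o, 'a, 'z) cat_scheme" and D :: "('o2, 'a2, 'z2) cat_scheme"
    and F G :: "('o, 'a, 'o2, 'a2) fctr" +
  fixes \<tau> :: "'o \<Rightarrow> 'a2"
  assumes component: "A \<in> Obj C \<Longrightarrow> \<tau> A \<in> hom D (FObj F A) (FObj G A)"
    and naturality: "f \<in> hom C A B \<Longrightarrow>
      \<tau> B \<cdot>\<^bsub>D\<^esub> FArr F f = FArr G f \<cdot>\<^bsub>D\<^esub> \<tau> A"


section \<open>Finite limits\<close>

definition is_cone where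
  "is_cone J C D L leg \<longleftrightarrow> L \<in> Obj C \<and>
     (\<forall>j\<in>Obj J. leg j \<in> hom C L (FObj D j)) \<and>
     (\<forall>i j u. u \<in> hom J i j \<longrightarrow> FArr D u \<cdot>\<^bsub>C\<^esub> leg i = leg j)"

definition is_limit_cone where
  "is_limit_cone J C D L leg \<longleftrightarrow> is_cone J C D L leg \<and>
     (\<forall>M leg'. is_cone J C D M leg' \<longrightarrow>
        (\<exists>!h. h \<in> hom C M L \<and> (\<forall>j\<in>Obj J. leg j \<cdot>\<^bsub>C\<^esub> h = leg' j)))"

text \<open>Index categories live on type \<^typ>\<open>nat\<close>; every finite category is isomorphic to such a one.\<close>

definition finite_category :: "(nat, nat) cat \<Rightarrow> bool" where
  "finite_category J \<longleftrightarrow> category J \<and> finite (Obj J) \<and> finite (Arr J)"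

definition has_finite_limits :: "('o, 'a, 'z) cat_scheme \<Rightarrow> bool" where
  "has_finite_limits C \<longleftrightarrow>
     (\<forall>J D. finite_category J \<and> is_functor J C D \<longrightarrow> (\<exists>L leg. is_limit_cone J C D L leg))"

definition preserves_finite_limits ::
  "('o, 'a, 'z) cat_scheme \<Rightarrow> ('o2, 'a2, 'z2) cat_scheme \<Rightarrow> ('o, 'a, 'o2, 'a2) fctr \<Rightarrow> bool" where
  "preserves_finite_limits C D F \<longleftrightarrow> is_functor C D F \<and>
     (\<forall>J K L leg. finite_category J \<and> is_functor J C K \<and> is_limit_cone J C K L leg \<longrightarrow>
        is_limit_cone J D (F \<circ>\<^sub>F K) (FObj F L) (\<lambda>j. FArr F (leg j)))"

definition is_pullback :: "('o, 'a, 'z) cat_scheme \<Rightarrow> 'a \<Rightarrow> 'a \<Rightarrow> 'a \<Rightarrow> 'a \<Rightarrow> bool" where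
  "is_pullback C h k f g \<longleftrightarrow>
     h \<in> hom C (Dom C h) (Dom C f) \<and> k \<in> hom C (Dom C h) (Dom C g) \<and>
     f \<in> hom C (Dom C f) (Cod C f) \<and> g \<in> hom C (Dom C g) (Cod C f) \<and>
     f \<cdot>\<^bsub>C\<^esub> h = g \<cdot>\<^bsub>C\<^esub> k \<and>
     (\<forall>X a b. a \<in> hom C X (Dom C f) \<and> b \<in> hom C X (Dom C g) \<and>
        f \<cdot>\<^bsub>C\<^esub> a = g \<cdot>\<^bsub>C\<^esub> b \<longrightarrow>
        (\<exists>!m. m \<in> hom C X (Dom C h) \<and> h \<cdot>\<^bsub>C\<^esub> m = a \<and> k \<cdot>\<^bsub>C\<^esub> m = b))"

text \<open>The binary products used to interpret contexts are an arbitrary choice, carried as data.\<close>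

record ('o, 'a) prodcat = "('o, 'a) cat" +
  Prod :: "'o \<Rightarrow> 'o \<Rightarrow> 'o"  (infixl "\<otimes>\<index>" 75)
  Pr1 :: "'o \<Rightarrow> 'o \<Rightarrow> 'a"
  Pr2 :: "'o \<Rightarrow> 'o \<Rightarrow> 'a"

locale fl_category = category C
  for C :: "('o, 'a, 'z) prodcat_scheme" (structure) +
  assumes finite_limits: "has_finite_limits C"
    and prod_obj: "A \<in> Obj C \<Longrightarrow> B \<in> Obj C \<Longrightarrow> A \<otimes> B \<in> Obj C"
    and pr1_hom: "A \<in> Obj C \<Longrightarrow> B \<in> Obj C \<Longrightarrow> Pr1 C A B \<in> hom C (A \<otimes> B) A"
    and pr2_hom: "A \<in> Obj C \<Longrightarrow> B \<in> Obj C \<Longrightarrow> Pr2 C A B \<in> hom C (A \<otimes> B) B"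
    and prod_universal: "A \<in> Obj C \<Longrightarrow> B \<in> Obj C \<Longrightarrow> f \<in> hom C X A \<Longrightarrow> g \<in> hom C X B \<Longrightarrow>
      \<exists>!h. h \<in> hom C X (A \<otimes> B) \<and> Pr1 C A B \<cdot> h = f \<and> Pr2 C A B \<cdot> h = g"

definition tuple :: "('o, 'a, 'z) prodcat_scheme \<Rightarrow> 'a \<Rightarrow> 'a \<Rightarrow> 'a"  ("\<langle>_,/ _\<rangle>\<index>") where
  "\<langle>f, g\<rangle>\<^bsub>C\<^esub> = (THE h. h \<in> hom C (Dom C f) (Cod C f \<otimes>\<^bsub>C\<^esub> Cod C g) \<and>
     Pr1 C (Cod C f) (Cod C g) \<cdot>\<^bsub>C\<^esub> h = f \<and> Pr2 C (Cod C f) (Cod C g) \<cdot>\<^bsub>C\<^esub> h = g)"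


section \<open>Indexed frames and triposes\<close>

text \<open>\<open>Pull P f\<close> is reindexing along \<open>f\<close>, from predicates on the codomain to predicates on the
  domain.\<close>

record ('o, 'a, 'p) ixposet =
  Fib :: "'o \<Rightarrow> 'p set"
  Le :: "'o \<Rightarrow> 'p \<Rightarrow> 'p \<Rightarrow> bool"
  Pull :: "'a \<Rightarrow> 'p \<Rightarrow> 'p"

locale indexed_poset = category C
  for C :: "('o, 'a, 'z) cat_scheme" (structure) +
  fixes P :: "('o, 'a, 'p) ixposet"
  assumes le_refl: "I \<in> Obj C \<Longrightarrow> \<phi> \<in> Fib P I \<Longrightarrow> Le P I \<phi> \<phi>"
    and le_trans: "I \<in> Obj C \<Longrightarrow> \<phi> \<in> Fib P I \<Longrightarrow> \<psi> \<in> Fib P I \<Longrightarrow> \<chi> \<in> Fib P I \<Longrightarrow>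
      Le P I \<phi> \<psi> \<Longrightarrow> Le P I \<psi> \<chi> \<Longrightarrow> Le P I \<phi> \<chi>"
    and le_antisym: "I \<in> Obj C \<Longrightarrow> \<phi> \<in> Fib P I \<Longrightarrow> \<psi> \<in> Fib P I \<Longrightarrow>
      Le P I \<phi> \<psi> \<Longrightarrow> Le P I \<psi> \<phi> \<Longrightarrow> \<phi> = \<psi>"
    and pull_fib: "f \<in> hom C J I \<Longrightarrow> \<phi> \<in> Fib P I \<Longrightarrow> Pull P f \<phi> \<in> Fib P J"
    and pull_mono: "f \<in> hom C J I \<Longrightarrow> \<phi> \<in> Fib P I \<Longrightarrow> \<psi> \<in> Fib P I \<Longrightarrow> Le P I \<phi> \<psi> \<Longrightarrow>
      Le P J (Pull P f \<phi>) (Pull P f \<psi>)"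
    and pull_ident: "I \<in> Obj C \<Longrightarrow> \<phi> \<in> Fib P I \<Longrightarrow> Pull P (Ident C I) \<phi> = \<phi>"
    and pull_comp: "f \<in> hom C K J \<Longrightarrow> g \<in> hom C J I \<Longrightarrow> \<phi> \<in> Fib P I \<Longrightarrow>
      Pull P (g \<cdot> f) \<phi> = Pull P f (Pull P g \<phi>)"

definition is_top :: "('o, 'a, 'p) ixposet \<Rightarrow> 'o \<Rightarrow> 'p \<Rightarrow> bool" where
  "is_top P I t \<longleftrightarrow> t \<in> Fib P I \<and> (\<forall>\<phi>\<in>Fib P I. Le P I \<phi> t)"

definition is_meet :: "('o, 'a, 'p) ixposet \<Rightarrow> 'o \<Rightarrow> 'p \<Rightarrow> 'p \<Rightarrow> 'p \<Rightarrow> bool" where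
  "is_meet P I \<phi> \<psi> m \<longleftrightarrow> m \<in> Fib P I \<and> Le P I m \<phi> \<and> Le P I m \<psi> \<and>
     (\<forall>\<chi>\<in>Fib P I. Le P I \<chi> \<phi> \<and> Le P I \<chi> \<psi> \<longrightarrow> Le P I \<chi> m)"

definition meet :: "('o, 'a, 'p) ixposet \<Rightarrow> 'o \<Rightarrow> 'p \<Rightarrow> 'p \<Rightarrow> 'p" where
  "meet P I \<phi> \<psi> = (THE m. is_meet P I \<phi> \<psi> m)"

locale indexed_meet_semilattice = indexed_poset +
  assumes ex_top: "I \<in> Obj C \<Longrightarrow> \<exists>t. is_top P I t"
    and ex_meet: "I \<in> Obj C \<Longrightarrow> \<phi> \<in> Fib P I \<Longrightarrow> \<psi> \<in> Fib P I \<Longrightarrow> \<exists>m. is_meet P I \<phi> \<psi> m"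
    and pull_top: "f \<in> hom C J I \<Longrightarrow> is_top P I t \<Longrightarrow> is_top P J (Pull P f t)"
    and pull_meet: "f \<in> hom C J I \<Longrightarrow> \<phi> \<in> Fib P I \<Longrightarrow> \<psi> \<in> Fib P I \<Longrightarrow>
      is_meet P I \<phi> \<psi> m \<Longrightarrow> is_meet P J (Pull P f \<phi>) (Pull P f \<psi>) (Pull P f m)"

definition is_left_adjoint ::
  "('o, 'a, 'z) cat_scheme \<Rightarrow> ('o, 'a, 'p) ixposet \<Rightarrow> 'a \<Rightarrow> ('p \<Rightarrow> 'p) \<Rightarrow> bool" where
  "is_left_adjoint C P f L \<longleftrightarrow> (\<forall>\<phi>\<in>Fib P (Dom C f). L \<phi> \<in> Fib P (Cod C f) \<and>
     (\<forall>\<psi>\<in>Fib P (Cod C f). Le P (Cod C f) (L \<phi>) \<psi> \<longleftrightarrow> Le P (Dom C f) \<phi> (Pull P f \<psi>)))"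

definition is_right_adjoint ::
  "('o, 'a, 'z) cat_scheme \<Rightarrow> ('o, 'a, 'p) ixposet \<Rightarrow> 'a \<Rightarrow> ('p \<Rightarrow> 'p) \<Rightarrow> bool" where
  "is_right_adjoint C P f R \<longleftrightarrow> (\<forall>\<phi>\<in>Fib P (Dom C f). R \<phi> \<in> Fib P (Cod C f) \<and>
     (\<forall>\<psi>\<in>Fib P (Cod C f). Le P (Cod C f) \<psi> (R \<phi>) \<longleftrightarrow> Le P (Dom C f) (Pull P f \<psi>) \<phi>))"

text \<open>The left adjoint is determined only on the fiber, so its value is selected pointwise.\<close>

definition Ex_along ::
  "('o, 'a, 'z) cat_scheme \<Rightarrow> ('o, 'a, 'p) ixposet \<Rightarrow> 'a \<Rightarrow> 'p \<Rightarrow> 'p" where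
  "Ex_along C P f \<phi> = (THE \<epsilon>. \<epsilon> \<in> Fib P (Cod C f) \<and>
     (\<forall>\<psi>\<in>Fib P (Cod C f). Le P (Cod C f) \<epsilon> \<psi> \<longleftrightarrow> Le P (Dom C f) \<phi> (Pull P f \<psi>)))"

locale indexed_frame = fl_category C + indexed_meet_semilattice C P
  for C :: "('o, 'a, 'z) prodcat_scheme" (structure) and P :: "('o, 'a, 'p) ixposet" +
  assumes Ex: "f \<in> Arr C \<Longrightarrow> \<exists>L. is_left_adjoint C P f L"
    and Fr: "f \<in> hom C J I \<Longrightarrow> \<phi> \<in> Fib P J \<Longrightarrow> \<psi> \<in> Fib P I \<Longrightarrow>
      meet P I (Ex_along C P f \<phi>) \<psi> = Ex_along C P f (meet P J \<phi> (Pull P f \<psi>))"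
    and BC: "is_pullback C h k f g \<Longrightarrow> \<phi> \<in> Fib P (Dom C g) \<Longrightarrow>
      Ex_along C P h (Pull P k \<phi>) = Pull P f (Ex_along C P g \<phi>)"

locale cartesian_map = P: indexed_meet_semilattice C P + Q: indexed_meet_semilattice C Q
  for C :: "('o, 'a, 'z) cat_scheme"
    and P :: "('o, 'a, 'p) ixposet" and Q :: "('o, 'a, 'q) ixposet" +
  fixes \<Phi> :: "'o \<Rightarrow> 'p \<Rightarrow> 'q"
  assumes map_fib: "I \<in> Obj C \<Longrightarrow> \<phi> \<in> Fib P I \<Longrightarrow> \<Phi> I \<phi> \<in> Fib Q I"
    and map_mono: "I \<in> Obj C \<Longrightarrow> \<phi> \<in> Fib P I \<Longrightarrow> \<psi> \<in> Fib P I \<Longrightarrow> Le P I \<phi> \<psi> \<Longrightarrow>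
      Le Q I (\<Phi> I \<phi>) (\<Phi> I \<psi>)"
    and map_pull: "f \<in> hom C J I \<Longrightarrow> \<phi> \<in> Fib P I \<Longrightarrow>
      \<Phi> J (Pull P f \<phi>) = Pull Q f (\<Phi> I \<phi>)"
    and map_top: "I \<in> Obj C \<Longrightarrow> is_top P I t \<Longrightarrow> is_top Q I (\<Phi> I t)"
    and map_meet: "I \<in> Obj C \<Longrightarrow> \<phi> \<in> Fib P I \<Longrightarrow> \<psi> \<in> Fib P I \<Longrightarrow> is_meet P I \<phi> \<psi> m \<Longrightarrow>
      is_meet Q I (\<Phi> I \<phi>) (\<Phi> I \<psi>) (\<Phi> I m)"

text \<open>Finite meets are already available in the fibers of an indexed frame, so the Heyting
  condition adds finite joins and implication.\<close>

locale tripos = indexed_frame C P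
  for C :: "('o, 'a, 'z) prodcat_scheme" (structure) and P :: "('o, 'a, 'p) ixposet" +
  assumes ex_bot: "I \<in> Obj C \<Longrightarrow> \<exists>b\<in>Fib P I. \<forall>\<phi>\<in>Fib P I. Le P I b \<phi>"
    and ex_join: "I \<in> Obj C \<Longrightarrow> \<phi> \<in> Fib P I \<Longrightarrow> \<psi> \<in> Fib P I \<Longrightarrow>
      \<exists>j\<in>Fib P I. \<forall>\<chi>\<in>Fib P I. Le P I j \<chi> \<longleftrightarrow> Le P I \<phi> \<chi> \<and> Le P I \<psi> \<chi>"
    and ex_imp: "I \<in> Obj C \<Longrightarrow> \<phi> \<in> Fib P I \<Longrightarrow> \<psi> \<in> Fib P I \<Longrightarrow>
      \<exists>i\<in>Fib P I. \<forall>\<chi>\<in>Fib P I. Le P I \<chi> i \<longleftrightarrow> Le P I (meet P I \<chi> \<phi>) \<psi>"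
    and All: "f \<in> Arr C \<Longrightarrow> \<exists>R. is_right_adjoint C P f R"
    and generic: "I \<in> Obj C \<Longrightarrow> \<exists>PI\<in>Obj C. \<exists>\<epsilon>\<in>Fib P (I \<otimes> PI).
      \<forall>J\<in>Obj C. \<forall>\<phi>\<in>Fib P (I \<otimes> J). \<exists>h\<in>hom C J PI.
        Pull P \<langle>Pr1 C I J, h \<cdot> Pr2 C I J\<rangle> \<epsilon> = \<phi>"

definition ex_prime ::
  "('o, 'a, 'z) cat_scheme \<Rightarrow> ('o, 'a, 'p) ixposet \<Rightarrow> 'o \<Rightarrow> 'p \<Rightarrow> bool" where
  "ex_prime C P I \<pi> \<longleftrightarrow> \<pi> \<in> Fib P I \<and>
     (\<forall>J K u v. \<forall>\<psi>\<in>Fib P K. u \<in> hom C J I \<and> v \<in> hom C K J \<and>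
        Le P J (Pull P u \<pi>) (Ex_along C P v \<psi>) \<longrightarrow>
        (\<exists>s\<in>hom C J K. v \<cdot>\<^bsub>C\<^esub> s = Ident C J \<and> Le P J (Pull P u \<pi>) (Pull P s \<psi>)))"

definition enough_ex_primes ::
  "('o, 'a, 'z) cat_scheme \<Rightarrow> ('o, 'a, 'p) ixposet \<Rightarrow> bool" where
  "enough_ex_primes C P \<longleftrightarrow> (\<forall>I\<in>Obj C. \<forall>\<phi>\<in>Fib P I.
     \<exists>J\<in>Obj C. \<exists>\<pi> f. ex_prime C P J \<pi> \<and> f \<in> hom C J I \<and> \<phi> = Ex_along C P f \<pi>)"


section \<open>The categories of partial equivalence relations and of functional relations\<close>

text \<open>
  The internal language is used through its interpretation. A context is the left-nested product
  of its sorts, a term in context is an arrow out of it (variables being projections), and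
  \<open>app C P \<rho> s t\<close> is the interpretation of the atomic formula \<open>\<rho>(s, t)\<close>. Conjunction and the
  judgment \<open>\<turnstile>\<close> become \<^const>\<open>meet\<close> and \<^const>\<open>Le\<close> in the fiber over the context, and
  existential quantification becomes \<^const>\<open>Ex_along\<close> for the projection forgetting the last
  variable. \<open>\<rho> x\<close> stands for \<open>\<rho>(x, x)\<close>.

  Below, \<open>PerCat C P\<close> is \<open>C\<langle>P\<rangle>\<close>, \<open>RelCat C P\<close> is \<open>C[P]\<close>, \<open>LocFun C P\<close> is the localization functor
  \<open>E\<^sub>P : C\<langle>P\<rangle> \<rightarrow> C[P]\<close>, and \<open>PerFun C \<Phi>\<close> is the functor \<open>C\<langle>\<Phi>\<rangle>\<close> induced by \<open>\<Phi>\<close>.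
\<close>

definition app ::
  "('o, 'a, 'z) prodcat_scheme \<Rightarrow> ('o, 'a, 'p) ixposet \<Rightarrow> 'p \<Rightarrow> 'a \<Rightarrow> 'a \<Rightarrow> 'p" where
  "app C P \<rho> s t = Pull P \<langle>s, t\<rangle>\<^bsub>C\<^esub> \<rho>"

definition is_per ::
  "('o, 'a, 'z) prodcat_scheme \<Rightarrow> ('o, 'a, 'p) ixposet \<Rightarrow> 'o \<Rightarrow> 'p \<Rightarrow> bool" where
  "is_per C P A \<rho> \<longleftrightarrow> A \<in> Obj C \<and> \<rho> \<in> Fib P (A \<otimes>\<^bsub>C\<^esub> A) \<and>
     (let \<Gamma> = A \<otimes>\<^bsub>C\<^esub> A; x = Pr1 C A A; y = Pr2 C A A
      in Le P \<Gamma> (app C P \<rho> x y) (app C P \<rho> y x)) \<and>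
     (let \<Gamma>' = A \<otimes>\<^bsub>C\<^esub> A; \<Gamma> = \<Gamma>' \<otimes>\<^bsub>C\<^esub> A;
          x = Pr1 C A A \<cdot>\<^bsub>C\<^esub> Pr1 C \<Gamma>' A; y = Pr2 C A A \<cdot>\<^bsub>C\<^esub> Pr1 C \<Gamma>' A; z = Pr2 C \<Gamma>' A
      in Le P \<Gamma> (meet P \<Gamma> (app C P \<rho> x y) (app C P \<rho> y z)) (app C P \<rho> x z))"

definition per_map ::
  "('o, 'a, 'z) prodcat_scheme \<Rightarrow> ('o, 'a, 'p) ixposet \<Rightarrow> 'o \<times> 'p \<Rightarrow> 'a \<Rightarrow> 'o \<times> 'p \<Rightarrow> bool" where
  "per_map C P X f Y \<longleftrightarrow> (case (X, Y) of ((A, \<rho>), (B, \<sigma>)) \<Rightarrow>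
     is_per C P A \<rho> \<and> is_per C P B \<sigma> \<and> f \<in> hom C A B \<and>
     (let \<Gamma> = A \<otimes>\<^bsub>C\<^esub> A; x = Pr1 C A A; y = Pr2 C A A
      in Le P \<Gamma> (app C P \<rho> x y) (app C P \<sigma> (f \<cdot>\<^bsub>C\<^esub> x) (f \<cdot>\<^bsub>C\<^esub> y))))"

text \<open>An arrow is stored together with its domain and codomain, since one underlying map may carry
  several of them.\<close>

definition PerCat :: "('o, 'a, 'z) prodcat_scheme \<Rightarrow> ('o, 'a, 'p) ixposet \<Rightarrow>
    ('o \<times> 'p, ('o \<times> 'p) \<times> 'a \<times> ('o \<times> 'p)) cat" where
  "PerCat C P =
     \<lparr>Obj = {(A, \<rho>). is_per C P A \<rho>},
      Arr = {(X, f, Y). per_map C P X f Y},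
      Dom = (\<lambda>(X, f, Y). X),
      Cod = (\<lambda>(X, f, Y). Y),
      Ident = (\<lambda>(A, \<rho>). ((A, \<rho>), Ident C A, (A, \<rho>))),
      Comp = (\<lambda>(Y, g, Z) (X, f, Y'). (X, g \<cdot>\<^bsub>C\<^esub> f, Z))\<rparr>"

definition func_rel ::
  "('o, 'a, 'z) prodcat_scheme \<Rightarrow> ('o, 'a, 'p) ixposet \<Rightarrow> 'o \<times> 'p \<Rightarrow> 'p \<Rightarrow> 'o \<times> 'p \<Rightarrow> bool" where
  "func_rel C P X \<phi> Y \<longleftrightarrow> (case (X, Y) of ((A, \<rho>), (B, \<sigma>)) \<Rightarrow>
     is_per C P A \<rho> \<and> is_per C P B \<sigma> \<and> \<phi> \<in> Fib P (A \<otimes>\<^bsub>C\<^esub> B) \<and>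
     (let \<Gamma> = A \<otimes>\<^bsub>C\<^esub> B; x = Pr1 C A B; u = Pr2 C A B
      in Le P \<Gamma> (app C P \<phi> x u) (meet P \<Gamma> (app C P \<rho> x x) (app C P \<sigma> u u))) \<and>
     (let \<Gamma>2 = A \<otimes>\<^bsub>C\<^esub> A; \<Gamma>3 = \<Gamma>2 \<otimes>\<^bsub>C\<^esub> B; \<Gamma> = \<Gamma>3 \<otimes>\<^bsub>C\<^esub> B;
          x = Pr1 C A A \<cdot>\<^bsub>C\<^esub> (Pr1 C \<Gamma>2 B \<cdot>\<^bsub>C\<^esub> Pr1 C \<Gamma>3 B);
          y = Pr2 C A A \<cdot>\<^bsub>C\<^esub> (Pr1 C \<Gamma>2 B \<cdot>\<^bsub>C\<^esub> Pr1 C \<Gamma>3 B);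
          u = Pr2 C \<Gamma>2 B \<cdot>\<^bsub>C\<^esub> Pr1 C \<Gamma>3 B;
          v = Pr2 C \<Gamma>3 B
      in Le P \<Gamma> (meet P \<Gamma> (meet P \<Gamma> (app C P \<rho> y x) (app C P \<phi> x u)) (app C P \<sigma> u v))
           (app C P \<phi> y v)) \<and>
     (let \<Gamma>' = A \<otimes>\<^bsub>C\<^esub> B; \<Gamma> = \<Gamma>' \<otimes>\<^bsub>C\<^esub> B;
          x = Pr1 C A B \<cdot>\<^bsub>C\<^esub> Pr1 C \<Gamma>' B; u = Pr2 C A B \<cdot>\<^bsub>C\<^esub> Pr1 C \<Gamma>' B; v = Pr2 C \<Gamma>' B
      in Le P \<Gamma> (meet P \<Gamma> (app C P \<phi> x u) (app C P \<phi> x v)) (app C P \<sigma> u v)) \<and>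
     (let x = Pr1 C A B; u = Pr2 C A B
      in Le P A (app C P \<rho> (Ident C A) (Ident C A)) (Ex_along C P x (app C P \<phi> x u))))"

text \<open>The middle object \<open>(B, \<sigma>)\<close> of a composite enters through the sort of the quantified variable:
  \<open>\<exists>u. \<phi>(x, u) \<and> \<gamma>(u, r)\<close> is read in the context \<open>x, r, u\<close>.\<close>

definition rel_comp :: "('o, 'a, 'z) prodcat_scheme \<Rightarrow> ('o, 'a, 'p) ixposet \<Rightarrow>
    'o \<Rightarrow> 'o \<Rightarrow> 'o \<Rightarrow> 'p \<Rightarrow> 'p \<Rightarrow> 'p" where
  "rel_comp C P A B D \<gamma> \<phi> =
     (let \<Gamma>' = A \<otimes>\<^bsub>C\<^esub> D; \<Gamma> = \<Gamma>' \<otimes>\<^bsub>C\<^esub> B;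
          x = Pr1 C A D \<cdot>\<^bsub>C\<^esub> Pr1 C \<Gamma>' B; r = Pr2 C A D \<cdot>\<^bsub>C\<^esub> Pr1 C \<Gamma>' B; u = Pr2 C \<Gamma>' B
      in Ex_along C P (Pr1 C \<Gamma>' B) (meet P \<Gamma> (app C P \<phi> x u) (app C P \<gamma> u r)))"

definition RelCat :: "('o, 'a, 'z) prodcat_scheme \<Rightarrow> ('o, 'a, 'p) ixposet \<Rightarrow>
    ('o \<times> 'p, ('o \<times> 'p) \<times> 'p \<times> ('o \<times> 'p)) cat" where
  "RelCat C P =
     \<lparr>Obj = {(A, \<rho>). is_per C P A \<rho>},
      Arr = {(X, \<phi>, Y). func_rel C P X \<phi> Y},
      Dom = (\<lambda>(X, \<phi>, Y). X),
      Cod = (\<lambda>(X, \<phi>, Y). Y),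
      Ident = (\<lambda>(A, \<rho>). ((A, \<rho>), \<rho>, (A, \<rho>))),
      Comp = (\<lambda>(Y, \<gamma>, Z) (X, \<phi>, Y'). (X, rel_comp C P (fst X) (fst Y) (fst Z) \<gamma> \<phi>, Z))\<rparr>"

definition LocFun :: "('o, 'a, 'z) prodcat_scheme \<Rightarrow> ('o, 'a, 'p) ixposet \<Rightarrow>
    ('o \<times> 'p, ('o \<times> 'p) \<times> 'a \<times> ('o \<times> 'p), 'o \<times> 'p, ('o \<times> 'p) \<times> 'p \<times> ('o \<times> 'p)) fctr" where
  "LocFun C P =
     \<lparr>FObj = (\<lambda>X. X),
      FArr = (\<lambda>((A, \<rho>), f, (B, \<sigma>)).
        ((A, \<rho>),
         (let \<Gamma> = A \<otimes>\<^bsub>C\<^esub> B; x = Pr1 C A B; u = Pr2 C A B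
          in meet P \<Gamma> (app C P \<rho> x x) (app C P \<sigma> (f \<cdot>\<^bsub>C\<^esub> x) u)),
         (B, \<sigma>)))\<rparr>"

definition PerFun :: "('o, 'a, 'z) prodcat_scheme \<Rightarrow> ('o \<Rightarrow> 'p \<Rightarrow> 'q) \<Rightarrow>
    ('o \<times> 'p, ('o \<times> 'p) \<times> 'a \<times> ('o \<times> 'p), 'o \<times> 'q, ('o \<times> 'q) \<times> 'a \<times> ('o \<times> 'q)) fctr" where
  "PerFun C \<Phi> =
     (let F = (\<lambda>(A, \<rho>). (A, \<Phi> (A \<otimes>\<^bsub>C\<^esub> A) \<rho>))
      in \<lparr>FObj = F, FArr = (\<lambda>(X, f, Y). (F X, f, F Y))\<rparr>)"


section \<open>Kan extensions and derived functors\<close>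

definition right_kan_extension ::
  "('o, 'a, 'z) cat_scheme \<Rightarrow> ('o2, 'a2, 'z2) cat_scheme \<Rightarrow> ('o3, 'a3, 'z3) cat_scheme \<Rightarrow>
   ('o, 'a, 'o2, 'a2) fctr \<Rightarrow> ('o, 'a, 'o3, 'a3) fctr \<Rightarrow>
   ('o2, 'a2, 'o3, 'a3) fctr \<Rightarrow> ('o \<Rightarrow> 'a3) \<Rightarrow> bool" where
  "right_kan_extension A B D K G R \<epsilon> \<longleftrightarrow>
     is_functor A B K \<and> is_functor B D R \<and> nat_trans A D (R \<circ>\<^sub>F K) G \<epsilon> \<and>
     (\<forall>S \<alpha>. is_functor B D S \<and> nat_trans A D (S \<circ>\<^sub>F K) G \<alpha> \<longrightarrow>
        (\<exists>\<beta>. nat_trans B D S R \<beta> \<and> (\<forall>X\<in>Obj A. \<epsilon> X \<cdot>\<^bsub>D\<^esub> \<beta> (FObj K X) = \<alpha> X) \<and>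
          (\<forall>\<beta>'. nat_trans B D S R \<beta>' \<and> (\<forall>X\<in>Obj A. \<epsilon> X \<cdot>\<^bsub>D\<^esub> \<beta>' (FObj K X) = \<alpha> X) \<longrightarrow>
             (\<forall>Y\<in>Obj B. \<beta>' Y = \<beta> Y))))"

definition left_kan_extension ::
  "('o, 'a, 'z) cat_scheme \<Rightarrow> ('o2, 'a2, 'z2) cat_scheme \<Rightarrow> ('o3, 'a3, 'z3) cat_scheme \<Rightarrow>
   ('o, 'a, 'o2, 'a2) fctr \<Rightarrow> ('o, 'a, 'o3, 'a3) fctr \<Rightarrow>
   ('o2, 'a2, 'o3, 'a3) fctr \<Rightarrow> ('o \<Rightarrow> 'a3) \<Rightarrow> bool" where
  "left_kan_extension A B D K G L \<eta> \<longleftrightarrow>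
     is_functor A B K \<and> is_functor B D L \<and> nat_trans A D G (L \<circ>\<^sub>F K) \<eta> \<and>
     (\<forall>S \<alpha>. is_functor B D S \<and> nat_trans A D G (S \<circ>\<^sub>F K) \<alpha> \<longrightarrow>
        (\<exists>\<beta>. nat_trans B D L S \<beta> \<and> (\<forall>X\<in>Obj A. \<beta> (FObj K X) \<cdot>\<^bsub>D\<^esub> \<eta> X = \<alpha> X) \<and>
          (\<forall>\<beta>'. nat_trans B D L S \<beta>' \<and> (\<forall>X\<in>Obj A. \<beta>' (FObj K X) \<cdot>\<^bsub>D\<^esub> \<eta> X = \<alpha> X) \<longrightarrow>
             (\<forall>Y\<in>Obj B. \<beta>' Y = \<beta> Y))))"

text \<open>A derived functor of \<open>F : A \<rightarrow> A'\<close> depends on the weak equivalences only through the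
  localization functors \<open>E : A \<rightarrow> H\<close> and \<open>E' : A' \<rightarrow> H'\<close>. Note the reversal: left derived functors
  are right Kan extensions and vice versa.\<close>

definition is_left_derived_functor where
  "is_left_derived_functor A H E H' E' F L \<epsilon> \<longleftrightarrow> right_kan_extension A H H' E (E' \<circ>\<^sub>F F) L \<epsilon>"

definition is_right_derived_functor where
  "is_right_derived_functor A H E H' E' F R \<eta> \<longleftrightarrow> left_kan_extension A H H' E (E' \<circ>\<^sub>F F) R \<eta>"

end

theory Submission
  imports Defs
begin

text \<open>
  All reasoning in the internal language is done with generalized elements. A stage is an object
  \<open>X\<close> with a predicate \<open>\<chi>\<close> on it, and it forces \<open>\<phi>(s, t)\<close> when \<open>\<chi> \<le> \<langle>s, t\<rangle>\<^sup>* \<phi>\<close>. By the Yoneda lemma a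
  judgment is an implication between forcing statements, Frobenius reciprocity and the
  Beck-Chevalley condition turn an existential statement into a witness on a cover
  (\<open>forces1_ex_elim\<close>), and forcing descends along covers. So partial equivalence relations and
  functional relations can be handled as if they were sets of elements.

  A finite limit in \<open>C\<langle>P\<rangle>\<close> is a limit of the carriers in \<open>C\<close>, equipped with the finite meet of the
  relations pulled back along the legs (\<open>limit_cone_PerCat\<close>). A cartesian map preserves such meets.
  Two parallel maps \<open>f, g : (A, \<rho>) \<rightarrow> (B, \<sigma>)\<close> have the same image in \<open>C[P]\<close> exactly when
  \<open>\<rho>(x, x) \<turnstile> \<sigma>(fx, gx)\<close> (\<open>graph_rel_eq_iff\<close>), and a cartesian map preserves this judgment as well.

  The derived functors are computed by replacements, as in homotopical algebra. Suppose that each \<open>X\<close>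
  has a map \<open>i : X \<rightarrow> Z\<close> inverted by the localization \<open>E\<close>, such that for every arrow \<open>h\<close> into \<open>X\<close> in
  the localization \<open>E(i) \<circ> h\<close> is the image of a map into \<open>Z\<close>. A functor that identifies maps whenever
  \<open>E\<close> does so then has a left Kan extension along \<open>E\<close>, its value at \<open>X\<close> being the value of the functor
  at \<open>Z\<close> (\<open>left_kan_extension_from_replacements\<close>); the dual statement holds for maps \<open>Z \<rightarrow> X\<close>.

  In a tripos, \<open>Z\<close> is the object of \<open>\<rho>\<close>-classes in the power object of the carrier: a functional
  relation into \<open>(A, \<rho>)\<close> has a name, which sends \<open>b\<close> to the class of the values at \<open>b\<close>
  (\<open>power_object_replacement\<close>). With enough \<open>\<exists>\<close>-prime predicates, \<open>Z\<close> is a cover of \<open>(A, \<rho>)\<close> with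
  \<open>\<exists>\<close>-prime support: a functional relation on it is total, and primeness of the support extracts
  from totality a map choosing the values (\<open>ex_prime_replacement\<close>).
\<close>

section \<open>Arrow calculus\<close>

context category
begin

lemma hom_iff [simp]: "f \<in> hom C A B \<longleftrightarrow> f \<in> Arr C \<and> Dom C f = A \<and> Cod C f = B"
  by (simp add: hom_def)

lemma comp_arr [simp]:
  assumes "f \<in> Arr C" "g \<in> Arr C" "Cod C f = Dom C g"
  shows "g \<cdot> f \<in> Arr C" "Dom C (g \<cdot> f) = Dom C f" "Cod C (g \<cdot> f) = Cod C g"
  using comp_hom[of f "Dom C f" "Dom C g" g "Cod C g"] assms by auto

lemma ident_arr [simp]:
  assumes "A \<in> Obj C"
  shows "Ident C A \<in> Arr C" "Dom C (Ident C A) = A" "Cod C (Ident C A) = A"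
  using ident_hom[OF assms] by auto

lemma comp_assoc_right [simp]:
  assumes "f \<in> Arr C" "g \<in> Arr C" "h \<in> Arr C" "Cod C f = Dom C g" "Cod C g = Dom C h"
  shows "(h \<cdot> g) \<cdot> f = h \<cdot> (g \<cdot> f)"
  using comp_assoc[of f "Dom C f" "Dom C g" g "Dom C h" h "Cod C h"] assms by auto

lemma comp_ident_right [simp]: "f \<in> Arr C \<Longrightarrow> Dom C f = A \<Longrightarrow> f \<cdot> Ident C A = f"
  using comp_ident[of f A "Cod C f"] by simp

lemma comp_ident_left [simp]: "f \<in> Arr C \<Longrightarrow> Cod C f = B \<Longrightarrow> Ident C B \<cdot> f = f"
  using ident_comp[of f "Dom C f" B] by simp

declare dom_obj [simp] cod_obj [simp]

end

context fl_category
begin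

declare prod_obj [simp]

lemma pr_arr [simp]:
  assumes "A \<in> Obj C" "B \<in> Obj C"
  shows "Pr1 C A B \<in> Arr C" "Dom C (Pr1 C A B) = A \<otimes> B" "Cod C (Pr1 C A B) = A"
    and "Pr2 C A B \<in> Arr C" "Dom C (Pr2 C A B) = A \<otimes> B" "Cod C (Pr2 C A B) = B"
  using pr1_hom[OF assms] pr2_hom[OF assms] by auto

lemma tuple_characterization:
  assumes "f \<in> Arr C" "g \<in> Arr C" "Dom C f = Dom C g"
  shows "\<langle>f, g\<rangle> \<in> hom C (Dom C f) (Cod C f \<otimes> Cod C g) \<and>
    Pr1 C (Cod C f) (Cod C g) \<cdot> \<langle>f, g\<rangle> = f \<and> Pr2 C (Cod C f) (Cod C g) \<cdot> \<langle>f, g\<rangle> = g"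
  unfolding tuple_def
  by (rule theI') (use prod_universal[of "Cod C f" "Cod C g" f "Dom C f" g] assms in auto)

lemma tuple_arr [simp]:
  assumes "f \<in> Arr C" "g \<in> Arr C" "Dom C f = Dom C g"
  shows "\<langle>f, g\<rangle> \<in> Arr C" "Dom C \<langle>f, g\<rangle> = Dom C g" "Cod C \<langle>f, g\<rangle> = Cod C f \<otimes> Cod C g"
  using tuple_characterization[OF assms] assms by auto

lemma pr_tuple [simp]:
  assumes "f \<in> Arr C" "g \<in> Arr C" "Dom C f = Dom C g" "Cod C f = A" "Cod C g = B"
  shows "Pr1 C A B \<cdot> \<langle>f, g\<rangle> = f" "Pr2 C A B \<cdot> \<langle>f, g\<rangle> = g"
  using tuple_characterization[of f g] assms by auto

lemma prod_arr_eqI: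
  assumes "h \<in> Arr C" "k \<in> Arr C" "Dom C h = Dom C k" "Cod C h = A \<otimes> B" "Cod C k = A \<otimes> B"
    and "A \<in> Obj C" "B \<in> Obj C"
    and "Pr1 C A B \<cdot> h = Pr1 C A B \<cdot> k" "Pr2 C A B \<cdot> h = Pr2 C A B \<cdot> k"
  shows "h = k"
proof -
  have "\<exists>!m. m \<in> hom C (Dom C k) (A \<otimes> B) \<and> Pr1 C A B \<cdot> m = Pr1 C A B \<cdot> k \<and> Pr2 C A B \<cdot> m = Pr2 C A B \<cdot> k"
    using assms by (intro prod_universal) auto
  with assms show ?thesis by (metis hom_iff)
qed

lemma tuple_comp [simp]:
  assumes "f \<in> Arr C" "g \<in> Arr C" "Dom C f = Dom C g" "k \<in> Arr C" "Cod C k = Dom C g"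
  shows "\<langle>f, g\<rangle> \<cdot> k = \<langle>f \<cdot> k, g \<cdot> k\<rangle>"
proof (rule prod_arr_eqI[where A = "Cod C f" and B = "Cod C g"])
  have "Pr1 C (Cod C f) (Cod C g) \<cdot> (\<langle>f, g\<rangle> \<cdot> k) = (Pr1 C (Cod C f) (Cod C g) \<cdot> \<langle>f, g\<rangle>) \<cdot> k"
    using assms by (subst comp_assoc_right) auto
  then show "Pr1 C (Cod C f) (Cod C g) \<cdot> (\<langle>f, g\<rangle> \<cdot> k) = Pr1 C (Cod C f) (Cod C g) \<cdot> \<langle>f \<cdot> k, g \<cdot> k\<rangle>"
    using assms by simp
  have "Pr2 C (Cod C f) (Cod C g) \<cdot> (\<langle>f, g\<rangle> \<cdot> k) = (Pr2 C (Cod C f) (Cod C g) \<cdot> \<langle>f, g\<rangle>) \<cdot> k"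
    using assms by (subst comp_assoc_right) auto
  then show "Pr2 C (Cod C f) (Cod C g) \<cdot> (\<langle>f, g\<rangle> \<cdot> k) = Pr2 C (Cod C f) (Cod C g) \<cdot> \<langle>f \<cdot> k, g \<cdot> k\<rangle>"
    using assms by simp
qed (use assms in auto)

lemma tuple_pr [simp]:
  assumes "A \<in> Obj C" "B \<in> Obj C"
  shows "\<langle>Pr1 C A B, Pr2 C A B\<rangle> = Ident C (A \<otimes> B)"
  by (rule prod_arr_eqI[where A = A and B = B]) (use assms in auto)

lemma tuple_pr_comp:
  assumes "A \<in> Obj C" "B \<in> Obj C" "h \<in> Arr C" "Cod C h = A \<otimes> B"
  shows "\<langle>Pr1 C A B \<cdot> h, Pr2 C A B \<cdot> h\<rangle> = h"
  by (rule prod_arr_eqI[where A = A and B = B]) (use assms in auto)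

text \<open>Changing the base of a context extension: these squares are the only pullbacks along which
  the Beck-Chevalley condition gets used.\<close>

lemma pullback_context_extension:
  assumes "f \<in> Arr C" "Dom C f = X" "Cod C f = I" "B \<in> Obj C"
  shows "is_pullback C (Pr1 C X B) \<langle>f \<cdot> Pr1 C X B, Pr2 C X B\<rangle> f (Pr1 C I B)"
proof -
  have o: "X \<in> Obj C" "I \<in> Obj C" using assms by auto
  have "\<exists>!m. m \<in> hom C Y (X \<otimes> B) \<and> Pr1 C X B \<cdot> m = a \<and>
      \<langle>f \<cdot> Pr1 C X B, Pr2 C X B\<rangle> \<cdot> m = b"
    if a: "a \<in> hom C Y X" and b: "b \<in> hom C Y (I \<otimes> B)" and ab: "f \<cdot> a = Pr1 C I B \<cdot> b" for Y a b
  proof (rule ex1I)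
    show "\<langle>a, Pr2 C I B \<cdot> b\<rangle> \<in> hom C Y (X \<otimes> B) \<and> Pr1 C X B \<cdot> \<langle>a, Pr2 C I B \<cdot> b\<rangle> = a \<and>
      \<langle>f \<cdot> Pr1 C X B, Pr2 C X B\<rangle> \<cdot> \<langle>a, Pr2 C I B \<cdot> b\<rangle> = b"
      using a b ab assms o by (simp add: tuple_pr_comp)
  next
    fix m assume m: "m \<in> hom C Y (X \<otimes> B) \<and> Pr1 C X B \<cdot> m = a \<and>
      \<langle>f \<cdot> Pr1 C X B, Pr2 C X B\<rangle> \<cdot> m = b"
    have "\<langle>f \<cdot> Pr1 C X B, Pr2 C X B\<rangle> \<cdot> m = \<langle>f \<cdot> (Pr1 C X B \<cdot> m), Pr2 C X B \<cdot> m\<rangle>"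
      using m[THEN conjunct1] assms o by simp
    then have "b = \<langle>f \<cdot> (Pr1 C X B \<cdot> m), Pr2 C X B \<cdot> m\<rangle>" using m by simp
    then have "Pr2 C I B \<cdot> b = Pr2 C X B \<cdot> m" using m[THEN conjunct1] assms o by simp
    then show "m = \<langle>a, Pr2 C I B \<cdot> b\<rangle>"
      using m o assms tuple_pr_comp[of X B m] by simp
  qed
  then show ?thesis
    unfolding is_pullback_def using assms o by auto
qed

end

lemma is_pullback_swap:
  assumes "is_pullback C h k f g"
  shows "is_pullback C k h g f"
proof -
  have eq: "Cod C g = Cod C f" "Dom C k = Dom C h"
    using assms unfolding is_pullback_def hom_def by auto
  have "\<exists>!m. m \<in> hom C X (Dom C h) \<and> k \<cdot>\<^bsub>C\<^esub> m = a \<and> h \<cdot>\<^bsub>C\<^esub> m = b"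
    if "a \<in> hom C X (Dom C g) \<and> b \<in> hom C X (Dom C f) \<and> g \<cdot>\<^bsub>C\<^esub> a = f \<cdot>\<^bsub>C\<^esub> b" for X a b
  proof -
    have "\<exists>!m. m \<in> hom C X (Dom C h) \<and> h \<cdot>\<^bsub>C\<^esub> m = b \<and> k \<cdot>\<^bsub>C\<^esub> m = a"
      using assms that unfolding is_pullback_def by auto
    then show ?thesis by (simp add: conj_commute)
  qed
  then show ?thesis
    using assms eq unfolding is_pullback_def by auto
qed

section \<open>Forcing\<close>

context indexed_meet_semilattice
begin

lemma meet_characterization:
  assumes "I \<in> Obj C" "\<phi> \<in> Fib P I" "\<psi> \<in> Fib P I"
  shows "is_meet P I \<phi> \<psi> (meet P I \<phi> \<psi>)"
  unfolding meet_def
proof (rule theI')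
  obtain m where m: "is_meet P I \<phi> \<psi> m" using ex_meet assms by blast
  moreover have "n = m" if "is_meet P I \<phi> \<psi> n" for n
    using that m le_antisym[of I n m] assms unfolding is_meet_def by blast
  ultimately show "\<exists>!m. is_meet P I \<phi> \<psi> m" by blast
qed

lemma meet_unique:
  assumes "I \<in> Obj C" "\<phi> \<in> Fib P I" "\<psi> \<in> Fib P I" "is_meet P I \<phi> \<psi> m"
  shows "meet P I \<phi> \<psi> = m"
  using assms meet_characterization[OF assms(1-3)] le_antisym[of I m "meet P I \<phi> \<psi>"]
  unfolding is_meet_def by auto

lemma meet_fib [simp]:
  "I \<in> Obj C \<Longrightarrow> \<phi> \<in> Fib P I \<Longrightarrow> \<psi> \<in> Fib P I \<Longrightarrow> meet P I \<phi> \<psi> \<in> Fib P I"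
  using meet_characterization unfolding is_meet_def by blast

lemma le_meet_iff:
  assumes "I \<in> Obj C" "\<phi> \<in> Fib P I" "\<psi> \<in> Fib P I" "\<chi> \<in> Fib P I"
  shows "Le P I \<chi> (meet P I \<phi> \<psi>) \<longleftrightarrow> Le P I \<chi> \<phi> \<and> Le P I \<chi> \<psi>"
  using assms meet_characterization[OF assms(1-3)] le_trans[of I \<chi> "meet P I \<phi> \<psi>"]
  unfolding is_meet_def by blast

lemma pull_meet_eq:
  assumes "f \<in> Arr C" "\<phi> \<in> Fib P (Cod C f)" "\<psi> \<in> Fib P (Cod C f)"
  shows "Pull P f (meet P (Cod C f) \<phi> \<psi>) = meet P (Dom C f) (Pull P f \<phi>) (Pull P f \<psi>)"
proof -
  have "is_meet P (Dom C f) (Pull P f \<phi>) (Pull P f \<psi>) (Pull P f (meet P (Cod C f) \<phi> \<psi>))"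
    by (rule pull_meet) (use assms in \<open>auto intro: meet_characterization\<close>)
  then show ?thesis
    using assms pull_fib[of f "Dom C f" "Cod C f"] by (intro meet_unique[symmetric]) auto
qed

lemma pull_fib' [simp]:
  "f \<in> Arr C \<Longrightarrow> Dom C f = J \<Longrightarrow> \<phi> \<in> Fib P (Cod C f) \<Longrightarrow> Pull P f \<phi> \<in> Fib P J"
  using pull_fib[of f J "Cod C f"] by simp

end

context indexed_frame
begin

lemma ex_characterization:
  assumes "f \<in> Arr C" "\<phi> \<in> Fib P (Dom C f)"
  shows "Ex_along C P f \<phi> \<in> Fib P (Cod C f) \<and>
    (\<forall>\<psi>\<in>Fib P (Cod C f). Le P (Cod C f) (Ex_along C P f \<phi>) \<psi> \<longleftrightarrow> Le P (Dom C f) \<phi> (Pull P f \<psi>))"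
  unfolding Ex_along_def
proof (rule theI')
  let ?R = "\<lambda>\<epsilon>. \<epsilon> \<in> Fib P (Cod C f) \<and>
    (\<forall>\<psi>\<in>Fib P (Cod C f). Le P (Cod C f) \<epsilon> \<psi> \<longleftrightarrow> Le P (Dom C f) \<phi> (Pull P f \<psi>))"
  obtain L where "is_left_adjoint C P f L" using Ex assms by blast
  then have L: "?R (L \<phi>)" using assms unfolding is_left_adjoint_def by blast
  moreover have "\<epsilon> = L \<phi>" if \<epsilon>: "?R \<epsilon>" for \<epsilon>
  proof (rule le_antisym[of "Cod C f"])
    have o: "Cod C f \<in> Obj C" using assms by simp
    show "Le P (Cod C f) \<epsilon> (L \<phi>)" "Le P (Cod C f) (L \<phi>) \<epsilon>"
      using \<epsilon> L le_refl[OF o, of \<epsilon>] le_refl[OF o, of "L \<phi>"] by auto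
  qed (use assms \<epsilon> L in auto)
  ultimately show "\<exists>!\<epsilon>. ?R \<epsilon>" by blast
qed

lemma ex_fib [simp]:
  "f \<in> Arr C \<Longrightarrow> \<phi> \<in> Fib P (Dom C f) \<Longrightarrow> Cod C f = I \<Longrightarrow> Ex_along C P f \<phi> \<in> Fib P I"
  using ex_characterization by blast

lemma ex_le_iff:
  assumes "f \<in> Arr C" "\<phi> \<in> Fib P J" "\<psi> \<in> Fib P I" "Dom C f = J" "Cod C f = I"
  shows "Le P I (Ex_along C P f \<phi>) \<psi> \<longleftrightarrow> Le P J \<phi> (Pull P f \<psi>)"
  using ex_characterization[of f \<phi>] assms by blast

text \<open>A stage \<open>(X, \<chi>)\<close> is an object of the category of elements of \<open>P\<close>: a context together with a
  hypothesis. It forces \<open>\<phi>\<close> at \<open>f : X \<rightarrow> I\<close> when the hypothesis implies \<open>\<phi>(f)\<close>.\<close>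

definition stage :: "'o \<times> 'p \<Rightarrow> bool" where
  "stage c \<longleftrightarrow> fst c \<in> Obj C \<and> snd c \<in> Fib P (fst c)"

definition forces1 :: "'o \<times> 'p \<Rightarrow> 'o \<Rightarrow> 'p \<Rightarrow> 'a \<Rightarrow> bool" where
  "forces1 c I \<phi> f \<longleftrightarrow> stage c \<and> f \<in> hom C (fst c) I \<and> \<phi> \<in> Fib P I \<and>
     Le P (fst c) (snd c) (Pull P f \<phi>)"

definition forces :: "'o \<times> 'p \<Rightarrow> 'o \<Rightarrow> 'o \<Rightarrow> 'p \<Rightarrow> 'a \<Rightarrow> 'a \<Rightarrow> bool" where
  "forces c A B \<phi> s t \<longleftrightarrow> s \<in> hom C (fst c) A \<and> t \<in> hom C (fst c) B \<and> forces1 c (A \<otimes> B) \<phi> \<langle>s, t\<rangle>"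

definition refines :: "'o \<times> 'p \<Rightarrow> 'a \<Rightarrow> 'o \<times> 'p \<Rightarrow> bool" where
  "refines d p c \<longleftrightarrow> stage d \<and> stage c \<and> p \<in> hom C (fst d) (fst c) \<and>
     Le P (fst d) (snd d) (Pull P p (snd c))"

text \<open>The last clause says \<open>\<chi> \<le> \<exists>\<^sub>p \<chi>'\<close>. Covers are what an existential quantifier ranges over, and
  forcing is local for them.\<close>

definition cover :: "'o \<times> 'p \<Rightarrow> 'a \<Rightarrow> 'o \<times> 'p \<Rightarrow> bool" where
  "cover d p c \<longleftrightarrow> refines d p c \<and>
     (\<forall>\<xi>\<in>Fib P (fst c). Le P (fst d) (snd d) (Pull P p \<xi>) \<longrightarrow> Le P (fst c) (snd c) \<xi>)"

lemma forces1_refine: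
  assumes "forces1 c I \<phi> f" "refines d p c"
  shows "forces1 d I \<phi> (f \<cdot> p)"
proof -
  have "Le P (fst d) (Pull P p (snd c)) (Pull P p (Pull P f \<phi>))"
    using assms pull_mono[of p "fst d" "fst c" "snd c" "Pull P f \<phi>"]
    unfolding forces1_def refines_def stage_def by auto
  then have "Le P (fst d) (snd d) (Pull P p (Pull P f \<phi>))"
    using assms le_trans[of "fst d" "snd d" "Pull P p (snd c)" "Pull P p (Pull P f \<phi>)"]
    unfolding forces1_def refines_def stage_def by auto
  then show ?thesis
    using assms pull_comp[of p "fst d" "fst c" f I \<phi>]
    unfolding forces1_def refines_def stage_def by auto
qed

lemma forces1_descend:
  assumes "forces1 d I \<phi> (f \<cdot> p)" "cover d p c" "f \<in> hom C (fst c) I"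
  shows "forces1 c I \<phi> f"
  using assms pull_comp[of p "fst d" "fst c" f I \<phi>]
  unfolding forces1_def refines_def stage_def cover_def by auto

lemma forces_refine:
  assumes "forces c A B \<phi> s t" "refines d p c"
  shows "forces d A B \<phi> (s \<cdot> p) (t \<cdot> p)"
  using assms forces1_refine[of c "A \<otimes> B" \<phi> "\<langle>s, t\<rangle>" d p] unfolding forces_def refines_def
  by auto

lemma forces_descend:
  assumes "forces d A B \<phi> (s \<cdot> p) (t \<cdot> p)" "cover d p c" "s \<in> hom C (fst c) A" "t \<in> hom C (fst c) B"
  shows "forces c A B \<phi> s t"
  using assms forces1_descend[of d "A \<otimes> B" \<phi> "\<langle>s, t\<rangle>" p c] unfolding forces_def cover_def refines_def
  by auto

lemma forces_typed:
  assumes "forces c A B \<phi> s t"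
  shows "stage c" "s \<in> Arr C" "Dom C s = fst c" "Cod C s = A" "t \<in> Arr C" "Dom C t = fst c"
    "Cod C t = B" "A \<in> Obj C" "B \<in> Obj C" "\<phi> \<in> Fib P (A \<otimes> B)" "fst c \<in> Obj C"
  using assms unfolding forces_def forces1_def stage_def by auto

lemma cover_refines: "cover d p c \<Longrightarrow> refines d p c"
  by (simp add: cover_def)

lemma refines_typed:
  assumes "refines d p c"
  shows "stage d" "stage c" "p \<in> Arr C" "Dom C p = fst d" "Cod C p = fst c"
  using assms unfolding refines_def by auto

lemma refines_refl: "stage c \<Longrightarrow> refines c (Ident C (fst c)) c"
  unfolding refines_def stage_def by (auto simp: pull_ident le_refl)

lemma cover_refl: "stage c \<Longrightarrow> cover c (Ident C (fst c)) c"
  unfolding cover_def using refines_refl by (auto simp: pull_ident stage_def)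

lemma refines_trans:
  assumes "refines e q d" "refines d p c"
  shows "refines e (p \<cdot> q) c"
proof -
  have "forces1 c (fst c) (snd c) (Ident C (fst c))"
    using assms unfolding forces1_def refines_def stage_def by (auto simp: pull_ident le_refl)
  from forces1_refine[OF forces1_refine[OF this assms(2)] assms(1)] show ?thesis
    using assms unfolding forces1_def refines_def by auto
qed

lemma cover_trans:
  assumes "cover e q d" "cover d p c"
  shows "cover e (p \<cdot> q) c"
  unfolding cover_def
proof (intro conjI ballI impI)
  show "refines e (p \<cdot> q) c" using assms refines_trans unfolding cover_def by blast
  fix \<xi> assume "\<xi> \<in> Fib P (fst c)" "Le P (fst e) (snd e) (Pull P (p \<cdot> q) \<xi>)"
  then show "Le P (fst c) (snd c) \<xi>"
    using assms pull_comp[of q "fst e" "fst d" p "fst c" \<xi>]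
    unfolding cover_def refines_def by auto
qed

lemma forces1_le:
  assumes "forces1 c I \<phi> f" "\<psi> \<in> Fib P I" "Le P I \<phi> \<psi>"
  shows "forces1 c I \<psi> f"
proof -
  have "Le P (fst c) (Pull P f \<phi>) (Pull P f \<psi>)"
    using assms pull_mono[of f "fst c" I \<phi> \<psi>] unfolding forces1_def by auto
  then show ?thesis
    using assms le_trans[of "fst c" "snd c" "Pull P f \<phi>" "Pull P f \<psi>"]
    unfolding forces1_def stage_def by auto
qed

lemma forces1_generic:
  "I \<in> Obj C \<Longrightarrow> \<phi> \<in> Fib P I \<Longrightarrow> forces1 (I, \<phi>) I \<phi> (Ident C I)"
  unfolding forces1_def stage_def by (auto simp: pull_ident le_refl)

lemma le_by_forces1:
  assumes "I \<in> Obj C" "\<phi> \<in> Fib P I" "forces1 (I, \<phi>) I \<psi> (Ident C I)"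
  shows "Le P I \<phi> \<psi>"
  using assms unfolding forces1_def by (auto simp: pull_ident)

lemma forces1_meet [simp]:
  assumes "\<phi> \<in> Fib P I" "\<psi> \<in> Fib P I"
  shows "forces1 c I (meet P I \<phi> \<psi>) f \<longleftrightarrow> forces1 c I \<phi> f \<and> forces1 c I \<psi> f"
proof (cases "stage c \<and> f \<in> hom C (fst c) I")
  case True
  then have o: "I \<in> Obj C" "fst c \<in> Obj C" by (auto simp: stage_def)
  have "Pull P f (meet P I \<phi> \<psi>) = meet P (fst c) (Pull P f \<phi>) (Pull P f \<psi>)"
    using pull_meet_eq[of f \<phi> \<psi>] True assms by auto
  then show ?thesis
    using True assms le_meet_iff[of "fst c" "Pull P f \<phi>" "Pull P f \<psi>" "snd c"] o
    unfolding forces1_def stage_def by auto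
qed (auto simp: forces1_def)

lemma app_fib [simp]:
  assumes "s \<in> Arr C" "t \<in> Arr C" "Dom C s = I" "Dom C t = I" "\<phi> \<in> Fib P (Cod C s \<otimes> Cod C t)"
  shows "app C P \<phi> s t \<in> Fib P I"
  using assms unfolding app_def by auto

lemma forces1_app:
  assumes "s \<in> Arr C" "t \<in> Arr C" "Dom C s = I" "Dom C t = I" "Cod C s = A" "Cod C t = B"
    "\<phi> \<in> Fib P (A \<otimes> B)" "f \<in> hom C (fst c) I"
  shows "forces1 c I (app C P \<phi> s t) f \<longleftrightarrow> forces c A B \<phi> (s \<cdot> f) (t \<cdot> f)"
  using assms pull_comp[of f "fst c" I "\<langle>s, t\<rangle>" "A \<otimes> B" \<phi>]
  unfolding forces_def forces1_def app_def by auto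

text \<open>Predicates are determined by what forces them, because the stage \<open>(A \<otimes> B, \<phi>)\<close> with the two
  projections is generic for \<open>\<phi>\<close>.\<close>

lemma predicate_eqI:
  assumes "A \<in> Obj C" "B \<in> Obj C" "\<phi> \<in> Fib P (A \<otimes> B)" "\<psi> \<in> Fib P (A \<otimes> B)"
    and "\<And>c s t. forces c A B \<phi> s t \<Longrightarrow> forces c A B \<psi> s t"
    and "\<And>c s t. forces c A B \<psi> s t \<Longrightarrow> forces c A B \<phi> s t"
  shows "\<phi> = \<psi>"
proof -
  have le: "Le P (A \<otimes> B) \<phi> \<psi>"
    if "\<phi> \<in> Fib P (A \<otimes> B)" and "\<And>c s t. forces c A B \<phi> s t \<Longrightarrow> forces c A B \<psi> s t" for \<phi> \<psi>
  proof (rule le_by_forces1)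
    have "forces (A \<otimes> B, \<phi>) A B \<phi> (Pr1 C A B) (Pr2 C A B)"
      using assms(1,2) that(1) forces1_generic unfolding forces_def by simp
    from that(2)[OF this] show "forces1 (A \<otimes> B, \<phi>) (A \<otimes> B) \<psi> (Ident C (A \<otimes> B))"
      using assms(1,2) unfolding forces_def by simp
  qed (use assms(1,2) that in auto)
  show ?thesis
    using le[of \<phi> \<psi>] le[of \<psi> \<phi>] le_antisym[of "A \<otimes> B" \<phi> \<psi>] assms by simp
qed

lemma judgment_by_forcing:
  assumes "I \<in> Obj C" "\<phi> \<in> Fib P I" "\<psi> \<in> Fib P I"
  shows "Le P I \<phi> \<psi> \<longleftrightarrow> (\<forall>c f. forces1 c I \<phi> f \<longrightarrow> forces1 c I \<psi> f)"
proof
  assume "Le P I \<phi> \<psi>"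
  then show "\<forall>c f. forces1 c I \<phi> f \<longrightarrow> forces1 c I \<psi> f" using forces1_le assms(3) by auto
next
  assume "\<forall>c f. forces1 c I \<phi> f \<longrightarrow> forces1 c I \<psi> f"
  then show "Le P I \<phi> \<psi>" using le_by_forces1[OF assms(1,2)] forces1_generic[OF assms(1,2)] by auto
qed

lemma judgmentI:
  assumes "I \<in> Obj C" "\<phi> \<in> Fib P I" "\<psi> \<in> Fib P I" "\<And>c f. forces1 c I \<phi> f \<Longrightarrow> forces1 c I \<psi> f"
  shows "Le P I \<phi> \<psi>"
  using le_by_forces1[OF assms(1,2)] assms(4)[OF forces1_generic[OF assms(1,2)]] by simp

lemma forces1_ex_intro:
  assumes "forces1 c J \<psi> j" "g \<in> hom C J I" "g \<cdot> j = f"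
  shows "forces1 c I (Ex_along C P g \<psi>) f"
proof -
  have J: "J \<in> Obj C" "\<psi> \<in> Fib P J" using assms unfolding forces1_def by auto
  have "Le P J \<psi> (Pull P g (Ex_along C P g \<psi>))"
    using ex_le_iff[of g \<psi> J "Ex_along C P g \<psi>" I] le_refl[of I] J assms by auto
  then have "forces1 c J (Pull P g (Ex_along C P g \<psi>)) j"
    using forces1_le assms J by simp
  then show ?thesis
    using assms pull_comp[of j "fst c" J g I "Ex_along C P g \<psi>"] J
    unfolding forces1_def by auto
qed

text \<open>An existential statement provides a witness on a cover: extend the context by the quantified
  variable and add the quantified formula to the hypothesis. That this is a cover is Frobenius
  reciprocity together with the Beck-Chevalley condition.\<close>

lemma forces1_ex_elim:
  assumes f: "forces1 c I (Ex_along C P (Pr1 C I B) \<psi>) f"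
    and \<psi>: "\<psi> \<in> Fib P (I \<otimes> B)" and B: "B \<in> Obj C"
  obtains d p b where "cover d p c" "b \<in> hom C (fst d) B" "forces1 d (I \<otimes> B) \<psi> \<langle>f \<cdot> p, b\<rangle>"
proof -
  define X where "X = fst c"
  define \<chi> where "\<chi> = snd c"
  define \<pi> where "\<pi> = Pr1 C X B"
  define k where "k = \<langle>f \<cdot> \<pi>, Pr2 C X B\<rangle>"
  have t: "X \<in> Obj C" "I \<in> Obj C" "\<chi> \<in> Fib P X" "f \<in> Arr C" "Dom C f = X" "Cod C f = I"
    using f unfolding forces1_def stage_def X_def \<chi>_def by auto
  have \<pi>: "\<pi> \<in> Arr C" "Dom C \<pi> = X \<otimes> B" "Cod C \<pi> = X" using t B by (auto simp: \<pi>_def)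
  have k: "k \<in> Arr C" "Dom C k = X \<otimes> B" "Cod C k = I \<otimes> B" using t \<pi> B by (auto simp: k_def)
  define d where "d = (X \<otimes> B, meet P (X \<otimes> B) (Pull P k \<psi>) (Pull P \<pi> \<chi>))"
  have fib: "Pull P k \<psi> \<in> Fib P (X \<otimes> B)" "Pull P \<pi> \<chi> \<in> Fib P (X \<otimes> B)" using t \<pi> k \<psi> by auto
  have d_fib: "snd d \<in> Fib P (X \<otimes> B)" using fib t B by (simp add: d_def)
  have le: "Le P (X \<otimes> B) (snd d) (Pull P k \<psi>)" "Le P (X \<otimes> B) (snd d) (Pull P \<pi> \<chi>)"
    using le_meet_iff[of "X \<otimes> B" "Pull P k \<psi>" "Pull P \<pi> \<chi>" "snd d"] fib d_fib t B le_refl[of "X \<otimes> B" "snd d"]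
    by (auto simp: d_def)
  have exk: "Ex_along C P \<pi> (Pull P k \<psi>) \<in> Fib P X" using \<pi> fib by simp
  have "Ex_along C P \<pi> (snd d) = meet P X (Ex_along C P \<pi> (Pull P k \<psi>)) \<chi>"
    using Fr[of \<pi> "X \<otimes> B" X "Pull P k \<psi>" \<chi>] fib t \<pi> by (simp add: d_def)
  moreover have "Ex_along C P \<pi> (Pull P k \<psi>) = Pull P f (Ex_along C P (Pr1 C I B) \<psi>)"
    using BC[OF pullback_context_extension[of f X I B], of \<psi>] t B \<psi> by (simp add: \<pi>_def k_def)
  ultimately have ex: "Le P X \<chi> (Ex_along C P \<pi> (snd d))"
    using f le_meet_iff[of X "Ex_along C P \<pi> (Pull P k \<psi>)" \<chi> \<chi>] exk t le_refl[of X \<chi>]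
    unfolding forces1_def X_def \<chi>_def by simp
  have ref: "refines d \<pi> c"
    unfolding refines_def stage_def using t \<pi> d_fib le B
    by (auto simp: X_def[symmetric] \<chi>_def[symmetric]) (auto simp: d_def)
  have "cover d \<pi> c"
    unfolding cover_def
  proof (intro conjI ballI impI ref)
    fix \<xi> assume "\<xi> \<in> Fib P (fst c)" "Le P (fst d) (snd d) (Pull P \<pi> \<xi>)"
    then have "\<xi> \<in> Fib P X" "Le P X (Ex_along C P \<pi> (snd d)) \<xi>"
      using ex_le_iff[of \<pi> "snd d" "X \<otimes> B" \<xi> X] \<pi> d_fib by (auto simp: X_def d_def)
    then show "Le P (fst c) (snd c) \<xi>"
      using ex le_trans[of X \<chi> "Ex_along C P \<pi> (snd d)" \<xi>] t \<pi> d_fib by (auto simp: X_def \<chi>_def)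
  qed
  moreover have "Pr2 C X B \<in> hom C (fst d) B" using t B by (simp add: d_def)
  moreover have "forces1 d (I \<otimes> B) \<psi> \<langle>f \<cdot> \<pi>, Pr2 C X B\<rangle>"
    unfolding forces1_def k_def[symmetric] using refines_typed(1)[OF ref] k \<psi> le by (simp add: d_def)
  ultimately show ?thesis using that by blast
qed

lemma forces1_ex_cover_intro:
  assumes "cover d p c" "forces1 d (I \<otimes> B) \<psi> \<langle>f \<cdot> p, b\<rangle>"
    "f \<in> hom C (fst c) I" "b \<in> hom C (fst d) B" "\<psi> \<in> Fib P (I \<otimes> B)"
  shows "forces1 c I (Ex_along C P (Pr1 C I B) \<psi>) f"
proof -
  have "I \<in> Obj C" "B \<in> Obj C" using assms by auto
  then have "forces1 d I (Ex_along C P (Pr1 C I B) \<psi>) (f \<cdot> p)"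
    using assms refines_typed[OF cover_refines[OF assms(1)]] by (intro forces1_ex_intro[OF assms(2)]) auto
  then show ?thesis
    using assms(1,3) by (rule forces1_descend)
qed

end

section \<open>Partial equivalence relations and functional relations\<close>

context indexed_frame
begin

lemma forces1_app_iff [simp]:
  assumes "s \<in> Arr C" "t \<in> Arr C" "Dom C s = I" "Dom C t = I" "Cod C s = A" "Cod C t = B"
    "\<phi> \<in> Fib P (A \<otimes> B)"
  shows "forces1 c I (app C P \<phi> s t) f \<longleftrightarrow> f \<in> hom C (fst c) I \<and> forces c A B \<phi> (s \<cdot> f) (t \<cdot> f)"
  using forces1_app[OF assms, of f c] unfolding forces1_def by auto

lemma forces_typing [dest]:
  assumes "forces c A B \<phi> s t"
  shows "s \<in> hom C (fst c) A \<and> t \<in> hom C (fst c) B \<and> stage c"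
  using forces_typed[OF assms] by simp

lemma is_per_iff:
  "is_per C P A \<rho> \<longleftrightarrow> A \<in> Obj C \<and> \<rho> \<in> Fib P (A \<otimes> A) \<and>
    (\<forall>c s t. forces c A A \<rho> s t \<longrightarrow> forces c A A \<rho> t s) \<and>
    (\<forall>c s t r. forces c A A \<rho> s t \<and> forces c A A \<rho> t r \<longrightarrow> forces c A A \<rho> s r)"
proof (cases "A \<in> Obj C \<and> \<rho> \<in> Fib P (A \<otimes> A)")
  case True
  let ?x = "Pr1 C A A" and ?y = "Pr2 C A A"
  have "Le P (A \<otimes> A) (app C P \<rho> ?x ?y) (app C P \<rho> ?y ?x) \<longleftrightarrow>
    (\<forall>c s t. forces c A A \<rho> s t \<longrightarrow> forces c A A \<rho> t s)" (is "?l \<longleftrightarrow> ?r")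
  proof
    assume l: ?l
    show ?r
    proof (intro allI impI)
      fix c s t assume st: "forces c A A \<rho> s t"
      have "forces1 c (A \<otimes> A) (app C P \<rho> ?y ?x) \<langle>s, t\<rangle>"
        by (rule forces1_le[OF _ _ l]) (use True st forces_typed[OF st] in simp_all)
      then show "forces c A A \<rho> t s" using True forces_typed[OF st] by simp
    qed
  next
    assume ?r then show ?l using True by (simp add: judgment_by_forcing)
  qed
  moreover
  let ?\<Gamma> = "(A \<otimes> A) \<otimes> A"
  let ?p = "Pr1 C (A \<otimes> A) A" and ?z = "Pr2 C (A \<otimes> A) A"
  have "Le P ?\<Gamma> (meet P ?\<Gamma> (app C P \<rho> (?x \<cdot> ?p) (?y \<cdot> ?p)) (app C P \<rho> (?y \<cdot> ?p) ?z))
      (app C P \<rho> (?x \<cdot> ?p) ?z) \<longleftrightarrow>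
    (\<forall>c s t r. forces c A A \<rho> s t \<and> forces c A A \<rho> t r \<longrightarrow> forces c A A \<rho> s r)" (is "?l \<longleftrightarrow> ?r")
  proof
    assume l: ?l
    show ?r
    proof (intro allI impI)
      fix c s t r assume st: "forces c A A \<rho> s t \<and> forces c A A \<rho> t r"
      note ty = forces_typed[OF st[THEN conjunct1]] forces_typed[OF st[THEN conjunct2]]
      have "forces1 c ?\<Gamma> (app C P \<rho> (?x \<cdot> ?p) ?z) \<langle>\<langle>s, t\<rangle>, r\<rangle>"
        by (rule forces1_le[OF _ _ l]) (use True st ty in simp_all)
      then show "forces c A A \<rho> s r" using True ty by simp
    qed
  next
    assume r: ?r
    show ?l
    proof (rule judgmentI)
      fix c f
      assume h: "forces1 c ?\<Gamma> (meet P ?\<Gamma> (app C P \<rho> (?x \<cdot> ?p) (?y \<cdot> ?p)) (app C P \<rho> (?y \<cdot> ?p) ?z)) f"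
      then have f: "f \<in> hom C (fst c) ?\<Gamma>" by (simp add: forces1_def)
      have "forces c A A \<rho> ((?x \<cdot> ?p) \<cdot> f) ((?y \<cdot> ?p) \<cdot> f) \<and> forces c A A \<rho> ((?y \<cdot> ?p) \<cdot> f) (?z \<cdot> f)"
        using h f True by auto
      then show "forces1 c ?\<Gamma> (app C P \<rho> (?x \<cdot> ?p) ?z) f"
        using f True r[rule_format, of c "(?x \<cdot> ?p) \<cdot> f" "(?y \<cdot> ?p) \<cdot> f" "?z \<cdot> f"] by simp
    qed (use True in simp_all)
  qed
  ultimately show ?thesis using True unfolding is_per_def Let_def by simp
qed (auto simp: is_per_def)

lemma per_typed: "is_per C P A \<rho> \<Longrightarrow> A \<in> Obj C \<and> \<rho> \<in> Fib P (A \<otimes> A)"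
  unfolding is_per_def by simp

lemma per_sym: "is_per C P A \<rho> \<Longrightarrow> forces c A A \<rho> s t \<Longrightarrow> forces c A A \<rho> t s"
  unfolding is_per_iff by blast

lemma per_trans:
  "is_per C P A \<rho> \<Longrightarrow> forces c A A \<rho> s t \<Longrightarrow> forces c A A \<rho> t r \<Longrightarrow> forces c A A \<rho> s r"
  unfolding is_per_iff by blast

lemma per_refl:
  "is_per C P A \<rho> \<Longrightarrow> forces c A A \<rho> s t \<Longrightarrow> forces c A A \<rho> s s"
  "is_per C P A \<rho> \<Longrightarrow> forces c A A \<rho> s t \<Longrightarrow> forces c A A \<rho> t t"
  by (blast intro: per_sym per_trans)+

lemma per_map_iff:
  "per_map C P (A, \<rho>) f (B, \<sigma>) \<longleftrightarrow> is_per C P A \<rho> \<and> is_per C P B \<sigma> \<and> f \<in> hom C A B \<and>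
    (\<forall>c s t. forces c A A \<rho> s t \<longrightarrow> forces c B B \<sigma> (f \<cdot> s) (f \<cdot> t))"
proof (cases "is_per C P A \<rho> \<and> is_per C P B \<sigma> \<and> f \<in> hom C A B")
  case True
  then have t: "A \<in> Obj C" "B \<in> Obj C" "\<rho> \<in> Fib P (A \<otimes> A)" "\<sigma> \<in> Fib P (B \<otimes> B)"
    "f \<in> Arr C" "Dom C f = A" "Cod C f = B" using per_typed by auto
  let ?x = "Pr1 C A A" and ?y = "Pr2 C A A"
  have "Le P (A \<otimes> A) (app C P \<rho> ?x ?y) (app C P \<sigma> (f \<cdot> ?x) (f \<cdot> ?y)) \<longleftrightarrow>
    (\<forall>c s t. forces c A A \<rho> s t \<longrightarrow> forces c B B \<sigma> (f \<cdot> s) (f \<cdot> t))" (is "?l \<longleftrightarrow> ?r")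
  proof
    assume l: ?l
    show ?r
    proof (intro allI impI)
      fix c s u assume st: "forces c A A \<rho> s u"
      have "forces1 c (A \<otimes> A) (app C P \<sigma> (f \<cdot> ?x) (f \<cdot> ?y)) \<langle>s, u\<rangle>"
        by (rule forces1_le[OF _ _ l]) (use t st forces_typed[OF st] in simp_all)
      then show "forces c B B \<sigma> (f \<cdot> s) (f \<cdot> u)" using t forces_typed[OF st] by simp
    qed
  next
    assume ?r then show ?l using t by (simp add: judgment_by_forcing)
  qed
  then show ?thesis using True unfolding per_map_def Let_def by simp
qed (auto simp: per_map_def)

lemma per_mapI:
  assumes "is_per C P A \<rho>" "is_per C P B \<sigma>" "f \<in> hom C A B"
    and "\<And>c s t. forces c A A \<rho> s t \<Longrightarrow> forces c B B \<sigma> (f \<cdot> s) (f \<cdot> t)"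
  shows "per_map C P (A, \<rho>) f (B, \<sigma>)"
  unfolding per_map_iff using assms by blast

lemma per_map_forces:
  "per_map C P (A, \<rho>) f (B, \<sigma>) \<Longrightarrow> forces c A A \<rho> s t \<Longrightarrow> forces c B B \<sigma> (f \<cdot> s) (f \<cdot> t)"
  unfolding per_map_iff by blast

lemma per_map_typed:
  assumes "per_map C P (A, \<rho>) f (B, \<sigma>)"
  shows "is_per C P A \<rho>" "is_per C P B \<sigma>" "f \<in> Arr C" "Dom C f = A" "Cod C f = B"
    "A \<in> Obj C" "B \<in> Obj C" "\<rho> \<in> Fib P (A \<otimes> A)" "\<sigma> \<in> Fib P (B \<otimes> B)"
  using assms per_typed unfolding per_map_iff by auto

text \<open>Totality is the only clause with a quantifier; read by forcing, it yields a value on a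
  cover.\<close>

lemma func_rel_iff:
  "func_rel C P (A, \<rho>) \<phi> (B, \<sigma>) \<longleftrightarrow> is_per C P A \<rho> \<and> is_per C P B \<sigma> \<and> \<phi> \<in> Fib P (A \<otimes> B) \<and>
    (\<forall>c s u. forces c A B \<phi> s u \<longrightarrow> forces c A A \<rho> s s \<and> forces c B B \<sigma> u u) \<and>
    (\<forall>c s t u v. forces c A A \<rho> t s \<and> forces c A B \<phi> s u \<and> forces c B B \<sigma> u v \<longrightarrow>
      forces c A B \<phi> t v) \<and>
    (\<forall>c s u v. forces c A B \<phi> s u \<and> forces c A B \<phi> s v \<longrightarrow> forces c B B \<sigma> u v) \<and>
    (\<forall>c s. forces c A A \<rho> s s \<longrightarrow> (\<exists>d p u. cover d p c \<and> forces d A B \<phi> (s \<cdot> p) u))"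
proof (cases "is_per C P A \<rho> \<and> is_per C P B \<sigma> \<and> \<phi> \<in> Fib P (A \<otimes> B)")
  case True
  then have t: "A \<in> Obj C" "B \<in> Obj C" "\<rho> \<in> Fib P (A \<otimes> A)" "\<sigma> \<in> Fib P (B \<otimes> B)"
    "\<phi> \<in> Fib P (A \<otimes> B)" using per_typed by auto
  let ?x = "Pr1 C A B" and ?u = "Pr2 C A B"
  have "Le P (A \<otimes> B) (app C P \<phi> ?x ?u) (meet P (A \<otimes> B) (app C P \<rho> ?x ?x) (app C P \<sigma> ?u ?u)) \<longleftrightarrow>
    (\<forall>c s u. forces c A B \<phi> s u \<longrightarrow> forces c A A \<rho> s s \<and> forces c B B \<sigma> u u)" (is "?l \<longleftrightarrow> ?r")
  proof
    assume l: ?l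
    show ?r
    proof (intro allI impI)
      fix c s u assume st: "forces c A B \<phi> s u"
      have "forces1 c (A \<otimes> B) (meet P (A \<otimes> B) (app C P \<rho> ?x ?x) (app C P \<sigma> ?u ?u)) \<langle>s, u\<rangle>"
        by (rule forces1_le[OF _ _ l]) (use t st forces_typed[OF st] in simp_all)
      then show "forces c A A \<rho> s s \<and> forces c B B \<sigma> u u" using t forces_typed[OF st] by simp
    qed
  next
    assume r: ?r
    show ?l
    proof (rule judgmentI)
      fix c f
      assume h: "forces1 c (A \<otimes> B) (app C P \<phi> ?x ?u) f"
      then have f: "f \<in> hom C (fst c) (A \<otimes> B)" by (simp add: forces1_def)
      have "forces c A B \<phi> (?x \<cdot> f) (?u \<cdot> f)" using h f t by auto
      then show "forces1 c (A \<otimes> B) (meet P (A \<otimes> B) (app C P \<rho> ?x ?x) (app C P \<sigma> ?u ?u)) f"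
        using f t r[rule_format, of c "?x \<cdot> f" "?u \<cdot> f"] by simp
    qed (use t in simp_all)
  qed
  moreover
  let ?G2 = "A \<otimes> A" and ?G3 = "(A \<otimes> A) \<otimes> B" and ?G4 = "((A \<otimes> A) \<otimes> B) \<otimes> B"
  let ?x = "Pr1 C A A \<cdot> (Pr1 C ?G2 B \<cdot> Pr1 C ?G3 B)" and ?y = "Pr2 C A A \<cdot> (Pr1 C ?G2 B \<cdot> Pr1 C ?G3 B)"
    and ?u = "Pr2 C ?G2 B \<cdot> Pr1 C ?G3 B" and ?v = "Pr2 C ?G3 B"
  have "Le P ?G4 (meet P ?G4 (meet P ?G4 (app C P \<rho> ?y ?x) (app C P \<phi> ?x ?u)) (app C P \<sigma> ?u ?v))
      (app C P \<phi> ?y ?v) \<longleftrightarrow>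
    (\<forall>c s t u v. forces c A A \<rho> t s \<and> forces c A B \<phi> s u \<and> forces c B B \<sigma> u v \<longrightarrow>
      forces c A B \<phi> t v)" (is "?l \<longleftrightarrow> ?r")
  proof
    assume l: ?l
    show ?r
    proof (intro allI impI)
      fix c s t' u v assume st: "forces c A A \<rho> t' s \<and> forces c A B \<phi> s u \<and> forces c B B \<sigma> u v"
      then have st1: "forces c A A \<rho> t' s" and st2: "forces c B B \<sigma> u v" by auto
      note ty = forces_typed[OF st1] forces_typed[OF st2]
      have "forces1 c ?G4 (app C P \<phi> ?y ?v) \<langle>\<langle>\<langle>s, t'\<rangle>, u\<rangle>, v\<rangle>"
        by (rule forces1_le[OF _ _ l]) (use t st ty in simp_all)
      then show "forces c A B \<phi> t' v" using t ty by simp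
    qed
  next
    assume r: ?r
    show ?l
    proof (rule judgmentI)
      fix c f
      assume h: "forces1 c ?G4 (meet P ?G4 (meet P ?G4 (app C P \<rho> ?y ?x) (app C P \<phi> ?x ?u)) (app C P \<sigma> ?u ?v)) f"
      then have f: "f \<in> hom C (fst c) ?G4" by (simp add: forces1_def)
      have "forces c A A \<rho> (?y \<cdot> f) (?x \<cdot> f) \<and> forces c A B \<phi> (?x \<cdot> f) (?u \<cdot> f) \<and>
          forces c B B \<sigma> (?u \<cdot> f) (?v \<cdot> f)"
        using h f t by auto
      then show "forces1 c ?G4 (app C P \<phi> ?y ?v) f"
        using f t r[rule_format, of c "?y \<cdot> f" "?x \<cdot> f" "?u \<cdot> f" "?v \<cdot> f"] by simp
    qed (use t in simp_all)
  qed
  moreover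
  let ?G2 = "A \<otimes> B" and ?G3 = "(A \<otimes> B) \<otimes> B"
  let ?x = "Pr1 C A B \<cdot> Pr1 C ?G2 B" and ?u = "Pr2 C A B \<cdot> Pr1 C ?G2 B" and ?v = "Pr2 C ?G2 B"
  have "Le P ?G3 (meet P ?G3 (app C P \<phi> ?x ?u) (app C P \<phi> ?x ?v)) (app C P \<sigma> ?u ?v) \<longleftrightarrow>
    (\<forall>c s u v. forces c A B \<phi> s u \<and> forces c A B \<phi> s v \<longrightarrow> forces c B B \<sigma> u v)" (is "?l \<longleftrightarrow> ?r")
  proof
    assume l: ?l
    show ?r
    proof (intro allI impI)
      fix c s u v assume st: "forces c A B \<phi> s u \<and> forces c A B \<phi> s v"
      then have st1: "forces c A B \<phi> s u" and st2: "forces c A B \<phi> s v" by auto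
      note ty = forces_typed[OF st1] forces_typed[OF st2]
      have "forces1 c ?G3 (app C P \<sigma> ?u ?v) \<langle>\<langle>s, u\<rangle>, v\<rangle>"
        by (rule forces1_le[OF _ _ l]) (use t st ty in simp_all)
      then show "forces c B B \<sigma> u v" using t ty by simp
    qed
  next
    assume r: ?r
    show ?l
    proof (rule judgmentI)
      fix c f
      assume h: "forces1 c ?G3 (meet P ?G3 (app C P \<phi> ?x ?u) (app C P \<phi> ?x ?v)) f"
      then have f: "f \<in> hom C (fst c) ?G3" by (simp add: forces1_def)
      have "forces c A B \<phi> (?x \<cdot> f) (?u \<cdot> f) \<and> forces c A B \<phi> (?x \<cdot> f) (?v \<cdot> f)"
        using h f t by auto
      then show "forces1 c ?G3 (app C P \<sigma> ?u ?v) f"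
        using f t r[rule_format, of c "?x \<cdot> f" "?u \<cdot> f" "?v \<cdot> f"] by simp
    qed (use t in simp_all)
  qed
  moreover
  let ?i = "Ident C A" and ?x = "Pr1 C A B" and ?u = "Pr2 C A B"
  have "Le P A (app C P \<rho> ?i ?i) (Ex_along C P ?x (app C P \<phi> ?x ?u)) \<longleftrightarrow>
    (\<forall>c s. forces c A A \<rho> s s \<longrightarrow> (\<exists>d p u. cover d p c \<and> forces d A B \<phi> (s \<cdot> p) u))" (is "?l \<longleftrightarrow> ?r")
  proof
    assume l: ?l
    show ?r
    proof (intro allI impI)
      fix c s assume st: "forces c A A \<rho> s s"
      note ty = forces_typed[OF st]
      have "forces1 c A (Ex_along C P ?x (app C P \<phi> ?x ?u)) s"
        by (rule forces1_le[OF _ _ l]) (use t st ty in simp_all)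
      then obtain d p b where d: "cover d p c" "b \<in> hom C (fst d) B"
          "forces1 d (A \<otimes> B) (app C P \<phi> ?x ?u) \<langle>s \<cdot> p, b\<rangle>"
        using t by (elim forces1_ex_elim) auto
      then have "forces d A B \<phi> (s \<cdot> p) b"
        using t ty refines_typed[OF cover_refines[OF d(1)]] by simp
      with d show "\<exists>d p u. cover d p c \<and> forces d A B \<phi> (s \<cdot> p) u" by blast
    qed
  next
    assume r: ?r
    have "forces1 c A (Ex_along C P ?x (app C P \<phi> ?x ?u)) s"
      if "forces1 c A (app C P \<rho> ?i ?i) s" for c s
    proof -
      have s: "forces c A A \<rho> s s" using that t by auto
      then obtain d p u where d: "cover d p c" "forces d A B \<phi> (s \<cdot> p) u" using r by blast
      then have "forces1 d (A \<otimes> B) (app C P \<phi> ?x ?u) \<langle>s \<cdot> p, u\<rangle>"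
        using t forces_typed[OF s] forces_typed[OF d(2)] refines_typed[OF cover_refines[OF d(1)]] by simp
      then show ?thesis using s t forces_typed[OF s] forces_typed[OF d(2)] by (intro forces1_ex_cover_intro[OF d(1)]) auto
    qed
    then show ?l using t by (subst judgment_by_forcing) auto
  qed
  ultimately show ?thesis using True unfolding func_rel_def Let_def by simp
qed (auto simp: func_rel_def)

lemma func_relI:
  assumes "is_per C P A \<rho>" "is_per C P B \<sigma>" "\<phi> \<in> Fib P (A \<otimes> B)"
    and "\<And>c s u. forces c A B \<phi> s u \<Longrightarrow> forces c A A \<rho> s s \<and> forces c B B \<sigma> u u"
    and "\<And>c s t u v. forces c A A \<rho> t s \<Longrightarrow> forces c A B \<phi> s u \<Longrightarrow> forces c B B \<sigma> u v \<Longrightarrow>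
      forces c A B \<phi> t v"
    and "\<And>c s u v. forces c A B \<phi> s u \<Longrightarrow> forces c A B \<phi> s v \<Longrightarrow> forces c B B \<sigma> u v"
    and "\<And>c s. forces c A A \<rho> s s \<Longrightarrow> \<exists>d p u. cover d p c \<and> forces d A B \<phi> (s \<cdot> p) u"
  shows "func_rel C P (A, \<rho>) \<phi> (B, \<sigma>)"
  unfolding func_rel_iff using assms by (intro conjI allI impI) (assumption | blast)+

lemma func_rel_typed:
  assumes "func_rel C P (A, \<rho>) \<phi> (B, \<sigma>)"
  shows "is_per C P A \<rho>" "is_per C P B \<sigma>" "\<phi> \<in> Fib P (A \<otimes> B)" "A \<in> Obj C" "B \<in> Obj C"
    "\<rho> \<in> Fib P (A \<otimes> A)" "\<sigma> \<in> Fib P (B \<otimes> B)"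
  using assms per_typed unfolding func_rel_iff by blast+

lemma func_rel_strict:
  assumes "func_rel C P (A, \<rho>) \<phi> (B, \<sigma>)" "forces c A B \<phi> s u"
  shows "forces c A A \<rho> s s" "forces c B B \<sigma> u u"
  using assms unfolding func_rel_iff by blast+

lemma func_rel_ext:
  "func_rel C P (A, \<rho>) \<phi> (B, \<sigma>) \<Longrightarrow> forces c A A \<rho> t s \<Longrightarrow> forces c A B \<phi> s u \<Longrightarrow> forces c B B \<sigma> u v \<Longrightarrow>
    forces c A B \<phi> t v"
  unfolding func_rel_iff by blast

lemma func_rel_single_valued:
  "func_rel C P (A, \<rho>) \<phi> (B, \<sigma>) \<Longrightarrow> forces c A B \<phi> s u \<Longrightarrow> forces c A B \<phi> s v \<Longrightarrow> forces c B B \<sigma> u v"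
  unfolding func_rel_iff by blast

lemma func_rel_total:
  assumes "func_rel C P (A, \<rho>) \<phi> (B, \<sigma>)" "forces c A A \<rho> s s"
  obtains d p u where "cover d p c" "forces d A B \<phi> (s \<cdot> p) u"
  using assms unfolding func_rel_iff by blast

text \<open>Totality of \<open>\<phi>\<close> and single-valuedness of \<open>\<psi>\<close> leave nothing between them, so equations
  between functional relations need one inclusion only, and the more convenient one can be chosen.\<close>

lemma func_rel_eqI:
  assumes \<phi>: "func_rel C P (A, \<rho>) \<phi> (B, \<sigma>)" and \<psi>: "func_rel C P (A, \<rho>) \<psi> (B, \<sigma>)"
    and le: "\<And>c s u. forces c A B \<phi> s u \<Longrightarrow> forces c A B \<psi> s u"
  shows "\<phi> = \<psi>"
proof (rule predicate_eqI[of A B])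
  fix c s u assume su: "forces c A B \<psi> s u"
  obtain d p v where d: "cover d p c" "forces d A B \<phi> (s \<cdot> p) v"
    using func_rel_total[OF \<phi> func_rel_strict(1)[OF \<psi> su]] by blast
  have "forces d B B \<sigma> v (u \<cdot> p)"
    using func_rel_single_valued[OF \<psi> le[OF d(2)] forces_refine[OF su cover_refines[OF d(1)]]] .
  then have "forces d A B \<phi> (s \<cdot> p) (u \<cdot> p)"
    using func_rel_ext[OF \<phi> func_rel_strict(1)[OF \<phi> d(2)] d(2)] by blast
  then show "forces c A B \<phi> s u" by (rule forces_descend[OF _ d(1)]) (use su in auto)
qed (use func_rel_typed[OF \<phi>] func_rel_typed[OF \<psi>] le in auto)

lemma rel_comp_fib:
  assumes "A \<in> Obj C" "B \<in> Obj C" "D \<in> Obj C" "\<phi> \<in> Fib P (A \<otimes> B)" "\<gamma> \<in> Fib P (B \<otimes> D)"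
  shows "rel_comp C P A B D \<gamma> \<phi> \<in> Fib P (A \<otimes> D)"
  using assms unfolding rel_comp_def Let_def by simp

lemma rel_comp_intro:
  assumes "cover d p c" "forces d A B \<phi> (s \<cdot> p) u" "forces d B D \<gamma> u (r \<cdot> p)"
    "s \<in> hom C (fst c) A" "r \<in> hom C (fst c) D"
  shows "forces c A D (rel_comp C P A B D \<gamma> \<phi>) s r"
proof -
  let ?p = "Pr1 C (A \<otimes> D) B" and ?u = "Pr2 C (A \<otimes> D) B"
  let ?x = "Pr1 C A D \<cdot> ?p" and ?r = "Pr2 C A D \<cdot> ?p"
  let ?\<psi> = "meet P ((A \<otimes> D) \<otimes> B) (app C P \<phi> ?x ?u) (app C P \<gamma> ?u ?r)"
  have o: "D \<in> Obj C" "A \<in> Obj C" "B \<in> Obj C" using assms forces_typed by auto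
  note ty = forces_typed[OF assms(2)] forces_typed[OF assms(3)] refines_typed[OF cover_refines[OF assms(1)]]
  have "forces1 d ((A \<otimes> D) \<otimes> B) ?\<psi> \<langle>\<langle>s, r\<rangle> \<cdot> p, u\<rangle>"
    using assms o ty by simp
  then have "forces1 c (A \<otimes> D) (Ex_along C P ?p ?\<psi>) \<langle>s, r\<rangle>"
    using assms o ty by (intro forces1_ex_cover_intro[OF assms(1)]) auto
  then show ?thesis
    using assms unfolding forces_def[of c A D] rel_comp_def Let_def by auto
qed

lemma rel_comp_elim:
  assumes "forces c A D (rel_comp C P A B D \<gamma> \<phi>) s r"
    "B \<in> Obj C" "\<phi> \<in> Fib P (A \<otimes> B)" "\<gamma> \<in> Fib P (B \<otimes> D)"
  obtains d p u where "cover d p c" "forces d A B \<phi> (s \<cdot> p) u" "forces d B D \<gamma> u (r \<cdot> p)"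
proof -
  let ?p = "Pr1 C (A \<otimes> D) B" and ?u = "Pr2 C (A \<otimes> D) B"
  let ?x = "Pr1 C A D \<cdot> ?p" and ?r = "Pr2 C A D \<cdot> ?p"
  let ?\<psi> = "meet P ((A \<otimes> D) \<otimes> B) (app C P \<phi> ?x ?u) (app C P \<gamma> ?u ?r)"
  note ty = forces_typed[OF assms(1)]
  have "forces1 c (A \<otimes> D) (Ex_along C P ?p ?\<psi>) \<langle>s, r\<rangle>"
    using assms(1) unfolding forces_def rel_comp_def Let_def by simp
  then obtain d p u where d: "cover d p c" "u \<in> hom C (fst d) B" "forces1 d ((A \<otimes> D) \<otimes> B) ?\<psi> \<langle>\<langle>s, r\<rangle> \<cdot> p, u\<rangle>"
    using ty assms by (elim forces1_ex_elim) auto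
  then show ?thesis
    using that[of d p u] ty assms refines_typed[OF cover_refines[OF d(1)]] by simp
qed

end

section \<open>The two categories\<close>

context indexed_frame
begin

lemma per_map_ident: "is_per C P A \<rho> \<Longrightarrow> per_map C P (A, \<rho>) (Ident C A) (A, \<rho>)"
proof (rule per_mapI)
  fix c s t assume st: "forces c A A \<rho> s t"
  then show "forces c A A \<rho> (Ident C A \<cdot> s) (Ident C A \<cdot> t)" using forces_typed[OF st] by simp
qed (auto dest: per_typed)

lemma per_map_comp:
  assumes "per_map C P (A, \<rho>) f (B, \<sigma>)" "per_map C P (B, \<sigma>) g (D, \<tau>)"
  shows "per_map C P (A, \<rho>) (g \<cdot> f) (D, \<tau>)"
proof (rule per_mapI)
  fix c s t assume st: "forces c A A \<rho> s t"
  then show "forces c D D \<tau> (g \<cdot> f \<cdot> s) (g \<cdot> f \<cdot> t)"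
    using per_map_forces[OF assms(2) per_map_forces[OF assms(1) st]] forces_typed[OF st]
      per_map_typed[OF assms(1)] per_map_typed[OF assms(2)] by simp
qed (use per_map_typed[OF assms(1)] per_map_typed[OF assms(2)] in simp_all)

lemma PerCat_hom_iff:
  "F \<in> hom (PerCat C P) X Y \<longleftrightarrow> (\<exists>f. F = (X, f, Y) \<and> per_map C P X f Y)"
  unfolding hom_def PerCat_def by auto

lemma PerCat_obj_iff [simp]: "(A, \<rho>) \<in> Obj (PerCat C P) \<longleftrightarrow> is_per C P A \<rho>"
  unfolding PerCat_def by simp

lemma PerCat_comp [simp]: "(Y', g, Z) \<cdot>\<^bsub>PerCat C P\<^esub> (X, f, Y) = (X, g \<cdot> f, Z)"
  unfolding PerCat_def by simp

lemma PerCat_ident [simp]: "Ident (PerCat C P) (A, \<rho>) = ((A, \<rho>), Ident C A, (A, \<rho>))"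
  unfolding PerCat_def by simp

lemma PerCat_category: "category (PerCat C P)"
proof
  fix F assume F: "F \<in> Arr (PerCat C P)"
  then obtain A \<rho> f B \<sigma> where "F = ((A, \<rho>), f, (B, \<sigma>))" "per_map C P (A, \<rho>) f (B, \<sigma>)"
    unfolding PerCat_def by auto
  then show "Dom (PerCat C P) F \<in> Obj (PerCat C P)" "Cod (PerCat C P) F \<in> Obj (PerCat C P)"
    using per_map_typed unfolding PerCat_def by auto
next
  fix X assume "X \<in> Obj (PerCat C P)"
  then show "Ident (PerCat C P) X \<in> hom (PerCat C P) X X"
    by (cases X) (auto simp: PerCat_hom_iff per_map_ident)
next
  fix F X Y G Z assume F: "F \<in> hom (PerCat C P) X Y" "G \<in> hom (PerCat C P) Y Z"
  then show "G \<cdot>\<^bsub>PerCat C P\<^esub> F \<in> hom (PerCat C P) X Z"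
    by (cases X; cases Y; cases Z) (auto simp: PerCat_hom_iff per_map_comp)
  fix H W assume "H \<in> hom (PerCat C P) Z W"
  with F show "H \<cdot>\<^bsub>PerCat C P\<^esub> (G \<cdot>\<^bsub>PerCat C P\<^esub> F) = H \<cdot>\<^bsub>PerCat C P\<^esub> G \<cdot>\<^bsub>PerCat C P\<^esub> F"
    by (cases X; cases Y; cases Z; cases W) (auto simp: PerCat_hom_iff per_map_typed)
next
  fix F X Y assume F: "F \<in> hom (PerCat C P) X Y"
  then show "F \<cdot>\<^bsub>PerCat C P\<^esub> Ident (PerCat C P) X = F" "Ident (PerCat C P) Y \<cdot>\<^bsub>PerCat C P\<^esub> F = F"
    by (cases X; cases Y; auto simp: PerCat_hom_iff per_map_typed)+
qed

lemma func_rel_ident: "is_per C P A \<rho> \<Longrightarrow> func_rel C P (A, \<rho>) \<rho> (A, \<rho>)"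
proof (rule func_relI)
  fix c s assume "is_per C P A \<rho>" and s: "forces c A A \<rho> s s"
  have "cover c (Ident C (fst c)) c \<and> forces c A A \<rho> (s \<cdot> Ident C (fst c)) s"
    using s forces_typed[OF s] cover_refl by simp
  then show "\<exists>d p u. cover d p c \<and> forces d A A \<rho> (s \<cdot> p) u" by blast
qed (blast intro: per_refl per_sym per_trans dest: per_typed)+

lemma func_rel_comp:
  assumes \<phi>: "func_rel C P (A, \<rho>) \<phi> (B, \<sigma>)" and \<gamma>: "func_rel C P (B, \<sigma>) \<gamma> (D, \<tau>)"
  shows "func_rel C P (A, \<rho>) (rel_comp C P A B D \<gamma> \<phi>) (D, \<tau>)"
proof (rule func_relI)
  note t = func_rel_typed[OF \<phi>] func_rel_typed[OF \<gamma>]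
  show "is_per C P A \<rho>" "is_per C P D \<tau>" "rel_comp C P A B D \<gamma> \<phi> \<in> Fib P (A \<otimes> D)"
    using t rel_comp_fib by auto
  note elim = rel_comp_elim[of _ A D B \<gamma> \<phi>, OF _ t(5) t(3) t(10)]
  {
    fix c s r assume h: "forces c A D (rel_comp C P A B D \<gamma> \<phi>) s r"
    then obtain d p u where d: "cover d p c" "forces d A B \<phi> (s \<cdot> p) u" "forces d B D \<gamma> u (r \<cdot> p)"
      by (elim elim)
    have "forces c A A \<rho> s s"
      by (rule forces_descend[OF func_rel_strict(1)[OF \<phi> d(2)] d(1)]) (use h in auto)
    moreover have "forces c D D \<tau> r r"
      by (rule forces_descend[OF func_rel_strict(2)[OF \<gamma> d(3)] d(1)]) (use h in auto)
    ultimately show "forces c A A \<rho> s s \<and> forces c D D \<tau> r r" by blast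
  next
    fix c s t r q
    assume ts: "forces c A A \<rho> t s" and h: "forces c A D (rel_comp C P A B D \<gamma> \<phi>) s r"
      and rq: "forces c D D \<tau> r q"
    obtain d p u where d: "cover d p c" "forces d A B \<phi> (s \<cdot> p) u" "forces d B D \<gamma> u (r \<cdot> p)"
      using h by (elim elim)
    note ref = cover_refines[OF d(1)]
    have u: "forces d B B \<sigma> u u" using func_rel_strict(2)[OF \<phi> d(2)] .
    show "forces c A D (rel_comp C P A B D \<gamma> \<phi>) t q"
    proof (rule rel_comp_intro[OF d(1)])
      show "forces d A B \<phi> (t \<cdot> p) u"
        using func_rel_ext[OF \<phi> forces_refine[OF ts ref] d(2) u] .
      show "forces d B D \<gamma> u (q \<cdot> p)"
        using func_rel_ext[OF \<gamma> u d(3) forces_refine[OF rq ref]] .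
    qed (use ts rq in auto)
  next
    fix c s r q
    assume h: "forces c A D (rel_comp C P A B D \<gamma> \<phi>) s r" "forces c A D (rel_comp C P A B D \<gamma> \<phi>) s q"
    obtain d p u where d: "cover d p c" "forces d A B \<phi> (s \<cdot> p) u" "forces d B D \<gamma> u (r \<cdot> p)"
      using h(1) by (elim elim)
    obtain d' p' u' where d': "cover d' p' d" "forces d' A B \<phi> (s \<cdot> p \<cdot> p') u'" "forces d' B D \<gamma> u' (q \<cdot> p \<cdot> p')"
      using forces_refine[OF h(2) cover_refines[OF d(1)]] by (elim elim)
    note ref = cover_refines[OF d'(1)]
    have u: "forces d' B B \<sigma> (u \<cdot> p') u'"
      using func_rel_single_valued[OF \<phi> forces_refine[OF d(2) ref] d'(2)] .
    have "forces d' B D \<gamma> u' (r \<cdot> p \<cdot> p')"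
      using func_rel_ext[OF \<gamma> per_sym[OF t(2) u] forces_refine[OF d(3) ref]]
        func_rel_strict(2)[OF \<gamma> forces_refine[OF d(3) ref]] by blast
    then have "forces d' D D \<tau> (r \<cdot> p \<cdot> p') (q \<cdot> p \<cdot> p')"
      using func_rel_single_valued[OF \<gamma> _ d'(3)] by blast
    then have "forces d D D \<tau> (r \<cdot> p) (q \<cdot> p)"
      by (rule forces_descend[OF _ d'(1)])
        (use h refines_typed[OF cover_refines[OF d(1)]] in \<open>auto dest!: forces_typing\<close>)
    then show "forces c D D \<tau> r q"
      by (rule forces_descend[OF _ d(1)]) (use h in auto)
  next
    fix c s assume s: "forces c A A \<rho> s s"
    obtain d p u where d: "cover d p c" "forces d A B \<phi> (s \<cdot> p) u"
      using func_rel_total[OF \<phi> s] by blast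
    obtain e q r where e: "cover e q d" "forces e B D \<gamma> (u \<cdot> q) r"
      using func_rel_total[OF \<gamma> func_rel_strict(2)[OF \<phi> d(2)]] by blast
    have "forces e A D (rel_comp C P A B D \<gamma> \<phi>) (s \<cdot> (p \<cdot> q)) r"
      using e(2) forces_refine[OF d(2) cover_refines[OF e(1)]] forces_typed[OF s] forces_typed[OF e(2)]
        refines_typed[OF cover_refines[OF d(1)]] refines_typed[OF cover_refines[OF e(1)]]
      by (intro rel_comp_intro[OF cover_refl, of e A B \<phi> _ "u \<cdot> q"]) simp_all
    then show "\<exists>d p u. cover d p c \<and> forces d A D (rel_comp C P A B D \<gamma> \<phi>) (s \<cdot> p) u"
      using cover_trans[OF e(1) d(1)] by blast
  }
qed

lemma rel_comp_ident_right:
  assumes \<phi>: "func_rel C P (A, \<rho>) \<phi> (B, \<sigma>)"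
  shows "rel_comp C P A A B \<phi> \<rho> = \<phi>"
proof (rule sym, rule func_rel_eqI[OF \<phi>])
  note t = func_rel_typed[OF \<phi>]
  show "func_rel C P (A, \<rho>) (rel_comp C P A A B \<phi> \<rho>) (B, \<sigma>)"
    using func_rel_comp[OF func_rel_ident[OF t(1)] \<phi>] .
  fix c s u assume h: "forces c A B \<phi> s u"
  show "forces c A B (rel_comp C P A A B \<phi> \<rho>) s u"
    using h func_rel_strict(1)[OF \<phi> h] forces_typed[OF h]
    by (intro rel_comp_intro[OF cover_refl, of c A A \<rho> _ s]) simp_all
qed

lemma rel_comp_ident_left:
  assumes \<phi>: "func_rel C P (A, \<rho>) \<phi> (B, \<sigma>)"
  shows "rel_comp C P A B B \<sigma> \<phi> = \<phi>"
proof (rule sym, rule func_rel_eqI[OF \<phi>])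
  note t = func_rel_typed[OF \<phi>]
  show "func_rel C P (A, \<rho>) (rel_comp C P A B B \<sigma> \<phi>) (B, \<sigma>)"
    using func_rel_comp[OF \<phi> func_rel_ident[OF t(2)]] .
  fix c s u assume h: "forces c A B \<phi> s u"
  show "forces c A B (rel_comp C P A B B \<sigma> \<phi>) s u"
    using h func_rel_strict(2)[OF \<phi> h] forces_typed[OF h]
    by (intro rel_comp_intro[OF cover_refl, of c A B \<phi> _ u]) simp_all
qed

lemma rel_comp_assoc:
  assumes \<phi>: "func_rel C P (A, \<rho>) \<phi> (B, \<sigma>)" and \<gamma>: "func_rel C P (B, \<sigma>) \<gamma> (D, \<tau>)"
    and \<delta>: "func_rel C P (D, \<tau>) \<delta> (E, \<upsilon>)"
  shows "rel_comp C P A D E \<delta> (rel_comp C P A B D \<gamma> \<phi>) = rel_comp C P A B E (rel_comp C P B D E \<delta> \<gamma>) \<phi>"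
    (is "?l = ?r")
proof (rule func_rel_eqI)
  show "func_rel C P (A, \<rho>) ?l (E, \<upsilon>)" "func_rel C P (A, \<rho>) ?r (E, \<upsilon>)"
    using \<phi> \<gamma> \<delta> by (auto intro: func_rel_comp)
  note t = func_rel_typed[OF \<phi>] func_rel_typed[OF \<gamma>] func_rel_typed[OF \<delta>]
  fix c s r assume h: "forces c A E ?l s r"
  obtain d p u where d: "cover d p c" "forces d A D (rel_comp C P A B D \<gamma> \<phi>) (s \<cdot> p) u" "forces d D E \<delta> u (r \<cdot> p)"
    using rel_comp_elim[OF h t(12) rel_comp_fib[OF t(4,5,12,3,10)] t(17)] by blast
  obtain e q v where e: "cover e q d" "forces e A B \<phi> (s \<cdot> p \<cdot> q) v" "forces e B D \<gamma> v (u \<cdot> q)"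
    using rel_comp_elim[OF d(2) t(5,3,10)] by blast
  have eq: "s \<cdot> p \<cdot> q = s \<cdot> (p \<cdot> q)" "r \<cdot> p \<cdot> q = r \<cdot> (p \<cdot> q)"
    using forces_typed[OF h] refines_typed[OF cover_refines[OF d(1)]] refines_typed[OF cover_refines[OF e(1)]]
    by simp_all
  have "forces e B E (rel_comp C P B D E \<delta> \<gamma>) v (r \<cdot> (p \<cdot> q))"
    using e(3) forces_refine[OF d(3) cover_refines[OF e(1)]] forces_typed[OF h] forces_typed[OF d(3)]
      forces_typed[OF e(3)] refines_typed[OF cover_refines[OF d(1)]] refines_typed[OF cover_refines[OF e(1)]]
    by (intro rel_comp_intro[OF cover_refl, of e B D \<gamma> _ "u \<cdot> q"]) simp_all
  then show "forces c A E ?r s r"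
    using e(2) eq h by (intro rel_comp_intro[OF cover_trans[OF e(1) d(1)], of A B \<phi> s v]) auto
qed

lemma RelCat_hom_iff:
  "F \<in> hom (RelCat C P) X Y \<longleftrightarrow> (\<exists>\<phi>. F = (X, \<phi>, Y) \<and> func_rel C P X \<phi> Y)"
  unfolding hom_def RelCat_def by auto

lemma RelCat_obj_iff [simp]: "(A, \<rho>) \<in> Obj (RelCat C P) \<longleftrightarrow> is_per C P A \<rho>"
  unfolding RelCat_def by simp

lemma RelCat_comp [simp]:
  "((B, \<sigma>), \<gamma>, (D, \<tau>)) \<cdot>\<^bsub>RelCat C P\<^esub> ((A, \<rho>), \<phi>, Y) = ((A, \<rho>), rel_comp C P A B D \<gamma> \<phi>, (D, \<tau>))"
  unfolding RelCat_def by simp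

lemma RelCat_ident [simp]: "Ident (RelCat C P) (A, \<rho>) = ((A, \<rho>), \<rho>, (A, \<rho>))"
  unfolding RelCat_def by simp

lemma RelCat_category: "category (RelCat C P)"
proof
  fix F assume F: "F \<in> Arr (RelCat C P)"
  then obtain A \<rho> f B \<sigma> where "F = ((A, \<rho>), f, (B, \<sigma>))" "func_rel C P (A, \<rho>) f (B, \<sigma>)"
    unfolding RelCat_def by auto
  then show "Dom (RelCat C P) F \<in> Obj (RelCat C P)" "Cod (RelCat C P) F \<in> Obj (RelCat C P)"
    using func_rel_typed unfolding RelCat_def by auto
next
  fix X assume "X \<in> Obj (RelCat C P)"
  then show "Ident (RelCat C P) X \<in> hom (RelCat C P) X X"
    by (cases X) (auto simp: RelCat_hom_iff func_rel_ident)
next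
  fix F X Y G Z assume F: "F \<in> hom (RelCat C P) X Y" "G \<in> hom (RelCat C P) Y Z"
  then show "G \<cdot>\<^bsub>RelCat C P\<^esub> F \<in> hom (RelCat C P) X Z"
    by (cases X; cases Y; cases Z) (auto simp: RelCat_hom_iff func_rel_comp)
  fix H W assume "H \<in> hom (RelCat C P) Z W"
  with F show "H \<cdot>\<^bsub>RelCat C P\<^esub> (G \<cdot>\<^bsub>RelCat C P\<^esub> F) = H \<cdot>\<^bsub>RelCat C P\<^esub> G \<cdot>\<^bsub>RelCat C P\<^esub> F"
    by (cases X; cases Y; cases Z; cases W) (auto simp: RelCat_hom_iff rel_comp_assoc)
next
  fix F X Y assume F: "F \<in> hom (RelCat C P) X Y"
  then show "F \<cdot>\<^bsub>RelCat C P\<^esub> Ident (RelCat C P) X = F" "Ident (RelCat C P) Y \<cdot>\<^bsub>RelCat C P\<^esub> F = F"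
    by (cases X; cases Y; auto simp: RelCat_hom_iff rel_comp_ident_left rel_comp_ident_right)+
qed

end

section \<open>The localization functor\<close>

definition iso_arr where
  "iso_arr C X Y f \<longleftrightarrow> f \<in> hom C X Y \<and>
     (\<exists>g\<in>hom C Y X. g \<cdot>\<^bsub>C\<^esub> f = Ident C X \<and> f \<cdot>\<^bsub>C\<^esub> g = Ident C Y)"

context indexed_frame
begin

definition graph_rel :: "'o \<times> 'p \<Rightarrow> 'a \<Rightarrow> 'o \<times> 'p \<Rightarrow> 'p" where
  "graph_rel X f Y = meet P (fst X \<otimes> fst Y)
     (app C P (snd X) (Pr1 C (fst X) (fst Y)) (Pr1 C (fst X) (fst Y)))
     (app C P (snd Y) (f \<cdot> Pr1 C (fst X) (fst Y)) (Pr2 C (fst X) (fst Y)))"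

lemma LocFun_arr [simp]: "FArr (LocFun C P) (X, f, Y) = (X, graph_rel X f Y, Y)"
  unfolding LocFun_def graph_rel_def Let_def by (cases X; cases Y) simp

lemma LocFun_obj [simp]: "FObj (LocFun C P) X = X"
  unfolding LocFun_def by simp

lemma graph_rel_fib:
  assumes "per_map C P (A, \<rho>) f (B, \<sigma>)"
  shows "graph_rel (A, \<rho>) f (B, \<sigma>) \<in> Fib P (A \<otimes> B)"
  using per_map_typed[OF assms] unfolding graph_rel_def by simp

lemma forces_graph_rel:
  assumes f: "per_map C P (A, \<rho>) f (B, \<sigma>)"
  shows "forces c A B (graph_rel (A, \<rho>) f (B, \<sigma>)) s u \<longleftrightarrow>
    forces c A A \<rho> s s \<and> forces c B B \<sigma> (f \<cdot> s) u"
proof (cases "s \<in> hom C (fst c) A \<and> u \<in> hom C (fst c) B")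
  case True
  then show ?thesis
    using per_map_typed[OF f] unfolding graph_rel_def forces_def[of c A B] by simp
next
  case False
  then show ?thesis by (auto dest: forces_typing)
qed

lemma func_rel_graph:
  assumes f: "per_map C P (A, \<rho>) f (B, \<sigma>)"
  shows "func_rel C P (A, \<rho>) (graph_rel (A, \<rho>) f (B, \<sigma>)) (B, \<sigma>)"
proof (rule func_relI)
  note t = per_map_typed[OF f]
  note gr = forces_graph_rel[OF f] and sym = per_sym[OF t(2)] and tr = per_trans[OF t(2)]
  show "is_per C P A \<rho>" "is_per C P B \<sigma>" by (rule t)+
  show "graph_rel (A, \<rho>) f (B, \<sigma>) \<in> Fib P (A \<otimes> B)" by (rule graph_rel_fib[OF f])
  show "forces c A A \<rho> s s \<and> forces c B B \<sigma> u u"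
    if "forces c A B (graph_rel (A, \<rho>) f (B, \<sigma>)) s u" for c s u
    using that sym tr unfolding gr by blast
  show "forces c A B (graph_rel (A, \<rho>) f (B, \<sigma>)) t v"
    if "forces c A A \<rho> t s" "forces c A B (graph_rel (A, \<rho>) f (B, \<sigma>)) s u" "forces c B B \<sigma> u v" for c s t u v
    using that per_map_forces[OF f that(1)] per_refl(1)[OF t(1) that(1)] tr unfolding gr by blast
  show "forces c B B \<sigma> u v"
    if "forces c A B (graph_rel (A, \<rho>) f (B, \<sigma>)) s u" "forces c A B (graph_rel (A, \<rho>) f (B, \<sigma>)) s v" for c s u v
    using that sym tr unfolding gr by blast
  fix c s assume s: "forces c A A \<rho> s s"
  have "forces c A B (graph_rel (A, \<rho>) f (B, \<sigma>)) (s \<cdot> Ident C (fst c)) (f \<cdot> s)"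
    unfolding gr using s per_map_forces[OF f s] forces_typed[OF s] by simp
  then show "\<exists>d p u. cover d p c \<and> forces d A B (graph_rel (A, \<rho>) f (B, \<sigma>)) (s \<cdot> p) u"
    using cover_refl[OF forces_typed(1)[OF s]] by blast
qed

lemma graph_rel_ident:
  assumes "is_per C P A \<rho>"
  shows "graph_rel (A, \<rho>) (Ident C A) (A, \<rho>) = \<rho>"
proof (rule sym, rule func_rel_eqI[OF func_rel_ident[OF assms] func_rel_graph[OF per_map_ident[OF assms]]])
  fix c s u assume su: "forces c A A \<rho> s u"
  then show "forces c A A (graph_rel (A, \<rho>) (Ident C A) (A, \<rho>)) s u"
    using per_refl(1)[OF assms su] forces_typed[OF su]
    unfolding forces_graph_rel[OF per_map_ident[OF assms]] by simp
qed

lemma graph_rel_comp: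
  assumes f: "per_map C P (A, \<rho>) f (B, \<sigma>)" and g: "per_map C P (B, \<sigma>) g (D, \<tau>)"
  shows "rel_comp C P A B D (graph_rel (B, \<sigma>) g (D, \<tau>)) (graph_rel (A, \<rho>) f (B, \<sigma>)) =
    graph_rel (A, \<rho>) (g \<cdot> f) (D, \<tau>)"
proof (rule sym, rule func_rel_eqI[OF func_rel_graph[OF per_map_comp[OF f g]]
    func_rel_comp[OF func_rel_graph[OF f] func_rel_graph[OF g]]])
  note t = per_map_typed[OF f] per_map_typed[OF g]
  fix c s r assume "forces c A D (graph_rel (A, \<rho>) (g \<cdot> f) (D, \<tau>)) s r"
  then have s: "forces c A A \<rho> s s" and r: "forces c D D \<tau> (g \<cdot> f \<cdot> s) r"
    unfolding forces_graph_rel[OF per_map_comp[OF f g]] by auto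
  show "forces c A D (rel_comp C P A B D (graph_rel (B, \<sigma>) g (D, \<tau>)) (graph_rel (A, \<rho>) f (B, \<sigma>))) s r"
  proof (rule rel_comp_intro[OF cover_refl])
    show "forces c A B (graph_rel (A, \<rho>) f (B, \<sigma>)) (s \<cdot> Ident C (fst c)) (f \<cdot> s)"
      using s per_map_forces[OF f s] forces_typed[OF s] unfolding forces_graph_rel[OF f] by simp
    show "forces c B D (graph_rel (B, \<sigma>) g (D, \<tau>)) (f \<cdot> s) (r \<cdot> Ident C (fst c))"
      using r per_map_forces[OF f s] forces_typed[OF s] forces_typed[OF r] t unfolding forces_graph_rel[OF g] by simp
  qed (use s r in auto)
qed

lemma LocFun_functor: "is_functor (PerCat C P) (RelCat C P) (LocFun C P)"
proof (intro is_functor.intro is_functor_axioms.intro PerCat_category RelCat_category)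
  fix X assume "X \<in> Obj (PerCat C P)"
  then show "FObj (LocFun C P) X \<in> Obj (RelCat C P)"
    "FArr (LocFun C P) (Ident (PerCat C P) X) = Ident (RelCat C P) (FObj (LocFun C P) X)"
    by (cases X; simp add: graph_rel_ident)+
next
  fix F X Y assume F: "F \<in> hom (PerCat C P) X Y"
  then show "FArr (LocFun C P) F \<in> hom (RelCat C P) (FObj (LocFun C P) X) (FObj (LocFun C P) Y)"
    by (cases X; cases Y) (auto simp: PerCat_hom_iff RelCat_hom_iff func_rel_graph)
  fix G Z assume "G \<in> hom (PerCat C P) Y Z"
  with F show "FArr (LocFun C P) (G \<cdot>\<^bsub>PerCat C P\<^esub> F) =
      FArr (LocFun C P) G \<cdot>\<^bsub>RelCat C P\<^esub> FArr (LocFun C P) F"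
    by (cases X; cases Y; cases Z) (auto simp: PerCat_hom_iff graph_rel_comp)
qed

text \<open>One direction evaluates both graphs at the generic \<open>x\<close> subject to \<open>\<rho>(x, x)\<close>, with \<open>fx\<close> as the
  value.\<close>

lemma graph_rel_eq_iff:
  assumes f: "per_map C P (A, \<rho>) f (B, \<sigma>)" and g: "per_map C P (A, \<rho>) g (B, \<sigma>)"
  shows "graph_rel (A, \<rho>) f (B, \<sigma>) = graph_rel (A, \<rho>) g (B, \<sigma>) \<longleftrightarrow>
    Le P A (app C P \<rho> (Ident C A) (Ident C A)) (app C P \<sigma> f g)"
proof
  note t = per_map_typed[OF f] per_map_typed[OF g]
  let ?i = "Ident C A"
  let ?c = "(A, app C P \<rho> ?i ?i)"
  assume eq: "graph_rel (A, \<rho>) f (B, \<sigma>) = graph_rel (A, \<rho>) g (B, \<sigma>)"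
  have "forces1 ?c A (app C P \<rho> ?i ?i) ?i" using t by (intro forces1_generic) auto
  then have i: "forces ?c A A \<rho> ?i ?i" using t by auto
  have "forces ?c A B (graph_rel (A, \<rho>) f (B, \<sigma>)) ?i (f \<cdot> ?i)"
    using i per_map_forces[OF f i] unfolding forces_graph_rel[OF f] by simp
  then have "forces ?c B B \<sigma> (f \<cdot> ?i) (g \<cdot> ?i)"
    unfolding eq unfolding forces_graph_rel[OF g] using per_sym[OF t(2)] by blast
  then have "forces1 ?c A (app C P \<sigma> f g) ?i" using t by simp
  then show "Le P A (app C P \<rho> ?i ?i) (app C P \<sigma> f g)"
    using t by (intro le_by_forces1) auto
next
  note t = per_map_typed[OF f] per_map_typed[OF g]
  let ?i = "Ident C A"
  assume le: "Le P A (app C P \<rho> ?i ?i) (app C P \<sigma> f g)"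
  show "graph_rel (A, \<rho>) f (B, \<sigma>) = graph_rel (A, \<rho>) g (B, \<sigma>)"
  proof (rule func_rel_eqI[OF func_rel_graph[OF f] func_rel_graph[OF g]])
    fix c s u assume "forces c A B (graph_rel (A, \<rho>) f (B, \<sigma>)) s u"
    then have s: "forces c A A \<rho> s s" and u: "forces c B B \<sigma> (f \<cdot> s) u"
      unfolding forces_graph_rel[OF f] by auto
    have "forces1 c A (app C P \<rho> ?i ?i) s" using s t forces_typed[OF s] by simp
    then have "forces1 c A (app C P \<sigma> f g) s" by (rule forces1_le) (use t le in auto)
    then have "forces c B B \<sigma> (f \<cdot> s) (g \<cdot> s)" using t by auto
    then show "forces c A B (graph_rel (A, \<rho>) g (B, \<sigma>)) s u"
      unfolding forces_graph_rel[OF g] using s u per_sym[OF t(2)] per_trans[OF t(2)] by blast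
  qed
qed

text \<open>The converse of a predicate on \<open>A \<otimes> B\<close> is its substitution along the symmetry.\<close>

lemma forces_converse:
  assumes "A \<in> Obj C" "B \<in> Obj C" "\<phi> \<in> Fib P (A \<otimes> B)"
  shows "forces c B A (app C P \<phi> (Pr2 C B A) (Pr1 C B A)) u s \<longleftrightarrow> forces c A B \<phi> s u"
proof (cases "s \<in> hom C (fst c) A \<and> u \<in> hom C (fst c) B")
  case True
  then show ?thesis using assms unfolding forces_def[of c B A] by simp
next
  case False
  then show ?thesis by (auto dest: forces_typing)
qed

text \<open>Single-valuedness of \<open>\<psi>\<close> puts the composite inside the identity.\<close>

lemma rel_comp_converse:
  assumes \<phi>: "func_rel C P (A, \<rho>) \<phi> (B, \<sigma>)" and \<psi>: "func_rel C P (B, \<sigma>) \<psi> (A, \<rho>)"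
    and conv: "\<And>c s u. forces c A B \<phi> s u \<longleftrightarrow> forces c B A \<psi> u s"
  shows "rel_comp C P A B A \<psi> \<phi> = \<rho>"
proof (rule func_rel_eqI[OF func_rel_comp[OF \<phi> \<psi>] func_rel_ident])
  note t = func_rel_typed[OF \<phi>] func_rel_typed[OF \<psi>]
  show "is_per C P A \<rho>" by (rule t)
  fix c s r assume h: "forces c A A (rel_comp C P A B A \<psi> \<phi>) s r"
  then obtain d p u where d: "cover d p c" "forces d A B \<phi> (s \<cdot> p) u" "forces d B A \<psi> u (r \<cdot> p)"
    using rel_comp_elim[OF h t(5,3,10)] by blast
  have "forces d A A \<rho> (s \<cdot> p) (r \<cdot> p)"
    using func_rel_single_valued[OF \<psi> _ d(3)] d(2) unfolding conv by blast
  then show "forces c A A \<rho> s r" by (rule forces_descend[OF _ d(1)]) (use h in auto)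
qed

text \<open>The two conditions on a weak equivalence are single-valuedness and totality of the converse of
  its graph, which is therefore an inverse in the category of functional relations.\<close>

lemma LocFun_weak_equivalence:
  assumes f: "per_map C P (A, \<rho>) f (B, \<sigma>)"
    and inj: "\<And>c s t. forces c A A \<rho> s s \<Longrightarrow> forces c A A \<rho> t t \<Longrightarrow> forces c B B \<sigma> (f \<cdot> s) (f \<cdot> t) \<Longrightarrow>
      forces c A A \<rho> s t"
    and surj: "\<And>c u. forces c B B \<sigma> u u \<Longrightarrow>
      \<exists>d p s. cover d p c \<and> forces d A A \<rho> s s \<and> forces d B B \<sigma> (f \<cdot> s) (u \<cdot> p)"
  shows "iso_arr (RelCat C P) (A, \<rho>) (B, \<sigma>) (FArr (LocFun C P) ((A, \<rho>), f, (B, \<sigma>)))"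
proof -
  note t = per_map_typed[OF f]
  let ?\<phi> = "graph_rel (A, \<rho>) f (B, \<sigma>)"
  let ?\<psi> = "app C P ?\<phi> (Pr2 C B A) (Pr1 C B A)"
  note \<phi> = func_rel_graph[OF f] and \<phi>_fib = graph_rel_fib[OF f]
  have conv: "forces c B A ?\<psi> u s \<longleftrightarrow> forces c A B ?\<phi> s u" for c u s
    using forces_converse t \<phi>_fib by blast
  have \<psi>: "func_rel C P (B, \<sigma>) ?\<psi> (A, \<rho>)"
  proof (rule func_relI)
    show "?\<psi> \<in> Fib P (B \<otimes> A)" using t \<phi>_fib by simp
    show "forces c B B \<sigma> s s \<and> forces c A A \<rho> u u" if "forces c B A ?\<psi> s u" for c s u
      using that func_rel_strict[OF \<phi>] unfolding conv by blast
    show "forces c B A ?\<psi> u v"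
      if "forces c B B \<sigma> u s" "forces c B A ?\<psi> s r" "forces c A A \<rho> r v" for c s u r v
      using that func_rel_ext[OF \<phi>] per_sym[OF t(1)] per_sym[OF t(2)] unfolding conv by blast
    show "forces c A A \<rho> u v" if "forces c B A ?\<psi> s u" "forces c B A ?\<psi> s v" for c s u v
      using that inj per_sym[OF t(2)] per_trans[OF t(2)] unfolding conv forces_graph_rel[OF f] by blast
    show "\<exists>d p s. cover d p c \<and> forces d B A ?\<psi> (u \<cdot> p) s" if "forces c B B \<sigma> u u" for c u
      using surj[OF that] unfolding conv forces_graph_rel[OF f] by blast
  qed (rule t)+
  have "rel_comp C P A B A ?\<psi> ?\<phi> = \<rho>" "rel_comp C P B A B ?\<phi> ?\<psi> = \<sigma>"
    using rel_comp_converse[OF \<phi> \<psi>] rel_comp_converse[OF \<psi> \<phi>] conv by blast+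
  then show ?thesis
    unfolding iso_arr_def using \<phi> \<psi>
    by (auto simp: RelCat_hom_iff intro!: bexI[of _ "((B, \<sigma>), ?\<psi>, (A, \<rho>))"])
qed

end

section \<open>Replacements\<close>

context indexed_frame
begin

lemma forces1_pull [simp]:
  assumes "g \<in> Arr C" "Dom C g = I" "Cod C g = K" "\<phi> \<in> Fib P K"
  shows "forces1 c I (Pull P g \<phi>) h \<longleftrightarrow> h \<in> hom C (fst c) I \<and> forces1 c K \<phi> (g \<cdot> h)"
  using assms pull_comp[of h "fst c" I g K \<phi>] unfolding forces1_def by auto

text \<open>The cofibrant replacement of \<open>(A, \<rho>)\<close> presents the support \<open>\<rho>(x, x)\<close> as \<open>\<exists>\<^sub>f \<pi>\<close> with \<open>\<pi>\<close>
  \<open>\<exists>\<close>-prime and restricts \<open>\<rho>\<close> along \<open>f\<close> to \<open>\<pi>\<close>. Its support is \<open>\<pi>\<close>, so totality of a functional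
  relation out of it is witnessed by a section, which is the graph of a map.\<close>

lemma ex_prime_replacement:
  assumes enough: "enough_ex_primes C P" and \<rho>: "is_per C P A \<rho>"
  shows "\<exists>Z F. F \<in> hom (PerCat C P) Z (A, \<rho>) \<and>
    iso_arr (RelCat C P) Z (A, \<rho>) (FArr (LocFun C P) F) \<and>
    (\<forall>Y. \<forall>h\<in>hom (RelCat C P) (A, \<rho>) Y. \<exists>G\<in>hom (PerCat C P) Z Y.
       FArr (LocFun C P) G = h \<cdot>\<^bsub>RelCat C P\<^esub> FArr (LocFun C P) F)"
proof -
  have A: "A \<in> Obj C" "\<rho> \<in> Fib P (A \<otimes> A)" using per_typed[OF \<rho>] by auto
  let ?r = "app C P \<rho> (Ident C A) (Ident C A)"
  have r_fib: "?r \<in> Fib P A" using A by simp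
  obtain J \<pi> f where J: "J \<in> Obj C" and prime: "ex_prime C P J \<pi>" and f0: "f \<in> hom C J A"
    and r: "?r = Ex_along C P f \<pi>"
    using enough A r_fib unfolding enough_ex_primes_def by blast
  have f: "f \<in> Arr C" "Dom C f = J" "Cod C f = A" using f0 by auto
  have \<pi>: "\<pi> \<in> Fib P J" using prime unfolding ex_prime_def by simp
  define \<tau> where "\<tau> = meet P (J \<otimes> J) (meet P (J \<otimes> J) (Pull P (Pr1 C J J) \<pi>) (Pull P (Pr2 C J J) \<pi>))
    (app C P \<rho> (f \<cdot> Pr1 C J J) (f \<cdot> Pr2 C J J))"
  have \<tau>_fib: "\<tau> \<in> Fib P (J \<otimes> J)" using J f \<pi> A by (simp add: \<tau>_def)
  have \<tau>: "forces c J J \<tau> s t \<longleftrightarrow> forces1 c J \<pi> s \<and> forces1 c J \<pi> t \<and> forces c A A \<rho> (f \<cdot> s) (f \<cdot> t)" for c s t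
  proof (cases "s \<in> hom C (fst c) J \<and> t \<in> hom C (fst c) J")
    case True
    then show ?thesis unfolding \<tau>_def forces_def[of c J J] using J f \<pi> A by simp
  qed (auto simp: forces_def forces1_def)
  have supp: "forces c J J \<tau> s s" if s: "forces1 c J \<pi> s" for c s
  proof -
    have "forces1 c A ?r (f \<cdot> s)" unfolding r using s f by (intro forces1_ex_intro[OF s]) auto
    then have "forces c A A \<rho> (f \<cdot> s) (f \<cdot> s)"
      using A f s by (auto simp: forces1_def[of c J])
    then show ?thesis using s \<tau> by blast
  qed
  have \<tau>_per: "is_per C P J \<tau>"
    unfolding is_per_iff \<tau> using J \<tau>_fib per_sym[OF \<rho>] per_trans[OF \<rho>] by blast
  have f_map: "per_map C P (J, \<tau>) f (A, \<rho>)"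
    by (rule per_mapI[OF \<tau>_per \<rho> f0]) (simp add: \<tau>)
  have iso: "iso_arr (RelCat C P) (J, \<tau>) (A, \<rho>) (FArr (LocFun C P) ((J, \<tau>), f, (A, \<rho>)))"
  proof (rule LocFun_weak_equivalence[OF f_map])
    show "forces c J J \<tau> s t" if "forces c J J \<tau> s s" "forces c J J \<tau> t t" "forces c A A \<rho> (f \<cdot> s) (f \<cdot> t)" for c s t
      using that unfolding \<tau> by blast
  next
    fix c u assume u: "forces c A A \<rho> u u"
    (* The predicate \<xi> on u reads \<exists>j. \<pi>(j) \<and> \<rho>(fj, u). As the support of \<rho> is \<exists>_f \<pi>, only the case
       u = fj has to be checked, where j itself is a witness. *)
    let ?\<psi> = "meet P (A \<otimes> J) (Pull P (Pr2 C A J) \<pi>) (app C P \<rho> (f \<cdot> Pr2 C A J) (Pr1 C A J))"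
    let ?\<xi> = "Ex_along C P (Pr1 C A J) ?\<psi>"
    have \<psi>: "?\<psi> \<in> Fib P (A \<otimes> J)" using J f \<pi> A by simp
    then have \<xi>: "?\<xi> \<in> Fib P A" using J A by simp
    have "Le P J \<pi> (Pull P f ?\<xi>)"
    proof (rule judgmentI)
      fix c s assume s: "forces1 c J \<pi> s"
      then have st: "s \<in> Arr C" "Dom C s = fst c" "Cod C s = J" by (auto simp: forces1_def)
      have "forces c A A \<rho> (f \<cdot> s) (f \<cdot> s)" using supp[OF s] \<tau> by blast
      then have "forces1 c (A \<otimes> J) ?\<psi> \<langle>f \<cdot> s, s\<rangle>" using s J f \<pi> A st by simp
      then have "forces1 c A ?\<xi> (f \<cdot> s)"
        by (rule forces1_ex_intro) (use J A f st in auto)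
      then show "forces1 c J (Pull P f ?\<xi>) s" using f \<xi> st by simp
    qed (use J f \<pi> \<xi> in auto)
    then have "Le P A ?r ?\<xi>"
      unfolding r using ex_le_iff[of f \<pi> J ?\<xi> A] f \<pi> \<xi> by simp
    moreover have "forces1 c A ?r u" using u A forces_typed[OF u] by simp
    ultimately have "forces1 c A ?\<xi> u" using \<xi> forces1_le by blast
    then obtain d p b where d: "cover d p c" "b \<in> hom C (fst d) J" "forces1 d (A \<otimes> J) ?\<psi> \<langle>u \<cdot> p, b\<rangle>"
      using forces1_ex_elim[OF _ \<psi> J] by blast
    have "forces1 d J \<pi> b \<and> forces d A A \<rho> (f \<cdot> b) (u \<cdot> p)"
      using d J f \<pi> A forces_typed[OF u] refines_typed[OF cover_refines[OF d(1)]] by simp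
    then show "\<exists>d p s. cover d p c \<and> forces d J J \<tau> s s \<and> forces d A A \<rho> (f \<cdot> s) (u \<cdot> p)"
      using d(1) supp by blast
  qed
  (* Totality says that the predicate \<pi> is below \<exists>u. \<phi>(x, u). Primeness gives a section of the
     projection to x, and its second component g satisfies \<phi>(x, gx) on \<pi>. *)
  have lift: "\<exists>g. per_map C P (J, \<tau>) g (B, \<sigma>) \<and> graph_rel (J, \<tau>) g (B, \<sigma>) = \<phi>"
    if \<phi>: "func_rel C P (J, \<tau>) \<phi> (B, \<sigma>)" for B \<sigma> \<phi>
  proof -
    note t = func_rel_typed[OF \<phi>]
    have "Le P J (Pull P (Ident C J) \<pi>) (Ex_along C P (Pr1 C J B) \<phi>)"
    proof (rule judgmentI)
      fix c s assume "forces1 c J (Pull P (Ident C J) \<pi>) s"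
      then have s: "forces1 c J \<pi> s" using pull_ident J \<pi> by simp
      obtain d p u where d: "cover d p c" "forces d J B \<phi> (s \<cdot> p) u"
        using func_rel_total[OF \<phi> supp[OF s]] by blast
      show "forces1 c J (Ex_along C P (Pr1 C J B) \<phi>) s"
      proof (rule forces1_ex_cover_intro[OF d(1)])
        show "forces1 d (J \<otimes> B) \<phi> \<langle>s \<cdot> p, u\<rangle>" using d(2) unfolding forces_def by blast
        show "s \<in> hom C (fst c) J" using s unfolding forces1_def by blast
        show "u \<in> hom C (fst d) B" using d(2) by blast
      qed (rule t)
    qed (use J \<pi> t in auto)
    moreover have "Ident C J \<in> hom C J J" "Pr1 C J B \<in> hom C (J \<otimes> B) J" using J t by auto
    ultimately obtain k where k: "k \<in> hom C J (J \<otimes> B)" "Pr1 C J B \<cdot> k = Ident C J"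
        "Le P J (Pull P (Ident C J) \<pi>) (Pull P k \<phi>)"
      using prime t(3) unfolding ex_prime_def by blast
    define g where "g = Pr2 C J B \<cdot> k"
    have g: "g \<in> hom C J B" using k J t by (simp add: g_def)
    have k_eq: "k = \<langle>Ident C J, g\<rangle>" unfolding g_def using tuple_pr_comp[of J B k] k J t by simp
    have \<phi>g: "forces c J B \<phi> s (g \<cdot> s)" if s: "forces1 c J \<pi> s" for c s
    proof -
      have st: "s \<in> hom C (fst c) J" using s unfolding forces1_def by blast
      have "forces1 c J (Pull P k \<phi>) s"
        by (rule forces1_le[OF s]) (use k J \<pi> t pull_ident in auto)
      then have "forces1 c (J \<otimes> B) \<phi> (k \<cdot> s)" using k t by simp
      then show ?thesis using st g J unfolding forces_def k_eq by simp
    qed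
    have g_map: "per_map C P (J, \<tau>) g (B, \<sigma>)"
    proof (rule per_mapI[OF \<tau>_per t(2) g])
      fix c s t' assume st: "forces c J J \<tau> s t'"
      then have "forces c J B \<phi> s (g \<cdot> s)" "forces c J B \<phi> t' (g \<cdot> t')" using \<tau> \<phi>g by blast+
      then show "forces c B B \<sigma> (g \<cdot> s) (g \<cdot> t')"
        using func_rel_ext[OF \<phi> st] func_rel_strict(2)[OF \<phi>] func_rel_single_valued[OF \<phi>] by blast
    qed
    have "graph_rel (J, \<tau>) g (B, \<sigma>) = \<phi>"
    proof (rule func_rel_eqI[OF func_rel_graph[OF g_map] \<phi>])
      fix c s u assume "forces c J B (graph_rel (J, \<tau>) g (B, \<sigma>)) s u"
      then have s: "forces c J J \<tau> s s" "forces c B B \<sigma> (g \<cdot> s) u" unfolding forces_graph_rel[OF g_map] by auto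
      then have "forces c J B \<phi> s (g \<cdot> s)" using \<tau> \<phi>g by blast
      then show "forces c J B \<phi> s u" using func_rel_ext[OF \<phi> s(1) _ s(2)] by blast
    qed
    with g_map show ?thesis by blast
  qed
  have "\<exists>G\<in>hom (PerCat C P) (J, \<tau>) Y.
       FArr (LocFun C P) G = h \<cdot>\<^bsub>RelCat C P\<^esub> FArr (LocFun C P) ((J, \<tau>), f, (A, \<rho>))"
    if h: "h \<in> hom (RelCat C P) (A, \<rho>) Y" for Y h
  proof -
    obtain B \<sigma> \<phi> where Y: "Y = (B, \<sigma>)" and h_eq: "h = ((A, \<rho>), \<phi>, (B, \<sigma>))"
      and \<phi>: "func_rel C P (A, \<rho>) \<phi> (B, \<sigma>)"
      using h by (cases Y) (auto simp: RelCat_hom_iff)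
    obtain g where "per_map C P (J, \<tau>) g (B, \<sigma>)"
        "graph_rel (J, \<tau>) g (B, \<sigma>) = rel_comp C P J A B \<phi> (graph_rel (J, \<tau>) f (A, \<rho>))"
      using lift[OF func_rel_comp[OF func_rel_graph[OF f_map] \<phi>]] by blast
    then show ?thesis
      by (intro bexI[of _ "((J, \<tau>), g, (B, \<sigma>))"]) (auto simp: Y h_eq PerCat_hom_iff)
  qed
  moreover have "((J, \<tau>), f, (A, \<rho>)) \<in> hom (PerCat C P) (J, \<tau>) (A, \<rho>)"
    using f_map by (simp add: PerCat_hom_iff)
  ultimately show ?thesis using iso by blast
qed

end

context tripos
begin

text \<open>Universal quantification and implication combine to a predicate with the expected
  Kripke-Joyal clause.\<close>

lemma forall_imp_predicate:
  assumes o: "I \<in> Obj C" "A \<in> Obj C" and a: "a \<in> Fib P (I \<otimes> A)" and b: "b \<in> Fib P (I \<otimes> A)"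
  obtains d where "d \<in> Fib P I" and "\<And>c f. forces1 c I d f \<longleftrightarrow> stage c \<and> f \<in> hom C (fst c) I \<and>
    (\<forall>c' p t. refines c' p c \<and> t \<in> hom C (fst c') A \<and> forces1 c' (I \<otimes> A) a \<langle>f \<cdot> p, t\<rangle> \<longrightarrow>
      forces1 c' (I \<otimes> A) b \<langle>f \<cdot> p, t\<rangle>)"
proof -
  obtain i where i: "i \<in> Fib P (I \<otimes> A)"
      "\<forall>\<chi>\<in>Fib P (I \<otimes> A). Le P (I \<otimes> A) \<chi> i \<longleftrightarrow> Le P (I \<otimes> A) (meet P (I \<otimes> A) \<chi> a) b"
    using ex_imp[of "I \<otimes> A" a b] o a b by auto
  have pr: "Pr1 C I A \<in> Arr C" "Dom C (Pr1 C I A) = I \<otimes> A" "Cod C (Pr1 C I A) = I" using o by auto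
  obtain R where "is_right_adjoint C P (Pr1 C I A) R" using All pr by blast
  then obtain d where d: "d \<in> Fib P I"
      "\<forall>\<psi>\<in>Fib P I. Le P I \<psi> d \<longleftrightarrow> Le P (I \<otimes> A) (Pull P (Pr1 C I A) \<psi>) i"
    using i(1) pr unfolding is_right_adjoint_def by fastforce
  have di: "Le P (I \<otimes> A) (Pull P (Pr1 C I A) d) i" using d le_refl o by blast
  have ib: "Le P (I \<otimes> A) (meet P (I \<otimes> A) i a) b" using i le_refl[of "I \<otimes> A" i] o by simp
  have "forces1 c I d f \<longleftrightarrow> stage c \<and> f \<in> hom C (fst c) I \<and>
    (\<forall>c' p t. refines c' p c \<and> t \<in> hom C (fst c') A \<and> forces1 c' (I \<otimes> A) a \<langle>f \<cdot> p, t\<rangle> \<longrightarrow>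
      forces1 c' (I \<otimes> A) b \<langle>f \<cdot> p, t\<rangle>)" for c f
  proof (intro iffI conjI allI impI)
    assume h: "forces1 c I d f"
    then show "stage c" "f \<in> hom C (fst c) I" unfolding forces1_def by blast+
    fix c' p t
    assume h': "refines c' p c \<and> t \<in> hom C (fst c') A \<and> forces1 c' (I \<otimes> A) a \<langle>f \<cdot> p, t\<rangle>"
    then have ty: "p \<in> Arr C" "Dom C p = fst c'" "Cod C p = fst c" "t \<in> Arr C" "Dom C t = fst c'" "Cod C t = A"
        "f \<in> Arr C" "Dom C f = fst c" "Cod C f = I"
      using refines_typed[of c' p c] h unfolding forces1_def by auto
    have "forces1 c' I d (f \<cdot> p)" using forces1_refine[OF h] h' by blast
    then have "forces1 c' (I \<otimes> A) (Pull P (Pr1 C I A) d) \<langle>f \<cdot> p, t\<rangle>" using ty o d by simp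
    then have "forces1 c' (I \<otimes> A) i \<langle>f \<cdot> p, t\<rangle>" using forces1_le i(1) di by blast
    then have "forces1 c' (I \<otimes> A) (meet P (I \<otimes> A) i a) \<langle>f \<cdot> p, t\<rangle>" using h' i(1) a by simp
    then show "forces1 c' (I \<otimes> A) b \<langle>f \<cdot> p, t\<rangle>" using forces1_le ib b by blast
  next
    assume h: "stage c \<and> f \<in> hom C (fst c) I \<and>
      (\<forall>c' p t. refines c' p c \<and> t \<in> hom C (fst c') A \<and> forces1 c' (I \<otimes> A) a \<langle>f \<cdot> p, t\<rangle> \<longrightarrow>
        forces1 c' (I \<otimes> A) b \<langle>f \<cdot> p, t\<rangle>)"
    (* It suffices to apply the hypothesis h to the generic y subject to a(x, y). The result
       transposes to \<exists>_k (\<pi>^* \<chi>) \<le> i, and Beck-Chevalley identifies the left side with a predicate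
       pulled back from I, so that it transposes further to the universal quantifier. *)
    define X where "X = fst c"
    define \<chi> where "\<chi> = snd c"
    have ty: "X \<in> Obj C" "\<chi> \<in> Fib P X" "f \<in> Arr C" "Dom C f = X" "Cod C f = I"
      using h by (auto simp: stage_def X_def \<chi>_def)
    define \<pi> where "\<pi> = Pr1 C X A"
    define k where "k = \<langle>f \<cdot> \<pi>, Pr2 C X A\<rangle>"
    have \<pi>: "\<pi> \<in> Arr C" "Dom C \<pi> = X \<otimes> A" "Cod C \<pi> = X" using ty o by (auto simp: \<pi>_def)
    have k: "k \<in> Arr C" "Dom C k = X \<otimes> A" "Cod C k = I \<otimes> A" using ty \<pi> o by (auto simp: k_def)
    have XA: "X \<otimes> A \<in> Obj C" using ty o by simp
    let ?m = "meet P (X \<otimes> A) (Pull P \<pi> \<chi>) (Pull P k a)"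
    have fib: "Pull P \<pi> \<chi> \<in> Fib P (X \<otimes> A)" "Pull P k a \<in> Fib P (X \<otimes> A)" "Pull P k b \<in> Fib P (X \<otimes> A)"
      using ty \<pi> k a b by auto
    have m: "?m \<in> Fib P (X \<otimes> A)" using fib XA by simp
    let ?c = "(X \<otimes> A, ?m)"
    have le: "Le P (X \<otimes> A) ?m (Pull P \<pi> \<chi>)" "Le P (X \<otimes> A) ?m (Pull P k a)"
      using le_meet_iff[OF XA fib(1,2) m] le_refl[OF XA m] by auto
    have "refines ?c \<pi> c"
      unfolding refines_def stage_def using ty \<pi> le XA m by (auto simp: X_def \<chi>_def)
    moreover have "Pr2 C X A \<in> hom C (fst ?c) A" using ty o by simp
    moreover have "forces1 ?c (I \<otimes> A) a \<langle>f \<cdot> \<pi>, Pr2 C X A\<rangle>"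
      unfolding k_def[symmetric] forces1_def stage_def using k a XA m le by simp
    ultimately have "forces1 ?c (I \<otimes> A) b k" using h unfolding k_def by blast
    then have "Le P (X \<otimes> A) ?m (Pull P k b)" unfolding forces1_def by simp
    then have "Le P (I \<otimes> A) (Ex_along C P k ?m) b"
      using ex_le_iff[of k ?m "X \<otimes> A" b "I \<otimes> A"] k m b by simp
    moreover have "Ex_along C P k ?m = meet P (I \<otimes> A) (Ex_along C P k (Pull P \<pi> \<chi>)) a"
      using Fr[of k "X \<otimes> A" "I \<otimes> A" "Pull P \<pi> \<chi>" a] k fib a by simp
    moreover have ek: "Ex_along C P k (Pull P \<pi> \<chi>) \<in> Fib P (I \<otimes> A)" using k fib by simp
    ultimately have "Le P (I \<otimes> A) (Ex_along C P k (Pull P \<pi> \<chi>)) i" using i(2) by simp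
    moreover have "Ex_along C P k (Pull P \<pi> \<chi>) = Pull P (Pr1 C I A) (Ex_along C P f \<chi>)"
      using BC[OF is_pullback_swap[OF pullback_context_extension[of f X I A]], of \<chi>] ty o
      by (simp add: k_def \<pi>_def)
    ultimately have "Le P I (Ex_along C P f \<chi>) d" using d(2) ty by simp
    then have "Le P X \<chi> (Pull P f d)" using ex_le_iff[of f \<chi> X d I] ty d(1) by simp
    then show "forces1 c I d f" using h d(1) unfolding forces1_def X_def \<chi>_def by blast
  qed
  with d(1) show ?thesis using that by blast
qed

text \<open>With \<open>\<epsilon>\<close> as membership, \<open>\<theta>(x, U)\<close> says that \<open>U\<close> is the \<open>\<rho>\<close>-class of \<open>x\<close>.\<close>

lemma singleton_predicate:
  assumes A: "A \<in> Obj C" and \<rho>: "\<rho> \<in> Fib P (A \<otimes> A)" and PA: "PA \<in> Obj C" and \<epsilon>: "\<epsilon> \<in> Fib P (A \<otimes> PA)"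
  obtains \<theta> where "\<theta> \<in> Fib P (A \<otimes> PA)"
    and "\<And>c s U. forces c A PA \<theta> s U \<longleftrightarrow> forces c A A \<rho> s s \<and> U \<in> hom C (fst c) PA \<and>
      (\<forall>d p t. refines d p c \<and> t \<in> hom C (fst d) A \<longrightarrow>
        (forces d A PA \<epsilon> t (U \<cdot> p) \<longleftrightarrow> forces d A A \<rho> (s \<cdot> p) t))"
proof -
  let ?I = "A \<otimes> PA"
  let ?x = "Pr1 C A PA \<cdot> Pr1 C ?I A" and ?U = "Pr2 C A PA \<cdot> Pr1 C ?I A" and ?y = "Pr2 C ?I A"
  let ?a = "app C P \<epsilon> ?y ?U" and ?b = "app C P \<rho> ?x ?y"
  have I: "?I \<in> Obj C" using A PA by simp
  have ab: "?a \<in> Fib P (?I \<otimes> A)" "?b \<in> Fib P (?I \<otimes> A)" using A PA \<rho> \<epsilon> by auto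
  obtain d1 where d1: "d1 \<in> Fib P ?I" "\<And>c f. forces1 c ?I d1 f \<longleftrightarrow> stage c \<and> f \<in> hom C (fst c) ?I \<and>
    (\<forall>c' p t. refines c' p c \<and> t \<in> hom C (fst c') A \<and> forces1 c' (?I \<otimes> A) ?a \<langle>f \<cdot> p, t\<rangle> \<longrightarrow>
      forces1 c' (?I \<otimes> A) ?b \<langle>f \<cdot> p, t\<rangle>)"
    using forall_imp_predicate[OF I A ab] by blast
  obtain d2 where d2: "d2 \<in> Fib P ?I" "\<And>c f. forces1 c ?I d2 f \<longleftrightarrow> stage c \<and> f \<in> hom C (fst c) ?I \<and>
    (\<forall>c' p t. refines c' p c \<and> t \<in> hom C (fst c') A \<and> forces1 c' (?I \<otimes> A) ?b \<langle>f \<cdot> p, t\<rangle> \<longrightarrow>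
      forces1 c' (?I \<otimes> A) ?a \<langle>f \<cdot> p, t\<rangle>)"
    using forall_imp_predicate[OF I A ab(2,1)] by blast
  define \<theta> where "\<theta> = meet P ?I (meet P ?I d1 d2) (app C P \<rho> (Pr1 C A PA) (Pr1 C A PA))"
  have \<theta>_fib: "\<theta> \<in> Fib P ?I" using A PA \<rho> d1(1) d2(1) I by (simp add: \<theta>_def)
  have "forces c A PA \<theta> s U \<longleftrightarrow> forces c A A \<rho> s s \<and> U \<in> hom C (fst c) PA \<and>
      (\<forall>d p t. refines d p c \<and> t \<in> hom C (fst d) A \<longrightarrow>
        (forces d A PA \<epsilon> t (U \<cdot> p) \<longleftrightarrow> forces d A A \<rho> (s \<cdot> p) t))" for c s U
  proof (cases "stage c \<and> s \<in> hom C (fst c) A \<and> U \<in> hom C (fst c) PA")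
    case True
    have at: "forces1 d (?I \<otimes> A) ?a \<langle>\<langle>s, U\<rangle> \<cdot> p, t\<rangle> \<longleftrightarrow> forces d A PA \<epsilon> t (U \<cdot> p)"
        "forces1 d (?I \<otimes> A) ?b \<langle>\<langle>s, U\<rangle> \<cdot> p, t\<rangle> \<longleftrightarrow> forces d A A \<rho> (s \<cdot> p) t"
      if "refines d p c" "t \<in> hom C (fst d) A" for d p t
      using that(2) refines_typed[OF that(1)] True A PA \<rho> \<epsilon> I by simp_all
    have "forces c A PA \<theta> s U \<longleftrightarrow> forces1 c ?I d1 \<langle>s, U\<rangle> \<and> forces1 c ?I d2 \<langle>s, U\<rangle> \<and> forces c A A \<rho> s s"
      unfolding \<theta>_def forces_def[of c A PA] using True A PA \<rho> d1(1) d2(1) I by simp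
    also have "\<dots> \<longleftrightarrow> forces c A A \<rho> s s \<and>
      (\<forall>d p t. refines d p c \<and> t \<in> hom C (fst d) A \<longrightarrow>
        (forces d A PA \<epsilon> t (U \<cdot> p) \<longleftrightarrow> forces d A A \<rho> (s \<cdot> p) t))"
    proof -
      have sU: "stage c \<and> \<langle>s, U\<rangle> \<in> hom C (fst c) ?I" using True by simp
      show ?thesis unfolding d1(2) d2(2) using at sU by blast
    qed
    finally show ?thesis using True by blast
  next
    case False
    then show ?thesis by (blast dest: forces_typing)
  qed
  with \<theta>_fib show ?thesis using that by blast
qed

text \<open>The fibrant replacement of \<open>(A, \<rho>)\<close> is the object of \<open>\<rho>\<close>-classes inside the power object
  of \<open>A\<close>. A functional relation into \<open>(A, \<rho>)\<close> is named by a map into the power object, and this map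
  picks out the classes of the values.\<close>

lemma power_object_replacement:
  assumes \<rho>: "is_per C P A \<rho>"
  shows "\<exists>Z F. F \<in> hom (PerCat C P) (A, \<rho>) Z \<and>
    iso_arr (RelCat C P) (A, \<rho>) Z (FArr (LocFun C P) F) \<and>
    (\<forall>Y. \<forall>h\<in>hom (RelCat C P) Y (A, \<rho>). \<exists>G\<in>hom (PerCat C P) Y Z.
       FArr (LocFun C P) G = FArr (LocFun C P) F \<cdot>\<^bsub>RelCat C P\<^esub> h)"
proof -
  have A: "A \<in> Obj C" "\<rho> \<in> Fib P (A \<otimes> A)" using per_typed[OF \<rho>] by auto
  obtain PA \<epsilon> where PA: "PA \<in> Obj C" and \<epsilon>: "\<epsilon> \<in> Fib P (A \<otimes> PA)" and gen:
    "\<forall>J\<in>Obj C. \<forall>\<phi>\<in>Fib P (A \<otimes> J). \<exists>h\<in>hom C J PA. Pull P \<langle>Pr1 C A J, h \<cdot> Pr2 C A J\<rangle> \<epsilon> = \<phi>"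
    using generic[OF A(1)] by blast
  obtain \<theta> where \<theta>_fib: "\<theta> \<in> Fib P (A \<otimes> PA)"
    and \<theta>: "\<And>c s U. forces c A PA \<theta> s U \<longleftrightarrow> forces c A A \<rho> s s \<and> U \<in> hom C (fst c) PA \<and>
      (\<forall>d p t. refines d p c \<and> t \<in> hom C (fst d) A \<longrightarrow>
        (forces d A PA \<epsilon> t (U \<cdot> p) \<longleftrightarrow> forces d A A \<rho> (s \<cdot> p) t))"
    using singleton_predicate[OF A PA \<epsilon>] by blast
  have \<theta>_now: "forces c A PA \<epsilon> t U \<longleftrightarrow> forces c A A \<rho> s t"
    if h: "forces c A PA \<theta> s U" and t: "t \<in> hom C (fst c) A" for c s t U
  proof -
    note ty = forces_typed[OF h]
    have "forces c A PA \<epsilon> t (U \<cdot> Ident C (fst c)) \<longleftrightarrow> forces c A A \<rho> (s \<cdot> Ident C (fst c)) t"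
      using h t refines_refl[OF ty(1)] unfolding \<theta> by blast
    then show ?thesis using ty by simp
  qed
  have \<theta>_same: "forces c A A \<rho> s t" if "forces c A PA \<theta> s U" "forces c A PA \<theta> t U" for c s t U
  proof -
    have t: "forces c A A \<rho> t t" using that(2) unfolding \<theta> by blast
    then have "forces c A PA \<epsilon> t U" using \<theta>_now[OF that(2)] by blast
    then show ?thesis using \<theta>_now[OF that(1)] t by blast
  qed
  have \<theta>_ext: "forces c A PA \<theta> t U" if h: "forces c A PA \<theta> s U" and st: "forces c A A \<rho> s t" for c s t U
    unfolding \<theta>
  proof (intro conjI allI impI)
    show "forces c A A \<rho> t t" "U \<in> hom C (fst c) PA" using st h per_refl[OF \<rho>] by blast+
    fix d p r assume d: "refines d p c \<and> r \<in> hom C (fst d) A"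
    then have "forces d A PA \<epsilon> r (U \<cdot> p) \<longleftrightarrow> forces d A A \<rho> (s \<cdot> p) r" using h unfolding \<theta> by blast
    also have "\<dots> \<longleftrightarrow> forces d A A \<rho> (t \<cdot> p) r"
      using forces_refine[OF st] d per_sym[OF \<rho>] per_trans[OF \<rho>] by blast
    finally show "forces d A PA \<epsilon> r (U \<cdot> p) \<longleftrightarrow> forces d A A \<rho> (t \<cdot> p) r" .
  qed
  let ?\<theta>' = "app C P \<theta> (Pr2 C PA A) (Pr1 C PA A)"
  have \<theta>': "forces c PA A ?\<theta>' U s \<longleftrightarrow> forces c A PA \<theta> s U" for c U s
    using forces_converse[OF A(1) PA \<theta>_fib] .
  have \<theta>'_fib: "?\<theta>' \<in> Fib P (PA \<otimes> A)" using A PA \<theta>_fib by simp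
  (* The relation \<exists>x. \<theta>(x, U) \<and> \<theta>(x, V): both are the class of a common element. *)
  define \<tau> where "\<tau> = rel_comp C P PA A PA \<theta> ?\<theta>'"
  have \<tau>_fib: "\<tau> \<in> Fib P (PA \<otimes> PA)" unfolding \<tau>_def by (rule rel_comp_fib[OF PA A(1) PA \<theta>'_fib \<theta>_fib])
  have \<tau>_elim: "\<exists>d p s. cover d p c \<and> forces d A PA \<theta> s (U \<cdot> p) \<and> forces d A PA \<theta> s (V \<cdot> p)"
    if "forces c PA PA \<tau> U V" for c U V
    using rel_comp_elim[OF that[unfolded \<tau>_def] A(1) \<theta>'_fib \<theta>_fib] unfolding \<theta>' by metis
  have \<tau>_cover: "forces c PA PA \<tau> U V"
    if "cover d p c" "forces d A PA \<theta> s (U \<cdot> p)" "forces d A PA \<theta> s (V \<cdot> p)"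
      "U \<in> hom C (fst c) PA" "V \<in> hom C (fst c) PA" for d p c s U V
    unfolding \<tau>_def by (rule rel_comp_intro[of d p c]) (use that in \<open>auto simp: \<theta>'\<close>)
  have \<tau>_intro: "forces c PA PA \<tau> U V" if "forces c A PA \<theta> s U" "forces c A PA \<theta> s V" for c s U V
    using that forces_typed[OF that(1)] forces_typed[OF that(2)] cover_refl
    by (intro \<tau>_cover[of c "Ident C (fst c)" c s U V]) simp_all
  have \<tau>_per: "is_per C P PA \<tau>"
    unfolding is_per_iff
  proof (intro conjI allI impI)
    fix c U V assume h: "forces c PA PA \<tau> U V"
    then show "forces c PA PA \<tau> V U" using \<tau>_elim[OF h] \<tau>_cover by blast
  next
    fix c U V W assume h: "forces c PA PA \<tau> U V \<and> forces c PA PA \<tau> V W"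
    obtain d p s where d: "cover d p c" "forces d A PA \<theta> s (U \<cdot> p)" "forces d A PA \<theta> s (V \<cdot> p)"
      using h \<tau>_elim by blast
    note ref = cover_refines[OF d(1)]
    obtain e q t where e: "cover e q d" "forces e A PA \<theta> t (V \<cdot> p \<cdot> q)" "forces e A PA \<theta> t (W \<cdot> p \<cdot> q)"
      using forces_refine[OF h[THEN conjunct2] ref] \<tau>_elim by blast
    note ref' = cover_refines[OF e(1)]
    have "forces e A A \<rho> t (s \<cdot> q)" using \<theta>_same[OF e(2) forces_refine[OF d(3) ref']] .
    then have "forces e PA PA \<tau> (U \<cdot> p \<cdot> q) (W \<cdot> p \<cdot> q)"
      using \<tau>_intro[OF forces_refine[OF d(2) ref'] \<theta>_ext[OF e(3)]] by blast
    then have "forces d PA PA \<tau> (U \<cdot> p) (W \<cdot> p)"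
      by (rule forces_descend[OF _ e(1)])
        (use h[THEN conjunct1, THEN forces_typing] h[THEN conjunct2, THEN forces_typing] refines_typed[OF ref] in auto)
    then show "forces c PA PA \<tau> U W" by (rule forces_descend[OF _ d(1)]) (use h in blast)+
  qed (use PA \<tau>_fib in auto)
  (* The map naming the converse of \<phi> works: by single-valuedness and extensionality, {y. \<phi>(b, y)}
     is the class of any value of \<phi> at b. *)
  have name: "\<exists>g\<in>hom C B PA. \<forall>c b s. forces c B A \<phi> b s \<longrightarrow> forces c A PA \<theta> s (g \<cdot> b)"
    if \<phi>: "func_rel C P (B, \<sigma>) \<phi> (A, \<rho>)" for B \<sigma> \<phi>
  proof -
    note t = func_rel_typed[OF \<phi>]
    let ?\<phi>' = "app C P \<phi> (Pr2 C A B) (Pr1 C A B)"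
    have \<phi>': "?\<phi>' \<in> Fib P (A \<otimes> B)" using t by simp
    obtain g where g: "g \<in> hom C B PA" "Pull P \<langle>Pr1 C A B, g \<cdot> Pr2 C A B\<rangle> \<epsilon> = ?\<phi>'"
      using gen t(4) \<phi>' by blast
    have \<epsilon>g: "forces c A PA \<epsilon> s (g \<cdot> b) \<longleftrightarrow> forces c B A \<phi> b s"
      if b: "b \<in> hom C (fst c) B" for c b s
    proof (cases "s \<in> hom C (fst c) A")
      case True
      have "forces c A B (app C P \<epsilon> (Pr1 C A B) (g \<cdot> Pr2 C A B)) s b \<longleftrightarrow> forces c A PA \<epsilon> s (g \<cdot> b)"
        unfolding forces_def[of c A B] using True b g(1) t A PA \<epsilon> by simp
      moreover have "app C P \<epsilon> (Pr1 C A B) (g \<cdot> Pr2 C A B) = ?\<phi>'" using g(2) unfolding app_def by simp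
      ultimately show ?thesis using forces_converse[OF t(4,5,3)] by simp
    next
      case False
      then show ?thesis by (blast dest: forces_typing)
    qed
    have "forces c A PA \<theta> s (g \<cdot> b)" if h: "forces c B A \<phi> b s" for c b s
      unfolding \<theta>
    proof (intro conjI allI impI)
      show "forces c A A \<rho> s s" using func_rel_strict(2)[OF \<phi> h] .
      show "g \<cdot> b \<in> hom C (fst c) PA" using g(1) forces_typed[OF h] by simp
      fix d p r assume d: "refines d p c \<and> r \<in> hom C (fst d) A"
      note h' = forces_refine[OF h d[THEN conjunct1]]
      have "g \<cdot> b \<cdot> p = g \<cdot> (b \<cdot> p)" using g(1) forces_typed[OF h] refines_typed[OF d[THEN conjunct1]] by simp
      then have "forces d A PA \<epsilon> r (g \<cdot> b \<cdot> p) \<longleftrightarrow> forces d B A \<phi> (b \<cdot> p) r"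
        using \<epsilon>g[of "b \<cdot> p" d r] forces_typing[OF h'] by simp
      also have "\<dots> \<longleftrightarrow> forces d A A \<rho> (s \<cdot> p) r"
        using func_rel_single_valued[OF \<phi> h'] func_rel_ext[OF \<phi> func_rel_strict(1)[OF \<phi> h'] h'] by blast
      finally show "forces d A PA \<epsilon> r (g \<cdot> b \<cdot> p) \<longleftrightarrow> forces d A A \<rho> (s \<cdot> p) r" .
    qed
    with g(1) show ?thesis by blast
  qed
  obtain i where i: "i \<in> hom C A PA" and \<theta>i: "\<And>c x s. forces c A A \<rho> x s \<Longrightarrow> forces c A PA \<theta> s (i \<cdot> x)"
    using name[OF func_rel_ident[OF \<rho>]] by blast
  have i_map: "per_map C P (A, \<rho>) i (PA, \<tau>)"
  proof (rule per_mapI[OF \<rho> \<tau>_per i])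
    fix c s t assume st: "forces c A A \<rho> s t"
    show "forces c PA PA \<tau> (i \<cdot> s) (i \<cdot> t)"
      using \<tau>_intro[OF \<theta>i[OF st] \<theta>i[OF per_refl(2)[OF \<rho> st]]] .
  qed
  have iso: "iso_arr (RelCat C P) (A, \<rho>) (PA, \<tau>) (FArr (LocFun C P) ((A, \<rho>), i, (PA, \<tau>)))"
  proof (rule LocFun_weak_equivalence[OF i_map])
    fix c s t assume s: "forces c A A \<rho> s s" and t: "forces c A A \<rho> t t" and st: "forces c PA PA \<tau> (i \<cdot> s) (i \<cdot> t)"
    obtain d p r where d: "cover d p c" "forces d A PA \<theta> r (i \<cdot> s \<cdot> p)" "forces d A PA \<theta> r (i \<cdot> t \<cdot> p)"
      using \<tau>_elim[OF st] by blast
    note ref = cover_refines[OF d(1)]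
    have "forces d A A \<rho> r (s \<cdot> p)" "forces d A A \<rho> r (t \<cdot> p)"
      using \<theta>_same[OF d(2) forces_refine[OF \<theta>i[OF s] ref]] \<theta>_same[OF d(3) forces_refine[OF \<theta>i[OF t] ref]] .
    then have "forces d A A \<rho> (s \<cdot> p) (t \<cdot> p)" using per_sym[OF \<rho>] per_trans[OF \<rho>] by blast
    then show "forces c A A \<rho> s t" by (rule forces_descend[OF _ d(1)]) (use s t in blast)+
  next
    fix c U assume U: "forces c PA PA \<tau> U U"
    obtain d p s where d: "cover d p c" "forces d A PA \<theta> s (U \<cdot> p)" using \<tau>_elim[OF U] by blast
    have s: "forces d A A \<rho> s s" using d(2) unfolding \<theta> by blast
    then show "\<exists>d p s. cover d p c \<and> forces d A A \<rho> s s \<and> forces d PA PA \<tau> (i \<cdot> s) (U \<cdot> p)"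
      using d(1) \<tau>_intro[OF \<theta>i[OF s] d(2)] by blast
  qed
  have "\<exists>G\<in>hom (PerCat C P) Y (PA, \<tau>).
       FArr (LocFun C P) G = FArr (LocFun C P) ((A, \<rho>), i, (PA, \<tau>)) \<cdot>\<^bsub>RelCat C P\<^esub> h"
    if h: "h \<in> hom (RelCat C P) Y (A, \<rho>)" for Y h
  proof -
    obtain B \<sigma> \<phi> where Y: "Y = (B, \<sigma>)" and h_eq: "h = ((B, \<sigma>), \<phi>, (A, \<rho>))"
      and \<phi>: "func_rel C P (B, \<sigma>) \<phi> (A, \<rho>)"
      using h by (cases Y) (auto simp: RelCat_hom_iff)
    note t = func_rel_typed[OF \<phi>]
    obtain g where g: "g \<in> hom C B PA" and \<theta>g: "\<And>c b s. forces c B A \<phi> b s \<Longrightarrow> forces c A PA \<theta> s (g \<cdot> b)"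
      using name[OF \<phi>] by blast
    have g_map: "per_map C P (B, \<sigma>) g (PA, \<tau>)"
    proof (rule per_mapI[OF t(1) \<tau>_per g])
      fix c b b' assume bb: "forces c B B \<sigma> b b'"
      obtain d p s where d: "cover d p c" "forces d B A \<phi> (b \<cdot> p) s"
        using func_rel_total[OF \<phi> per_refl(1)[OF t(1) bb]] by blast
      have "forces d B A \<phi> (b' \<cdot> p) s"
        using func_rel_ext[OF \<phi> forces_refine[OF per_sym[OF t(1) bb] cover_refines[OF d(1)]] d(2)]
          func_rel_strict(2)[OF \<phi> d(2)] by blast
      then show "forces c PA PA \<tau> (g \<cdot> b) (g \<cdot> b')"
        using \<theta>g[OF d(2)] \<theta>g[of d "b' \<cdot> p" s] g forces_typed[OF bb] refines_typed[OF cover_refines[OF d(1)]]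
        by (intro \<tau>_cover[OF d(1), of s]) simp_all
    qed
    have "rel_comp C P B A PA (graph_rel (A, \<rho>) i (PA, \<tau>)) \<phi> = graph_rel (B, \<sigma>) g (PA, \<tau>)"
    proof (rule func_rel_eqI[OF func_rel_comp[OF \<phi> func_rel_graph[OF i_map]] func_rel_graph[OF g_map]])
      fix c b U assume h: "forces c B PA (rel_comp C P B A PA (graph_rel (A, \<rho>) i (PA, \<tau>)) \<phi>) b U"
      obtain d p s where d: "cover d p c" "forces d B A \<phi> (b \<cdot> p) s"
          "forces d A PA (graph_rel (A, \<rho>) i (PA, \<tau>)) s (U \<cdot> p)"
        using rel_comp_elim[OF h t(5) t(3) graph_rel_fib[OF i_map]] by blast
      then have s: "forces d A A \<rho> s s" and U: "forces d PA PA \<tau> (i \<cdot> s) (U \<cdot> p)"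
        unfolding forces_graph_rel[OF i_map] by blast+
      have "forces d PA PA \<tau> (g \<cdot> (b \<cdot> p)) (U \<cdot> p)"
        using per_trans[OF \<tau>_per \<tau>_intro[OF \<theta>g[OF d(2)] \<theta>i[OF s]] U] .
      then have "forces d B PA (graph_rel (B, \<sigma>) g (PA, \<tau>)) (b \<cdot> p) (U \<cdot> p)"
        unfolding forces_graph_rel[OF g_map] using func_rel_strict(1)[OF \<phi> d(2)] by blast
      then show "forces c B PA (graph_rel (B, \<sigma>) g (PA, \<tau>)) b U"
        by (rule forces_descend[OF _ d(1)]) (use h in blast)+
    qed
    then show ?thesis using g_map
      by (intro bexI[of _ "((B, \<sigma>), g, (PA, \<tau>))"]) (auto simp: Y h_eq PerCat_hom_iff)
  qed
  moreover have "((A, \<rho>), i, (PA, \<tau>)) \<in> hom (PerCat C P) (A, \<rho>) (PA, \<tau>)"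
    using i_map by (simp add: PerCat_hom_iff)
  ultimately show ?thesis using iso by blast
qed

end

section \<open>Kan extensions from replacements\<close>

lemma (in is_functor) map_arr [simp]:
  assumes "f \<in> Arr C"
  shows "FArr F f \<in> Arr D" "Dom D (FArr F f) = FObj F (Dom C f)" "Cod D (FArr F f) = FObj F (Cod C f)"
  using map_hom[of f "Dom C f" "Cod C f"] assms by auto

lemma (in is_functor) map_comp_arr:
  "f \<in> Arr C \<Longrightarrow> g \<in> Arr C \<Longrightarrow> Cod C f = Dom C g \<Longrightarrow>
    FArr F (g \<cdot>\<^bsub>C\<^esub> f) = FArr F g \<cdot>\<^bsub>D\<^esub> FArr F f"
  using map_comp[of f "Dom C f" "Dom C g" g "Cod C g"] by auto

lemma fcomp_simps [simp]:
  "FObj (G \<circ>\<^sub>F F) X = FObj G (FObj F X)" "FArr (G \<circ>\<^sub>F F) f = FArr G (FArr F f)"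
  unfolding fcomp_def by simp_all

lemma functor_comp:
  assumes "is_functor A B F" "is_functor B D G"
  shows "is_functor A D (G \<circ>\<^sub>F F)"
proof -
  interpret F: is_functor A B F by fact
  interpret G: is_functor B D G by fact
  show ?thesis
    by unfold_locales (auto simp: F.map_obj G.map_obj F.map_ident G.map_ident F.map_comp_arr G.map_comp_arr)
qed

text \<open>The objects \<open>Z\<close> of the hypothesis behave like fibrant objects, and \<open>i\<close> like a fibrant
  replacement. Every arrow of the localization between replacements lifts, and since \<open>G\<close> identifies
  any two lifts, evaluating \<open>G\<close> at replacements is a functor on the localization. It is the left Kan
  extension because an arrow \<open>S(X) \<rightarrow> S(Z)\<close> induced by \<open>i\<close> is invertible for each functor \<open>S\<close> on the
  localization.\<close>

lemma left_kan_extension_from_replacements: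
  assumes E: "is_functor A H E" and E_obj: "\<And>X. FObj E X = X" and HA: "Obj H = Obj A"
    and G: "is_functor A D G"
    and coarse: "\<And>X Y f g. f \<in> hom A X Y \<Longrightarrow> g \<in> hom A X Y \<Longrightarrow> FArr E f = FArr E g \<Longrightarrow> FArr G f = FArr G g"
    and repl: "\<And>X. X \<in> Obj A \<Longrightarrow> \<exists>Z i. i \<in> hom A X Z \<and> iso_arr H X Z (FArr E i) \<and>
      (\<forall>Y. \<forall>h\<in>hom H Y X. \<exists>f\<in>hom A Y Z. FArr E f = FArr E i \<cdot>\<^bsub>H\<^esub> h)"
  shows "\<exists>R \<eta>. left_kan_extension A H D E G R \<eta>"
proof -
  interpret E: is_functor A H E by fact
  interpret G: is_functor A D G by fact
  have "\<forall>X. \<exists>Z i j. X \<in> Obj A \<longrightarrow> i \<in> hom A X Z \<and> j \<in> hom H Z X \<and> j \<cdot>\<^bsub>H\<^esub> FArr E i = Ident H X \<and>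
      FArr E i \<cdot>\<^bsub>H\<^esub> j = Ident H Z \<and> (\<forall>Y. \<forall>h\<in>hom H Y X. \<exists>f\<in>hom A Y Z. FArr E f = FArr E i \<cdot>\<^bsub>H\<^esub> h)"
    using repl unfolding iso_arr_def by blast
  then obtain Z i j where Z: "\<And>X. X \<in> Obj A \<Longrightarrow> i X \<in> hom A X (Z X) \<and> j X \<in> hom H (Z X) X \<and>
      j X \<cdot>\<^bsub>H\<^esub> FArr E (i X) = Ident H X \<and> FArr E (i X) \<cdot>\<^bsub>H\<^esub> j X = Ident H (Z X) \<and>
      (\<forall>Y. \<forall>h\<in>hom H Y X. \<exists>f\<in>hom A Y (Z X). FArr E f = FArr E (i X) \<cdot>\<^bsub>H\<^esub> h)"
    by metis
  have i: "i X \<in> Arr A" "Dom A (i X) = X" "Cod A (i X) = Z X" "Z X \<in> Obj A"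
    and j: "j X \<in> Arr H" "Dom H (j X) = Z X" "Cod H (j X) = X"
    and ji: "j X \<cdot>\<^bsub>H\<^esub> FArr E (i X) = Ident H X" and ij: "FArr E (i X) \<cdot>\<^bsub>H\<^esub> j X = Ident H (Z X)"
    if "X \<in> Obj A" for X
    using Z[OF that] E.C.cod_obj[of "i X"] by auto
  note [simp] = E_obj HA i j
  let ?lift = "\<lambda>h f. f \<in> hom A (Z (Dom H h)) (Z (Cod H h)) \<and>
    FArr E f = FArr E (i (Cod H h)) \<cdot>\<^bsub>H\<^esub> (h \<cdot>\<^bsub>H\<^esub> j (Dom H h))"
  (* The choice of a lift is harmless, since G identifies any two of them; see R_eq. *)
  define R where "R = \<lparr>FObj = \<lambda>X. FObj G (Z X), FArr = \<lambda>h. FArr G (SOME f. ?lift h f)\<rparr>"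
  have HO: "Dom H h \<in> Obj A" "Cod H h \<in> Obj A" if "h \<in> Arr H" for h
    using E.D.dom_obj[OF that] E.D.cod_obj[OF that] by auto
  note [simp] = HO
  have R_obj: "FObj R X = FObj G (Z X)" for X by (simp add: R_def)
  have lift_ex: "\<exists>f. ?lift h f" if h: "h \<in> Arr H" for h
  proof -
    have "h \<cdot>\<^bsub>H\<^esub> j (Dom H h) \<in> hom H (Z (Dom H h)) (Cod H h)" using h by simp
    moreover have "Cod H h \<in> Obj A" using h by simp
    ultimately show ?thesis using Z[of "Cod H h"] by blast
  qed
  have R_eq: "FArr R h = FArr G f" if h: "h \<in> Arr H" and f: "?lift h f" for h f
  proof -
    have "?lift h (SOME f. ?lift h f)" using lift_ex[OF h] by (rule someI_ex)
    then show ?thesis using coarse[of "SOME f. ?lift h f" _ _ f] f unfolding R_def by simp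
  qed
  have liftI: "?lift h f"
    if "h \<in> Arr H" "f \<in> hom A (Z (Dom H h)) (Z (Cod H h))"
      "FArr E f \<cdot>\<^bsub>H\<^esub> FArr E (i (Dom H h)) = FArr E (i (Cod H h)) \<cdot>\<^bsub>H\<^esub> h" for h f
  proof -
    have "FArr E f = (FArr E f \<cdot>\<^bsub>H\<^esub> FArr E (i (Dom H h))) \<cdot>\<^bsub>H\<^esub> j (Dom H h)"
      using that(1,2) ij by simp
    also have "\<dots> = FArr E (i (Cod H h)) \<cdot>\<^bsub>H\<^esub> (h \<cdot>\<^bsub>H\<^esub> j (Dom H h))"
      unfolding that(3) using that(1) by simp
    finally show ?thesis using that(2) by blast
  qed
  have lift_square: "FArr E f \<cdot>\<^bsub>H\<^esub> FArr E (i (Dom H h)) = FArr E (i (Cod H h)) \<cdot>\<^bsub>H\<^esub> h"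
    if "h \<in> Arr H" "?lift h f" for h f
    using that ji by simp
  have R: "is_functor H D R"
  proof (intro is_functor.intro is_functor_axioms.intro E.D.category_axioms G.D.category_axioms)
    fix X assume X: "X \<in> Obj H"
    then show "FObj R X \<in> Obj D" by (simp add: R_obj G.map_obj)
    have "?lift (Ident H X) (Ident A (Z X))"
      using X E.map_ident[of "Z X"] by (intro liftI) simp_all
    then show "FArr R (Ident H X) = Ident D (FObj R X)"
      using X R_eq[of "Ident H X" "Ident A (Z X)"] by (simp add: R_obj G.map_ident)
  next
    fix h X Y assume h: "h \<in> hom H X Y"
    then obtain f where f: "?lift h f" using lift_ex[of h] by auto
    then show "FArr R h \<in> hom D (FObj R X) (FObj R Y)"
      using h R_eq[OF _ f] by (simp add: R_obj)
    fix k W assume k: "k \<in> hom H Y W"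
    then obtain g where g: "?lift k g" using lift_ex[of k] by auto
    have sq: "FArr E f \<cdot>\<^bsub>H\<^esub> FArr E (i X) = FArr E (i Y) \<cdot>\<^bsub>H\<^esub> h" "FArr E g \<cdot>\<^bsub>H\<^esub> FArr E (i Y) = FArr E (i W) \<cdot>\<^bsub>H\<^esub> k"
      using lift_square[OF _ f] lift_square[OF _ g] h k by auto
    have "?lift (k \<cdot>\<^bsub>H\<^esub> h) (g \<cdot>\<^bsub>A\<^esub> f)"
    proof (rule liftI)
      have "FArr E (g \<cdot>\<^bsub>A\<^esub> f) \<cdot>\<^bsub>H\<^esub> FArr E (i X) = FArr E g \<cdot>\<^bsub>H\<^esub> (FArr E f \<cdot>\<^bsub>H\<^esub> FArr E (i X))"
        using f g h k by (auto simp: E.map_comp_arr)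
      also have "\<dots> = (FArr E g \<cdot>\<^bsub>H\<^esub> FArr E (i Y)) \<cdot>\<^bsub>H\<^esub> h" unfolding sq(1) using f g h k by auto
      also have "\<dots> = FArr E (i W) \<cdot>\<^bsub>H\<^esub> (k \<cdot>\<^bsub>H\<^esub> h)" unfolding sq(2) using f g h k by auto
      finally show "FArr E (g \<cdot>\<^bsub>A\<^esub> f) \<cdot>\<^bsub>H\<^esub> FArr E (i (Dom H (k \<cdot>\<^bsub>H\<^esub> h))) =
          FArr E (i (Cod H (k \<cdot>\<^bsub>H\<^esub> h))) \<cdot>\<^bsub>H\<^esub> (k \<cdot>\<^bsub>H\<^esub> h)" using h k by simp
    qed (use f g h k in auto)
    then have "FArr R (k \<cdot>\<^bsub>H\<^esub> h) = FArr G (g \<cdot>\<^bsub>A\<^esub> f)" using h k by (intro R_eq) auto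
    also have "\<dots> = FArr G g \<cdot>\<^bsub>D\<^esub> FArr G f" using f g h k by (intro G.map_comp_arr) auto
    finally show "FArr R (k \<cdot>\<^bsub>H\<^esub> h) = FArr R k \<cdot>\<^bsub>D\<^esub> FArr R h" using R_eq[OF _ f] R_eq[OF _ g] h k by simp
  qed
  interpret R: is_functor H D R by (rule R)
  have RE: "is_functor A D (R \<circ>\<^sub>F E)" using functor_comp[OF E R] .
  have \<eta>: "nat_trans A D G (R \<circ>\<^sub>F E) (\<lambda>X. FArr G (i X))"
  proof (intro nat_trans.intro nat_trans_axioms.intro G RE)
    fix X assume "X \<in> Obj A"
    then show "FArr G (i X) \<in> hom D (FObj G X) (FObj (R \<circ>\<^sub>F E) X)" by (simp add: R_obj)
  next
    fix f X Y assume f: "f \<in> hom A X Y"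
    then have XY: "X \<in> Obj A" "Y \<in> Obj A" by auto
    have Ef: "FArr E f \<in> Arr H" using f by simp
    obtain f' where f': "?lift (FArr E f) f'" using lift_ex[OF Ef] by blast
    have "FArr E (f' \<cdot>\<^bsub>A\<^esub> i X) = FArr E (i Y \<cdot>\<^bsub>A\<^esub> f)"
      using lift_square[OF Ef f'] f f' XY by (auto simp: E.map_comp_arr)
    then have "FArr G (f' \<cdot>\<^bsub>A\<^esub> i X) = FArr G (i Y \<cdot>\<^bsub>A\<^esub> f)"
      using f f' XY by (intro coarse[of _ X "Z Y"]) auto
    then show "FArr G (i Y) \<cdot>\<^bsub>D\<^esub> FArr G f = FArr (R \<circ>\<^sub>F E) f \<cdot>\<^bsub>D\<^esub> FArr G (i X)"
      using R_eq[OF Ef f'] f f' XY by (auto simp: G.map_comp_arr)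
  qed
  have "left_kan_extension A H D E G R (\<lambda>X. FArr G (i X))"
    unfolding left_kan_extension_def
  proof (intro conjI E R \<eta> allI impI)
    fix S \<alpha> assume S\<alpha>: "is_functor H D S \<and> nat_trans A D G (S \<circ>\<^sub>F E) \<alpha>"
    interpret S: is_functor H D S using S\<alpha> by blast
    interpret \<alpha>: nat_trans A D G "S \<circ>\<^sub>F E" \<alpha> using S\<alpha> by blast
    have \<alpha>_arr: "\<alpha> X \<in> Arr D" "Dom D (\<alpha> X) = FObj G X" "Cod D (\<alpha> X) = FObj S X" if "X \<in> Obj A" for X
      using \<alpha>.component[OF that] by auto
    note [simp] = \<alpha>_arr
    define \<beta> where "\<beta> X = FArr S (j X) \<cdot>\<^bsub>D\<^esub> \<alpha> (Z X)" for X
    have S_ji: "FArr S (j X) \<cdot>\<^bsub>D\<^esub> FArr S (FArr E (i X)) = Ident D (FObj S X)" if "X \<in> Obj A" for X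
      using that S.map_comp_arr[of "FArr E (i X)" "j X"] ji[OF that] S.map_ident[of X] by simp
    have "nat_trans H D R S \<beta>"
    proof (intro nat_trans.intro nat_trans_axioms.intro R S.is_functor_axioms)
      fix X assume "X \<in> Obj H"
      then show "\<beta> X \<in> hom D (FObj R X) (FObj S X)" by (simp add: \<beta>_def R_obj)
    next
      fix h X Y assume h: "h \<in> hom H X Y"
      then have XY: "X \<in> Obj A" "Y \<in> Obj A" and hA: "h \<in> Arr H" by auto
      obtain f where f: "?lift h f" using lift_ex[OF hA] by blast
      have "j Y \<cdot>\<^bsub>H\<^esub> FArr E f = (j Y \<cdot>\<^bsub>H\<^esub> FArr E (i Y)) \<cdot>\<^bsub>H\<^esub> (h \<cdot>\<^bsub>H\<^esub> j X)"
        using f h XY by auto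
      then have jE: "j Y \<cdot>\<^bsub>H\<^esub> FArr E f = h \<cdot>\<^bsub>H\<^esub> j X"
        unfolding ji[OF XY(2)] using h XY by auto
      have "\<beta> Y \<cdot>\<^bsub>D\<^esub> FArr R h = FArr S (j Y) \<cdot>\<^bsub>D\<^esub> (\<alpha> (Z Y) \<cdot>\<^bsub>D\<^esub> FArr G f)"
        unfolding R_eq[OF hA f] \<beta>_def using f h XY by auto
      also have "\<dots> = FArr S (j Y) \<cdot>\<^bsub>D\<^esub> (FArr S (FArr E f) \<cdot>\<^bsub>D\<^esub> \<alpha> (Z X))"
        using \<alpha>.naturality[of f "Z X" "Z Y"] f h by auto
      also have "\<dots> = FArr S (j Y \<cdot>\<^bsub>H\<^esub> FArr E f) \<cdot>\<^bsub>D\<^esub> \<alpha> (Z X)"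
        using f h XY by (auto simp: S.map_comp_arr)
      also have "\<dots> = FArr S h \<cdot>\<^bsub>D\<^esub> \<beta> X"
        unfolding jE \<beta>_def using h XY by (auto simp: S.map_comp_arr)
      finally show "\<beta> Y \<cdot>\<^bsub>D\<^esub> FArr R h = FArr S h \<cdot>\<^bsub>D\<^esub> \<beta> X" .
    qed
    moreover have "\<beta> X \<cdot>\<^bsub>D\<^esub> FArr G (i X) = \<alpha> X" if X: "X \<in> Obj A" for X
    proof -
      have "\<beta> X \<cdot>\<^bsub>D\<^esub> FArr G (i X) = FArr S (j X) \<cdot>\<^bsub>D\<^esub> (\<alpha> (Z X) \<cdot>\<^bsub>D\<^esub> FArr G (i X))"
        using X by (simp add: \<beta>_def)
      also have "\<dots> = (FArr S (j X) \<cdot>\<^bsub>D\<^esub> FArr S (FArr E (i X))) \<cdot>\<^bsub>D\<^esub> \<alpha> X"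
        using \<alpha>.naturality[of "i X" X "Z X"] X by simp
      finally show ?thesis unfolding S_ji[OF X] using X by simp
    qed
    moreover have "\<beta>' X = \<beta> X"
      if \<beta>': "nat_trans H D R S \<beta>' \<and> (\<forall>X\<in>Obj A. \<beta>' (FObj E X) \<cdot>\<^bsub>D\<^esub> FArr G (i X) = \<alpha> X)"
        and X: "X \<in> Obj H" for \<beta>' X
    proof -
      interpret \<beta>': nat_trans H D R S \<beta>' using \<beta>' by blast
      have XA: "X \<in> Obj A" using X by simp
      have Ei: "FArr E (i X) \<in> Arr H" using XA by simp
      (* The map i (Z X) lifts E (i X), so the unit at Z X is a value of R, and naturality of \<beta>' at
         E (i X) expresses \<beta>' X through the component of \<alpha> at Z X. *)
      have "?lift (FArr E (i X)) (i (Z X))" using XA by (intro liftI) auto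
      then have "FArr R (FArr E (i X)) = FArr G (i (Z X))" using R_eq[OF Ei] by blast
      then have "\<alpha> (Z X) = \<beta>' (Z X) \<cdot>\<^bsub>D\<^esub> FArr R (FArr E (i X))" using \<beta>' XA by simp
      also have "\<dots> = FArr S (FArr E (i X)) \<cdot>\<^bsub>D\<^esub> \<beta>' X"
        using \<beta>'.naturality[of "FArr E (i X)" X "Z X"] XA by simp
      finally have "\<beta> X = (FArr S (j X) \<cdot>\<^bsub>D\<^esub> FArr S (FArr E (i X))) \<cdot>\<^bsub>D\<^esub> \<beta>' X"
        unfolding \<beta>_def using XA \<beta>'.component[of X] by simp
      then show ?thesis unfolding S_ji[OF XA] using XA \<beta>'.component[of X] by simp
    qed
    ultimately show "\<exists>\<beta>. nat_trans H D R S \<beta> \<and> (\<forall>X\<in>Obj A. \<beta> (FObj E X) \<cdot>\<^bsub>D\<^esub> FArr G (i X) = \<alpha> X) \<and>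
        (\<forall>\<beta>'. nat_trans H D R S \<beta>' \<and> (\<forall>X\<in>Obj A. \<beta>' (FObj E X) \<cdot>\<^bsub>D\<^esub> FArr G (i X) = \<alpha> X) \<longrightarrow>
           (\<forall>Y\<in>Obj H. \<beta>' Y = \<beta> Y))"
      by (intro exI[of _ \<beta>]) (simp only: E_obj, blast)
  qed
  then show ?thesis by blast
qed

definition op_cat :: "('o, 'a) cat \<Rightarrow> ('o, 'a) cat" where
  "op_cat C = \<lparr>Obj = Obj C, Arr = Arr C, Dom = Cod C, Cod = Dom C, Ident = Ident C,
     Comp = (\<lambda>g f. f \<cdot>\<^bsub>C\<^esub> g)\<rparr>"

lemma op_cat_simps [simp]:
  "Obj (op_cat C) = Obj C" "Arr (op_cat C) = Arr C" "Dom (op_cat C) = Cod C" "Cod (op_cat C) = Dom C"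
  "Ident (op_cat C) = Ident C" "g \<cdot>\<^bsub>op_cat C\<^esub> f = f \<cdot>\<^bsub>C\<^esub> g" "hom (op_cat C) A B = hom C B A"
  unfolding op_cat_def hom_def by auto

lemma op_op_cat [simp]: "op_cat (op_cat C) = C"
  unfolding op_cat_def by simp

lemma category_op:
  assumes "category C"
  shows "category (op_cat C)"
proof -
  interpret category C by fact
  show ?thesis by unfold_locales auto
qed

lemma functor_op:
  assumes "is_functor C D F"
  shows "is_functor (op_cat C) (op_cat D) F"
proof -
  interpret is_functor C D F by fact
  show ?thesis
    by (intro is_functor.intro is_functor_axioms.intro category_op C.category_axioms D.category_axioms)
      (auto simp: map_obj map_ident map_comp_arr)
qed

lemma functor_op_iff [simp]: "is_functor (op_cat C) (op_cat D) F \<longleftrightarrow> is_functor C D F"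
  using functor_op[of C D F] functor_op[of "op_cat C" "op_cat D" F] by auto

lemma nat_trans_op:
  assumes "nat_trans C D F G \<tau>"
  shows "nat_trans (op_cat C) (op_cat D) G F \<tau>"
proof -
  interpret nat_trans C D F G \<tau> by fact
  have "\<tau> A \<cdot>\<^bsub>op_cat D\<^esub> FArr G f = FArr F f \<cdot>\<^bsub>op_cat D\<^esub> \<tau> B"
    if "f \<in> hom (op_cat C) B A" for f A B
    using naturality[of f A B] that by simp
  moreover have "\<tau> A \<in> hom (op_cat D) (FObj G A) (FObj F A)" if "A \<in> Obj (op_cat C)" for A
    using component[of A] that by simp
  ultimately show ?thesis
    by (intro nat_trans.intro nat_trans_axioms.intro functor_op F.is_functor_axioms G.is_functor_axioms)
qed

lemma nat_trans_op_iff [simp]: "nat_trans (op_cat C) (op_cat D) G F \<tau> \<longleftrightarrow> nat_trans C D F G \<tau>"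
  using nat_trans_op[of C D F G \<tau>] nat_trans_op[of "op_cat C" "op_cat D" G F \<tau>] by auto

lemma left_kan_extension_op [simp]:
  "left_kan_extension (op_cat A) (op_cat B) (op_cat D) K G L \<eta> \<longleftrightarrow> right_kan_extension A B D K G L \<eta>"
  unfolding left_kan_extension_def right_kan_extension_def by simp

lemma iso_arr_op [simp]: "iso_arr (op_cat C) X Y f \<longleftrightarrow> iso_arr C Y X f"
  unfolding iso_arr_def by auto

text \<open>Reversing all arrows exchanges left and right Kan extensions, and fibrant and cofibrant
  replacements.\<close>

lemma right_kan_extension_from_replacements:
  fixes A :: "('o, 'a) cat" and H :: "('o, 'h) cat" and D :: "('d, 'e) cat"
  assumes E: "is_functor A H E" and E_obj: "\<And>X. FObj E X = X" and HA: "Obj H = Obj A"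
    and G: "is_functor A D G"
    and coarse: "\<And>X Y f g. f \<in> hom A X Y \<Longrightarrow> g \<in> hom A X Y \<Longrightarrow> FArr E f = FArr E g \<Longrightarrow> FArr G f = FArr G g"
    and repl: "\<And>X. X \<in> Obj A \<Longrightarrow> \<exists>Z p. p \<in> hom A Z X \<and> iso_arr H Z X (FArr E p) \<and>
      (\<forall>Y. \<forall>h\<in>hom H X Y. \<exists>f\<in>hom A Z Y. FArr E f = h \<cdot>\<^bsub>H\<^esub> FArr E p)"
  shows "\<exists>L \<epsilon>. right_kan_extension A H D E G L \<epsilon>"
proof -
  have "\<exists>L \<epsilon>. left_kan_extension (op_cat A) (op_cat H) (op_cat D) E G L \<epsilon>"
  proof (rule left_kan_extension_from_replacements[OF _ E_obj])
    show "is_functor (op_cat A) (op_cat H) E" "is_functor (op_cat A) (op_cat D) G"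
      using E G by simp_all
    show "Obj (op_cat H) = Obj (op_cat A)" using HA by simp
    show "FArr G f = FArr G g"
      if "f \<in> hom (op_cat A) X Y" "g \<in> hom (op_cat A) X Y" "FArr E f = FArr E g" for X Y f g
      using coarse[of f Y X g] that by simp
    show "\<exists>Z p. p \<in> hom (op_cat A) X Z \<and> iso_arr (op_cat H) X Z (FArr E p) \<and>
        (\<forall>Y. \<forall>h\<in>hom (op_cat H) Y X. \<exists>f\<in>hom (op_cat A) Y Z. FArr E f = FArr E p \<cdot>\<^bsub>op_cat H\<^esub> h)"
      if "X \<in> Obj (op_cat A)" for X
      using repl[of X] that by simp
  qed
  then show ?thesis by simp
qed

section \<open>Finite limits\<close>

text \<open>Two limit cones are related by an isomorphism, which \<open>F\<close> preserves; hence preservation of a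
  limit has to be tested on one limit cone only.\<close>

lemma limit_preservation_transport:
  assumes K: "is_functor J A K" and F: "is_functor A B F"
    and L: "is_limit_cone J A K L leg" and M: "is_limit_cone J A K M leg2"
    and FM: "is_limit_cone J B (F \<circ>\<^sub>F K) (FObj F M) (\<lambda>j. FArr F (leg2 j))"
  shows "is_limit_cone J B (F \<circ>\<^sub>F K) (FObj F L) (\<lambda>j. FArr F (leg j))"
proof -
  interpret K: is_functor J A K by fact
  interpret F: is_functor A B F by fact
  have cL: "is_cone J A K L leg" and cM: "is_cone J A K M leg2" using L M unfolding is_limit_cone_def by auto
  have LM: "L \<in> Obj A" "M \<in> Obj A" using cL cM unfolding is_cone_def by auto
  have leg: "leg j \<in> hom A L (FObj K j)" "leg2 j \<in> hom A M (FObj K j)" if "j \<in> Obj J" for j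
    using that cL cM unfolding is_cone_def by auto
  obtain h where h: "h \<in> hom A L M" "\<And>j. j \<in> Obj J \<Longrightarrow> leg2 j \<cdot>\<^bsub>A\<^esub> h = leg j"
    using M cL unfolding is_limit_cone_def by metis
  obtain k where k: "k \<in> hom A M L" "\<And>j. j \<in> Obj J \<Longrightarrow> leg j \<cdot>\<^bsub>A\<^esub> k = leg2 j"
    using L cM unfolding is_limit_cone_def by metis
  have kh: "k \<cdot>\<^bsub>A\<^esub> h = Ident A L"
  proof -
    have "\<exists>!m. m \<in> hom A L L \<and> (\<forall>j\<in>Obj J. leg j \<cdot>\<^bsub>A\<^esub> m = leg j)"
      using L cL unfolding is_limit_cone_def by blast
    moreover have "leg j \<cdot>\<^bsub>A\<^esub> (k \<cdot>\<^bsub>A\<^esub> h) = leg j" if j: "j \<in> Obj J" for j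
    proof -
      have "leg j \<cdot>\<^bsub>A\<^esub> (k \<cdot>\<^bsub>A\<^esub> h) = (leg j \<cdot>\<^bsub>A\<^esub> k) \<cdot>\<^bsub>A\<^esub> h" using leg[OF j] h(1) k(1) by simp
      then show ?thesis using h(2) k(2) j by simp
    qed
    moreover have "k \<cdot>\<^bsub>A\<^esub> h \<in> hom A L L" "Ident A L \<in> hom A L L" using h(1) k(1) LM by auto
    moreover have "leg j \<cdot>\<^bsub>A\<^esub> Ident A L = leg j" if "j \<in> Obj J" for j using leg[OF that] by simp
    ultimately show ?thesis by metis
  qed
  have Fcomp: "FArr F (leg2 j) \<cdot>\<^bsub>B\<^esub> FArr F h = FArr F (leg j)" "FArr F (leg j) \<cdot>\<^bsub>B\<^esub> FArr F k = FArr F (leg2 j)"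
    if "j \<in> Obj J" for j
    using F.map_comp[OF h(1) leg(2)[OF that]] F.map_comp[OF k(1) leg(1)[OF that]] h(2)[OF that] k(2)[OF that]
    by auto
  have FL: "FObj F L \<in> Obj B" using F.map_obj LM by blast
  have cone: "is_cone J B (F \<circ>\<^sub>F K) (FObj F L) (\<lambda>j. FArr F (leg j))"
    unfolding is_cone_def
  proof (intro conjI ballI allI impI FL)
    show "FArr F (leg j) \<in> hom B (FObj F L) (FObj (F \<circ>\<^sub>F K) j)" if "j \<in> Obj J" for j
      using leg(1)[OF that] by simp
    fix i j u assume u: "u \<in> hom J i j"
    then have "FArr K u \<cdot>\<^bsub>A\<^esub> leg i = leg j" using cL unfolding is_cone_def by blast
    moreover have "i \<in> Obj J" using u by auto
    ultimately show "FArr (F \<circ>\<^sub>F K) u \<cdot>\<^bsub>B\<^esub> FArr F (leg i) = FArr F (leg j)"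
      using F.map_comp[OF leg(1) K.map_hom[OF u]] by simp
  qed
  have "\<exists>!v. v \<in> hom B N (FObj F L) \<and> (\<forall>j\<in>Obj J. FArr F (leg j) \<cdot>\<^bsub>B\<^esub> v = leg' j)"
    if N: "is_cone J B (F \<circ>\<^sub>F K) N leg'" for N leg'
  proof -
    have uni: "\<exists>!u. u \<in> hom B N (FObj F M) \<and> (\<forall>j\<in>Obj J. FArr F (leg2 j) \<cdot>\<^bsub>B\<^esub> u = leg' j)"
      using FM N unfolding is_limit_cone_def by blast
    then obtain u where u: "u \<in> hom B N (FObj F M)" "\<forall>j\<in>Obj J. FArr F (leg2 j) \<cdot>\<^bsub>B\<^esub> u = leg' j" by blast
    have Fhk: "FArr F h \<in> hom B (FObj F L) (FObj F M)" "FArr F k \<in> hom B (FObj F M) (FObj F L)"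
      using h(1) k(1) by simp_all
    show ?thesis
    proof (rule ex1I)
      have "FArr F (leg j) \<cdot>\<^bsub>B\<^esub> (FArr F k \<cdot>\<^bsub>B\<^esub> u) = leg' j" if j: "j \<in> Obj J" for j
      proof -
        have "FArr F (leg j) \<cdot>\<^bsub>B\<^esub> (FArr F k \<cdot>\<^bsub>B\<^esub> u) = (FArr F (leg j) \<cdot>\<^bsub>B\<^esub> FArr F k) \<cdot>\<^bsub>B\<^esub> u"
          using leg[OF j] k(1) u(1) by simp
        then show ?thesis using Fcomp(2)[OF j] u(2) j by simp
      qed
      then show "FArr F k \<cdot>\<^bsub>B\<^esub> u \<in> hom B N (FObj F L) \<and>
          (\<forall>j\<in>Obj J. FArr F (leg j) \<cdot>\<^bsub>B\<^esub> (FArr F k \<cdot>\<^bsub>B\<^esub> u) = leg' j)"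
        using Fhk u(1) by simp
    next
      fix v assume v: "v \<in> hom B N (FObj F L) \<and> (\<forall>j\<in>Obj J. FArr F (leg j) \<cdot>\<^bsub>B\<^esub> v = leg' j)"
      have "FArr F (leg2 j) \<cdot>\<^bsub>B\<^esub> (FArr F h \<cdot>\<^bsub>B\<^esub> v) = leg' j" if j: "j \<in> Obj J" for j
      proof -
        have "FArr F (leg2 j) \<cdot>\<^bsub>B\<^esub> (FArr F h \<cdot>\<^bsub>B\<^esub> v) = (FArr F (leg2 j) \<cdot>\<^bsub>B\<^esub> FArr F h) \<cdot>\<^bsub>B\<^esub> v"
          using leg[OF j] h(1) v[THEN conjunct1] by simp
        then show ?thesis using Fcomp(1)[OF j] v j by simp
      qed
      moreover have "FArr F h \<cdot>\<^bsub>B\<^esub> v \<in> hom B N (FObj F M)" using Fhk v[THEN conjunct1] by simp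
      ultimately have "u = FArr F h \<cdot>\<^bsub>B\<^esub> v" using uni u by blast
      then have "FArr F k \<cdot>\<^bsub>B\<^esub> u = (FArr F k \<cdot>\<^bsub>B\<^esub> FArr F h) \<cdot>\<^bsub>B\<^esub> v"
        using Fhk v[THEN conjunct1] by simp
      moreover have "FArr F k \<cdot>\<^bsub>B\<^esub> FArr F h = Ident B (FObj F L)"
        unfolding F.map_comp[OF h(1) k(1), symmetric] kh by (rule F.map_ident[OF LM(1)])
      ultimately show "v = FArr F k \<cdot>\<^bsub>B\<^esub> u"
        using v[THEN conjunct1] by simp
    qed
  qed
  with cone show ?thesis unfolding is_limit_cone_def by blast
qed

definition carrier_fctr :: "('o \<times> 'p, ('o \<times> 'p) \<times> 'a \<times> ('o \<times> 'p), 'o, 'a) fctr" where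
  "carrier_fctr = \<lparr>FObj = fst, FArr = (\<lambda>(X, f, Y). f)\<rparr>"

lemma carrier_fctr_simps [simp]: "FObj carrier_fctr X = fst X" "FArr carrier_fctr (X, f, Y) = f"
  unfolding carrier_fctr_def by simp_all

context indexed_frame
begin

lemma carrier_functor: "is_functor (PerCat C P) C carrier_fctr"
proof (intro is_functor.intro is_functor_axioms.intro PerCat_category category_axioms)
  fix X assume "X \<in> Obj (PerCat C P)"
  then show "FObj carrier_fctr X \<in> Obj C"
    "FArr carrier_fctr (Ident (PerCat C P) X) = Ident C (FObj carrier_fctr X)"
    by (cases X; simp add: per_typed)+
next
  fix F X Y assume F: "F \<in> hom (PerCat C P) X Y"
  then show "FArr carrier_fctr F \<in> hom C (FObj carrier_fctr X) (FObj carrier_fctr Y)"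
    by (cases X; cases Y) (auto simp: PerCat_hom_iff per_map_typed)
  fix G Z assume "G \<in> hom (PerCat C P) Y Z"
  with F show "FArr carrier_fctr (G \<cdot>\<^bsub>PerCat C P\<^esub> F) = FArr carrier_fctr G \<cdot> FArr carrier_fctr F"
    by (auto simp: PerCat_hom_iff)
qed

text \<open>A limit of carriers becomes a limit of partial equivalence relations once its vertex carries
  the coarsest relation making the legs morphisms.\<close>

lemma limit_cone_PerCat:
  assumes K: "is_functor J (PerCat C P) K" and L: "is_limit_cone J C (carrier_fctr \<circ>\<^sub>F K) L leg"
    and \<tau>_fib: "\<tau> \<in> Fib P (L \<otimes> L)"
    and \<tau>: "\<And>c s t. forces c L L \<tau> s t \<longleftrightarrow> stage c \<and> s \<in> hom C (fst c) L \<and> t \<in> hom C (fst c) L \<and>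
      (\<forall>j\<in>Obj J. forces c (fst (FObj K j)) (fst (FObj K j)) (snd (FObj K j)) (leg j \<cdot> s) (leg j \<cdot> t))"
  shows "is_limit_cone J (PerCat C P) K (L, \<tau>) (\<lambda>j. ((L, \<tau>), leg j, FObj K j))"
proof -
  interpret K: is_functor J "PerCat C P" K by fact
  note [simp del] = K.D.hom_iff
  let ?A = "\<lambda>j. fst (FObj K j)" and ?\<rho> = "\<lambda>j. snd (FObj K j)"
  have cL: "is_cone J C (carrier_fctr \<circ>\<^sub>F K) L leg" using L unfolding is_limit_cone_def by blast
  have per: "is_per C P (?A j) (?\<rho> j)" if "j \<in> Obj J" for j
    using K.map_obj[OF that] by (cases "FObj K j") simp
  have LO: "L \<in> Obj C" using cL unfolding is_cone_def by blast
  have leg: "leg j \<in> hom C L (?A j)" if "j \<in> Obj J" for j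
    using cL that unfolding is_cone_def by simp
  have \<tau>_per: "is_per C P L \<tau>"
    unfolding is_per_iff
  proof (intro conjI allI impI LO \<tau>_fib)
    show "forces c L L \<tau> t s" if "forces c L L \<tau> s t" for c s t
      using that per_sym[OF per] unfolding \<tau> by blast
    show "forces c L L \<tau> s r" if "forces c L L \<tau> s t \<and> forces c L L \<tau> t r" for c s t r
      using that per_trans[OF per] unfolding \<tau> by blast
  qed
  have leg_map: "per_map C P (L, \<tau>) (leg j) (FObj K j)" if "j \<in> Obj J" for j
    using per_mapI[OF \<tau>_per per[OF that] leg[OF that]] that \<tau> by simp
  have cone: "is_cone J (PerCat C P) K (L, \<tau>) (\<lambda>j. ((L, \<tau>), leg j, FObj K j))"
    unfolding is_cone_def
  proof (intro conjI ballI allI impI)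
    show "(L, \<tau>) \<in> Obj (PerCat C P)" using \<tau>_per by simp
    show "((L, \<tau>), leg j, FObj K j) \<in> hom (PerCat C P) (L, \<tau>) (FObj K j)" if "j \<in> Obj J" for j
      using leg_map[OF that] by (simp add: PerCat_hom_iff)
    fix i j u assume u: "u \<in> hom J i j"
    then obtain f where f: "FArr K u = (FObj K i, f, FObj K j)" using K.map_hom[OF u] by (auto simp: PerCat_hom_iff)
    have "FArr (carrier_fctr \<circ>\<^sub>F K) u \<cdot> leg i = leg j" using cL u unfolding is_cone_def by blast
    then show "FArr K u \<cdot>\<^bsub>PerCat C P\<^esub> ((L, \<tau>), leg i, FObj K i) = ((L, \<tau>), leg j, FObj K j)"
      using f by simp
  qed
  have "\<exists>!H. H \<in> hom (PerCat C P) N (L, \<tau>) \<and>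
      (\<forall>j\<in>Obj J. ((L, \<tau>), leg j, FObj K j) \<cdot>\<^bsub>PerCat C P\<^esub> H = leg' j)"
    if N: "is_cone J (PerCat C P) K N leg'" for N leg'
  proof -
    obtain M \<mu> where N_eq: "N = (M, \<mu>)" by (cases N)
    have \<mu>: "is_per C P M \<mu>" using N unfolding is_cone_def N_eq by simp
    define g where "g j = FArr carrier_fctr (leg' j)" for j
    have g: "leg' j = (N, g j, FObj K j)" "per_map C P N (g j) (FObj K j)" if "j \<in> Obj J" for j
      using N that unfolding is_cone_def g_def by (auto simp: PerCat_hom_iff)
    have g_hom: "g j \<in> hom C M (?A j)" if "j \<in> Obj J" for j
      using g(2)[OF that] unfolding N_eq by (cases "FObj K j") (auto simp: per_map_typed)
    have "is_cone J C (carrier_fctr \<circ>\<^sub>F K) M g"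
      unfolding is_cone_def
    proof (intro conjI ballI allI impI)
      show "M \<in> Obj C" using per_typed[OF \<mu>] by blast
      show "g j \<in> hom C M (FObj (carrier_fctr \<circ>\<^sub>F K) j)" if "j \<in> Obj J" for j using g_hom[OF that] by simp
      fix i j u assume u: "u \<in> hom J i j"
      then have ij: "i \<in> Obj J" "j \<in> Obj J" by auto
      obtain f where f: "FArr K u = (FObj K i, f, FObj K j)" using K.map_hom[OF u] by (auto simp: PerCat_hom_iff)
      have "FArr K u \<cdot>\<^bsub>PerCat C P\<^esub> leg' i = leg' j" using N u unfolding is_cone_def by blast
      then show "FArr (carrier_fctr \<circ>\<^sub>F K) u \<cdot> g i = g j" using f g(1) ij by simp
    qed
    then have uni: "\<exists>!h. h \<in> hom C M L \<and> (\<forall>j\<in>Obj J. leg j \<cdot> h = g j)"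
      using L unfolding is_limit_cone_def by blast
    then obtain h where h: "h \<in> hom C M L" "\<forall>j\<in>Obj J. leg j \<cdot> h = g j" by blast
    have h_map: "per_map C P (M, \<mu>) h (L, \<tau>)"
    proof (rule per_mapI[OF \<mu> \<tau>_per h(1)])
      fix c s t assume st: "forces c M M \<mu> s t"
      have "forces c (?A j) (?A j) (?\<rho> j) (leg j \<cdot> (h \<cdot> s)) (leg j \<cdot> (h \<cdot> t))" if j: "j \<in> Obj J" for j
      proof -
        have "per_map C P (M, \<mu>) (g j) (?A j, ?\<rho> j)" using g(2)[OF j] unfolding N_eq by simp
        from per_map_forces[OF this st] have "forces c (?A j) (?A j) (?\<rho> j) ((leg j \<cdot> h) \<cdot> s) ((leg j \<cdot> h) \<cdot> t)"
          using h(2) j by simp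
        then show ?thesis using h(1) leg[OF j] forces_typed[OF st] by simp
      qed
      then show "forces c L L \<tau> (h \<cdot> s) (h \<cdot> t)" unfolding \<tau> using h(1) forces_typed[OF st] by simp
    qed
    show ?thesis
    proof (rule ex1I[of _ "(N, h, (L, \<tau>))"])
      show "(N, h, (L, \<tau>)) \<in> hom (PerCat C P) N (L, \<tau>) \<and>
          (\<forall>j\<in>Obj J. ((L, \<tau>), leg j, FObj K j) \<cdot>\<^bsub>PerCat C P\<^esub> (N, h, (L, \<tau>)) = leg' j)"
        using h_map h(2) g(1) unfolding N_eq by (simp add: PerCat_hom_iff)
      fix H assume H: "H \<in> hom (PerCat C P) N (L, \<tau>) \<and>
          (\<forall>j\<in>Obj J. ((L, \<tau>), leg j, FObj K j) \<cdot>\<^bsub>PerCat C P\<^esub> H = leg' j)"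
      then obtain k where k: "H = (N, k, (L, \<tau>))" "per_map C P (M, \<mu>) k (L, \<tau>)"
        unfolding N_eq by (auto simp: PerCat_hom_iff)
      have "k \<in> hom C M L" using per_map_typed[OF k(2)] by simp
      moreover have "\<forall>j\<in>Obj J. leg j \<cdot> k = g j" using H g(1) unfolding k(1) by simp
      ultimately show "H = (N, h, (L, \<tau>))" using uni h unfolding k(1) by blast
    qed
  qed
  with cone show ?thesis unfolding is_limit_cone_def by blast
qed

lemma forces1_top:
  assumes "I \<in> Obj C" "is_top P I t"
  shows "forces1 c I t f \<longleftrightarrow> stage c \<and> f \<in> hom C (fst c) I"
proof -
  have "Le P (fst c) (snd c) (Pull P f t)" if "stage c" "f \<in> hom C (fst c) I"
    using pull_top[OF that(2) assms(2)] that(1) unfolding is_top_def stage_def by blast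
  then show ?thesis using assms(2) unfolding forces1_def is_top_def by blast
qed

end

section \<open>The functor induced by a cartesian map\<close>

locale cartesian_frame_map = P: indexed_frame C P + Q: indexed_frame C Q + cartesian_map C P Q \<Phi>
  for C :: "('o, 'a) prodcat" and P :: "('o, 'a, 'p) ixposet" and Q :: "('o, 'a, 'q) ixposet"
    and \<Phi> :: "'o \<Rightarrow> 'p \<Rightarrow> 'q"
begin

lemma map_meet_eq [simp]:
  assumes "I \<in> Obj C" "\<phi> \<in> Fib P I" "\<psi> \<in> Fib P I"
  shows "\<Phi> I (meet P I \<phi> \<psi>) = meet Q I (\<Phi> I \<phi>) (\<Phi> I \<psi>)"
  using assms map_meet[OF assms P.meet_characterization[OF assms]] map_fib
  by (intro Q.meet_unique[symmetric]) auto

declare map_fib [simp]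

lemma map_app [simp]:
  assumes "s \<in> Arr C" "t \<in> Arr C" "Dom C s = I" "Dom C t = I" "\<phi> \<in> Fib P (Cod C s \<otimes>\<^bsub>C\<^esub> Cod C t)"
  shows "\<Phi> I (app C P \<phi> s t) = app C Q (\<Phi> (Cod C s \<otimes>\<^bsub>C\<^esub> Cod C t) \<phi>) s t"
  using assms map_pull[of "\<langle>s, t\<rangle>\<^bsub>C\<^esub>" I "Cod C s \<otimes>\<^bsub>C\<^esub> Cod C t" \<phi>] unfolding app_def by simp

lemma is_per_map:
  assumes \<rho>: "is_per C P A \<rho>"
  shows "is_per C Q A (\<Phi> (A \<otimes>\<^bsub>C\<^esub> A) \<rho>)"
proof -
  have A: "A \<in> Obj C" "\<rho> \<in> Fib P (A \<otimes>\<^bsub>C\<^esub> A)" using P.per_typed[OF \<rho>] by auto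
  let ?\<Gamma>' = "A \<otimes>\<^bsub>C\<^esub> A"
  let ?\<Gamma> = "?\<Gamma>' \<otimes>\<^bsub>C\<^esub> A"
  let ?x = "Pr1 C A A" and ?y = "Pr2 C A A" and ?p = "Pr1 C ?\<Gamma>' A" and ?z = "Pr2 C ?\<Gamma>' A"
  have "Le Q ?\<Gamma>' (\<Phi> ?\<Gamma>' (app C P \<rho> ?x ?y)) (\<Phi> ?\<Gamma>' (app C P \<rho> ?y ?x))"
    by (rule map_mono) (use \<rho> A in \<open>auto simp: is_per_def Let_def\<close>)
  moreover have "Le Q ?\<Gamma> (\<Phi> ?\<Gamma> (meet P ?\<Gamma> (app C P \<rho> (?x \<cdot>\<^bsub>C\<^esub> ?p) (?y \<cdot>\<^bsub>C\<^esub> ?p)) (app C P \<rho> (?y \<cdot>\<^bsub>C\<^esub> ?p) ?z)))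
      (\<Phi> ?\<Gamma> (app C P \<rho> (?x \<cdot>\<^bsub>C\<^esub> ?p) ?z))"
    by (rule map_mono) (use \<rho> A in \<open>auto simp: is_per_def Let_def\<close>)
  ultimately show ?thesis using A unfolding is_per_def Let_def by simp
qed

lemma per_map_map:
  assumes f: "per_map C P (A, \<rho>) f (B, \<sigma>)"
  shows "per_map C Q (A, \<Phi> (A \<otimes>\<^bsub>C\<^esub> A) \<rho>) f (B, \<Phi> (B \<otimes>\<^bsub>C\<^esub> B) \<sigma>)"
proof -
  note t = P.per_map_typed[OF f]
  have "Le Q (A \<otimes>\<^bsub>C\<^esub> A) (\<Phi> (A \<otimes>\<^bsub>C\<^esub> A) (app C P \<rho> (Pr1 C A A) (Pr2 C A A)))
      (\<Phi> (A \<otimes>\<^bsub>C\<^esub> A) (app C P \<sigma> (f \<cdot>\<^bsub>C\<^esub> Pr1 C A A) (f \<cdot>\<^bsub>C\<^esub> Pr2 C A A)))"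
    by (rule map_mono) (use f t in \<open>auto simp: per_map_def Let_def\<close>)
  then show ?thesis using t is_per_map unfolding per_map_def Let_def by simp
qed

lemma PerFun_simps [simp]:
  "FObj (PerFun C \<Phi>) (A, \<rho>) = (A, \<Phi> (A \<otimes>\<^bsub>C\<^esub> A) \<rho>)"
  "fst (FObj (PerFun C \<Phi>) X) = fst X"
  "snd (FObj (PerFun C \<Phi>) X) = \<Phi> (fst X \<otimes>\<^bsub>C\<^esub> fst X) (snd X)"
  "FArr (PerFun C \<Phi>) (X, f, Y) = (FObj (PerFun C \<Phi>) X, f, FObj (PerFun C \<Phi>) Y)"
  unfolding PerFun_def Let_def by (cases X; simp)+

lemma PerFun_functor: "is_functor (PerCat C P) (PerCat C Q) (PerFun C \<Phi>)"
proof (intro is_functor.intro is_functor_axioms.intro P.PerCat_category Q.PerCat_category)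
  fix X assume "X \<in> Obj (PerCat C P)"
  then show "FObj (PerFun C \<Phi>) X \<in> Obj (PerCat C Q)"
    "FArr (PerFun C \<Phi>) (Ident (PerCat C P) X) = Ident (PerCat C Q) (FObj (PerFun C \<Phi>) X)"
    by (cases X; simp add: is_per_map)+
next
  fix F X Y assume F: "F \<in> hom (PerCat C P) X Y"
  then show "FArr (PerFun C \<Phi>) F \<in> hom (PerCat C Q) (FObj (PerFun C \<Phi>) X) (FObj (PerFun C \<Phi>) Y)"
    by (cases X; cases Y) (auto simp: P.PerCat_hom_iff Q.PerCat_hom_iff per_map_map)
  fix G Z assume "G \<in> hom (PerCat C P) Y Z"
  with F show "FArr (PerFun C \<Phi>) (G \<cdot>\<^bsub>PerCat C P\<^esub> F) =
      FArr (PerFun C \<Phi>) G \<cdot>\<^bsub>PerCat C Q\<^esub> FArr (PerFun C \<Phi>) F"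
    by (auto simp: P.PerCat_hom_iff)
qed

text \<open>Equality of \<open>f\<close> and \<open>g\<close> in the localization amounts to \<open>\<rho>(x, x) \<turnstile> \<sigma>(fx, gx)\<close>, a Horn
  judgment, and \<open>\<Phi>\<close> preserves those.\<close>

lemma LocFun_PerFun_eq:
  assumes F: "F \<in> hom (PerCat C P) X Y" and G: "G \<in> hom (PerCat C P) X Y"
    and eq: "FArr (LocFun C P) F = FArr (LocFun C P) G"
  shows "FArr (LocFun C Q) (FArr (PerFun C \<Phi>) F) = FArr (LocFun C Q) (FArr (PerFun C \<Phi>) G)"
proof -
  obtain A \<rho> B \<sigma> where XY: "X = (A, \<rho>)" "Y = (B, \<sigma>)" by (cases X; cases Y)
  obtain f g where fg: "F = (X, f, Y)" "G = (X, g, Y)"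
    and f: "per_map C P (A, \<rho>) f (B, \<sigma>)" and g: "per_map C P (A, \<rho>) g (B, \<sigma>)"
    using F G unfolding XY by (auto simp: P.PerCat_hom_iff)
  note t = P.per_map_typed[OF f] P.per_map_typed[OF g]
  have "Le P A (app C P \<rho> (Ident C A) (Ident C A)) (app C P \<sigma> f g)"
    using eq P.graph_rel_eq_iff[OF f g] unfolding fg XY by simp
  then have "Le Q A (\<Phi> A (app C P \<rho> (Ident C A) (Ident C A))) (\<Phi> A (app C P \<sigma> f g))"
    using t by (intro map_mono) auto
  then show ?thesis
    using Q.graph_rel_eq_iff[OF per_map_map[OF f] per_map_map[OF g]] t unfolding fg XY by simp
qed

text \<open>The meet and its image under \<open>\<Phi>\<close> are built along one induction, so that the same predicate
  serves for the limits on both sides.\<close>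

lemma finite_meet_exists:
  assumes "finite S" "I \<in> Obj C" "\<forall>j\<in>S. a j \<in> Fib P I"
  shows "\<exists>m\<in>Fib P I.
    (\<forall>c f. P.forces1 c I m f \<longleftrightarrow> P.stage c \<and> f \<in> hom C (fst c) I \<and> (\<forall>j\<in>S. P.forces1 c I (a j) f)) \<and>
    (\<forall>c f. Q.forces1 c I (\<Phi> I m) f \<longleftrightarrow>
      Q.stage c \<and> f \<in> hom C (fst c) I \<and> (\<forall>j\<in>S. Q.forces1 c I (\<Phi> I (a j)) f))"
  using assms(1,3)
proof (induction S)
  case empty
  obtain t where t: "is_top P I t" using P.ex_top assms(2) by blast
  then have "t \<in> Fib P I" unfolding is_top_def by blast
  then show ?case
    using P.forces1_top[OF assms(2) t] Q.forces1_top[OF assms(2) map_top[OF assms(2) t]]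
    by (intro bexI[of _ t]) auto
next
  case (insert j S)
  then obtain m where m: "m \<in> Fib P I"
      "\<forall>c f. P.forces1 c I m f \<longleftrightarrow> P.stage c \<and> f \<in> hom C (fst c) I \<and> (\<forall>j\<in>S. P.forces1 c I (a j) f)"
      "\<forall>c f. Q.forces1 c I (\<Phi> I m) f \<longleftrightarrow>
        Q.stage c \<and> f \<in> hom C (fst c) I \<and> (\<forall>j\<in>S. Q.forces1 c I (\<Phi> I (a j)) f)"
    by auto
  have aj: "a j \<in> Fib P I" using insert.prems by simp
  have "P.forces1 c I (meet P I (a j) m) f \<longleftrightarrow> P.forces1 c I (a j) f \<and> P.forces1 c I m f" for c f
    using aj m(1) by simp
  moreover have "Q.forces1 c I (\<Phi> I (meet P I (a j) m)) f \<longleftrightarrow>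
      Q.forces1 c I (\<Phi> I (a j)) f \<and> Q.forces1 c I (\<Phi> I m) f" for c f
    using aj m(1) assms(2) by simp
  moreover have "meet P I (a j) m \<in> Fib P I" using aj m(1) assms(2) by simp
  ultimately show ?case using m(2,3) by (intro bexI[of _ "meet P I (a j) m"]) auto
qed

lemma PerFun_preserves_finite_limits:
  "preserves_finite_limits (PerCat C P) (PerCat C Q) (PerFun C \<Phi>)"
  unfolding preserves_finite_limits_def
proof (intro conjI PerFun_functor allI impI)
  fix J :: "(nat, nat) cat" and K M leg2
  assume h: "finite_category J \<and> is_functor J (PerCat C P) K \<and> is_limit_cone J (PerCat C P) K M leg2"
  then have K: "is_functor J (PerCat C P) K" by blast
  interpret K: is_functor J "PerCat C P" K by (rule K)
  let ?A = "\<lambda>j. fst (FObj K j)" and ?\<rho> = "\<lambda>j. snd (FObj K j)"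
  obtain L leg where L: "is_limit_cone J C (carrier_fctr \<circ>\<^sub>F K) L leg"
    using P.finite_limits h functor_comp[OF K P.carrier_functor] unfolding has_finite_limits_def by blast
  have cL: "is_cone J C (carrier_fctr \<circ>\<^sub>F K) L leg" using L unfolding is_limit_cone_def by blast
  have LO: "L \<in> Obj C" using cL unfolding is_cone_def by blast
  have leg: "leg j \<in> Arr C" "Dom C (leg j) = L" "Cod C (leg j) = ?A j" if "j \<in> Obj J" for j
    using cL that unfolding is_cone_def by auto
  have per: "?A j \<in> Obj C" "?\<rho> j \<in> Fib P (?A j \<otimes>\<^bsub>C\<^esub> ?A j)" if "j \<in> Obj J" for j
    using K.map_obj[OF that] P.per_typed by (cases "FObj K j"; auto)+
  let ?I = "L \<otimes>\<^bsub>C\<^esub> L"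
  define a where "a j = app C P (?\<rho> j) (leg j \<cdot>\<^bsub>C\<^esub> Pr1 C L L) (leg j \<cdot>\<^bsub>C\<^esub> Pr2 C L L)" for j
  have a_fib: "a j \<in> Fib P ?I" if "j \<in> Obj J" for j
    unfolding a_def using leg[OF that] per[OF that] LO by simp
  have \<Phi>a: "\<Phi> ?I (a j) = app C Q (\<Phi> (?A j \<otimes>\<^bsub>C\<^esub> ?A j) (?\<rho> j)) (leg j \<cdot>\<^bsub>C\<^esub> Pr1 C L L) (leg j \<cdot>\<^bsub>C\<^esub> Pr2 C L L)"
    if "j \<in> Obj J" for j
    unfolding a_def using leg[OF that] per[OF that] LO by simp
  have "finite (Obj J)" "?I \<in> Obj C" using h LO unfolding finite_category_def by auto
  then obtain \<tau> where \<tau>_fib: "\<tau> \<in> Fib P ?I"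
    and \<tau>P: "\<And>c f. P.forces1 c ?I \<tau> f \<longleftrightarrow>
      P.stage c \<and> f \<in> hom C (fst c) ?I \<and> (\<forall>j\<in>Obj J. P.forces1 c ?I (a j) f)"
    and \<tau>Q: "\<And>c f. Q.forces1 c ?I (\<Phi> ?I \<tau>) f \<longleftrightarrow>
      Q.stage c \<and> f \<in> hom C (fst c) ?I \<and> (\<forall>j\<in>Obj J. Q.forces1 c ?I (\<Phi> ?I (a j)) f)"
    using finite_meet_exists[of "Obj J" ?I a] a_fib by blast
  have "is_limit_cone J (PerCat C P) K (L, \<tau>) (\<lambda>j. ((L, \<tau>), leg j, FObj K j))"
  proof (rule P.limit_cone_PerCat[OF K L \<tau>_fib])
    fix c s t
    have "P.forces1 c ?I (a j) \<langle>s, t\<rangle>\<^bsub>C\<^esub> \<longleftrightarrow> P.forces c (?A j) (?A j) (?\<rho> j) (leg j \<cdot>\<^bsub>C\<^esub> s) (leg j \<cdot>\<^bsub>C\<^esub> t)"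
      if "s \<in> hom C (fst c) L" "t \<in> hom C (fst c) L" "j \<in> Obj J" for j
      unfolding a_def using that leg[OF that(3)] per[OF that(3)] LO by simp
    then show "P.forces c L L \<tau> s t \<longleftrightarrow> P.stage c \<and> s \<in> hom C (fst c) L \<and> t \<in> hom C (fst c) L \<and>
        (\<forall>j\<in>Obj J. P.forces c (?A j) (?A j) (?\<rho> j) (leg j \<cdot>\<^bsub>C\<^esub> s) (leg j \<cdot>\<^bsub>C\<^esub> t))"
      unfolding P.forces_def[of c L L] \<tau>P by auto
  qed
  moreover
  have K': "is_functor J (PerCat C Q) (PerFun C \<Phi> \<circ>\<^sub>F K)" using functor_comp[OF K PerFun_functor] .
  have "carrier_fctr \<circ>\<^sub>F (PerFun C \<Phi> \<circ>\<^sub>F K) = carrier_fctr \<circ>\<^sub>F K"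
    unfolding fcomp_def carrier_fctr_def PerFun_def Let_def by (auto simp: fun_eq_iff split: prod.splits)
  with L have L': "is_limit_cone J C (carrier_fctr \<circ>\<^sub>F (PerFun C \<Phi> \<circ>\<^sub>F K)) L leg" by simp
  have "is_limit_cone J (PerCat C Q) (PerFun C \<Phi> \<circ>\<^sub>F K) (L, \<Phi> ?I \<tau>)
    (\<lambda>j. ((L, \<Phi> ?I \<tau>), leg j, FObj (PerFun C \<Phi> \<circ>\<^sub>F K) j))"
  proof (rule Q.limit_cone_PerCat[OF K' L'])
    show "\<Phi> ?I \<tau> \<in> Fib Q ?I" using \<tau>_fib LO by simp
    fix c s t
    have "Q.forces1 c ?I (\<Phi> ?I (a j)) \<langle>s, t\<rangle>\<^bsub>C\<^esub> \<longleftrightarrow>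
        Q.forces c (?A j) (?A j) (\<Phi> (?A j \<otimes>\<^bsub>C\<^esub> ?A j) (?\<rho> j)) (leg j \<cdot>\<^bsub>C\<^esub> s) (leg j \<cdot>\<^bsub>C\<^esub> t)"
      if "s \<in> hom C (fst c) L" "t \<in> hom C (fst c) L" "j \<in> Obj J" for j
      unfolding \<Phi>a[OF that(3)] using that leg[OF that(3)] per[OF that(3)] LO by simp
    then show "Q.forces c L L (\<Phi> ?I \<tau>) s t \<longleftrightarrow> Q.stage c \<and> s \<in> hom C (fst c) L \<and> t \<in> hom C (fst c) L \<and>
        (\<forall>j\<in>Obj J. Q.forces c (fst (FObj (PerFun C \<Phi> \<circ>\<^sub>F K) j)) (fst (FObj (PerFun C \<Phi> \<circ>\<^sub>F K) j))
          (snd (FObj (PerFun C \<Phi> \<circ>\<^sub>F K) j)) (leg j \<cdot>\<^bsub>C\<^esub> s) (leg j \<cdot>\<^bsub>C\<^esub> t))"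
      unfolding Q.forces_def[of c L L] \<tau>Q by auto
  qed
  then have "is_limit_cone J (PerCat C Q) (PerFun C \<Phi> \<circ>\<^sub>F K) (FObj (PerFun C \<Phi>) (L, \<tau>))
    (\<lambda>j. FArr (PerFun C \<Phi>) ((L, \<tau>), leg j, FObj K j))" by simp
  ultimately show "is_limit_cone J (PerCat C Q) (PerFun C \<Phi> \<circ>\<^sub>F K) (FObj (PerFun C \<Phi>) M)
      (\<lambda>j. FArr (PerFun C \<Phi>) (leg2 j))"
    using limit_preservation_transport[OF K PerFun_functor] h by blast
qed

end

theorem theorem8p4:
  fixes C :: "('o, 'a) prodcat"
    and P :: "('o, 'a, 'p) ixposet" and Q :: "('o, 'a, 'q) ixposet"
    and \<Phi> :: "'o \<Rightarrow> 'p \<Rightarrow> 'q"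
  assumes "indexed_frame C P" and "indexed_frame C Q" and "cartesian_map C P Q \<Phi>"
  shows "preserves_finite_limits (PerCat C P) (PerCat C Q) (PerFun C \<Phi>)
    \<and> (\<forall>X Y. \<forall>f \<in> hom (PerCat C P) X Y. \<forall>g \<in> hom (PerCat C P) X Y.
         FArr (LocFun C P) f = FArr (LocFun C P) g \<longrightarrow>
         FArr (LocFun C Q) (FArr (PerFun C \<Phi>) f) = FArr (LocFun C Q) (FArr (PerFun C \<Phi>) g))
    \<and> (tripos C P \<longrightarrow>
         (\<exists>R \<eta>. is_right_derived_functor (PerCat C P) (RelCat C P) (LocFun C P)
                  (RelCat C Q) (LocFun C Q) (PerFun C \<Phi>) R \<eta>))
    \<and> (enough_ex_primes C P \<longrightarrow>
         (\<exists>L \<epsilon>. is_left_derived_functor (PerCat C P) (RelCat C P) (LocFun C P)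
                  (RelCat C Q) (LocFun C Q) (PerFun C \<Phi>) L \<epsilon>))"
proof -
  interpret cartesian_frame_map C P Q \<Phi>
    using assms by (rule cartesian_frame_map.intro)
  note E = P.LocFun_functor and G = functor_comp[OF PerFun_functor Q.LocFun_functor]
  have HA: "Obj (RelCat C P) = Obj (PerCat C P)" unfolding RelCat_def PerCat_def by simp
  have coarse: "FArr (LocFun C Q \<circ>\<^sub>F PerFun C \<Phi>) f = FArr (LocFun C Q \<circ>\<^sub>F PerFun C \<Phi>) g"
    if "f \<in> hom (PerCat C P) X Y" "g \<in> hom (PerCat C P) X Y" "FArr (LocFun C P) f = FArr (LocFun C P) g"
    for X Y f g
    using LocFun_PerFun_eq[OF that] by simp
  have "\<exists>R \<eta>. is_right_derived_functor (PerCat C P) (RelCat C P) (LocFun C P)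
      (RelCat C Q) (LocFun C Q) (PerFun C \<Phi>) R \<eta>" if "tripos C P"
    unfolding is_right_derived_functor_def
  proof (rule left_kan_extension_from_replacements[OF E P.LocFun_obj HA G coarse])
    fix X assume "X \<in> Obj (PerCat C P)"
    then show "\<exists>Z i. i \<in> hom (PerCat C P) X Z \<and> iso_arr (RelCat C P) X Z (FArr (LocFun C P) i) \<and>
        (\<forall>Y. \<forall>h\<in>hom (RelCat C P) Y X. \<exists>f\<in>hom (PerCat C P) Y Z.
          FArr (LocFun C P) f = FArr (LocFun C P) i \<cdot>\<^bsub>RelCat C P\<^esub> h)"
      using tripos.power_object_replacement[OF that] by (cases X) simp
  qed
  moreover have "\<exists>L \<epsilon>. is_left_derived_functor (PerCat C P) (RelCat C P) (LocFun C P)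
      (RelCat C Q) (LocFun C Q) (PerFun C \<Phi>) L \<epsilon>" if "enough_ex_primes C P"
    unfolding is_left_derived_functor_def
  proof (rule right_kan_extension_from_replacements[OF E P.LocFun_obj HA G coarse])
    fix X assume "X \<in> Obj (PerCat C P)"
    then show "\<exists>Z p. p \<in> hom (PerCat C P) Z X \<and> iso_arr (RelCat C P) Z X (FArr (LocFun C P) p) \<and>
        (\<forall>Y. \<forall>h\<in>hom (RelCat C P) X Y. \<exists>f\<in>hom (PerCat C P) Z Y.
          FArr (LocFun C P) f = h \<cdot>\<^bsub>RelCat C P\<^esub> FArr (LocFun C P) p)"
      using P.ex_prime_replacement[OF that] by (cases X) simp
  qed
  ultimately show ?thesis
    using PerFun_preserves_finite_limits LocFun_PerFun_eq by blast
qed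

end
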